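(* Let $A$ be a positive self-adjoint operator on $L^2(X,\mu)$ such that $L(t)=\|e^{-tA}\Pi_V\|_{1,\infty}$ is finite for all $t>0$, where $V=L^2(X)\cap(\ker A)^\perp$ and $\Pi_V$ is the orthogonal projection on $V$. Suppose moreover that $M(t)=\int_t^{+\infty}L(u)\,du<+\infty$ for all $t>0$. Then every non-zero $f\in V$ of finite energy $\mathcal{E}(f)=\langle Af,f\rangle_2$ satisfies $$\int_X N\Bigl(\frac{|f(x)|^2}{4\,\mathcal{E}(f)}\Bigr)\,d\mu(x)\le\ln 2,$$ where $N(y)=y/M^{-1}(y)$.
   Context: $(X,\mu)$ is a $\sigma$-finite measure space. A positive self-adjoint operator $A$ is a (possibly unbounded) self-adjoint operator with $\langle Af,f\rangle\ge 0$. $\|P\|_{1,\infty}$ is the norm of $P$ as an operator from $L^1$ to $L^\infty$. The energy is $\mathcal{E}(f)=\|A^{1/2}f\|_2^2$. For the non-increasing function $M$, the inverse is $M^{-1}(y)=\inf\{t>0\mid M(t)\le y\}$ (with $\inf\emptyset=+\infty$), and $N(0)=0$. *)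

theory Defs
  imports "HOL-Probability.Probability"
begin

text \<open>
  Elements of \<open>L\<^sup>2(M)\<close> are represented by square-integrable functions, to be identified when they
  agree almost everywhere.  A (possibly unbounded) operator is represented by its graph, a set of
  pairs \<open>(f, g)\<close> that contains, together with a pair, all pairs of representatives of the same
  classes.  Thus equality of operators (domains included) is equality of sets, the domain is
  \<open>Domain A\<close>, and \<open>R O S\<close> is the composite with natural domain that applies \<open>R\<close> first.
\<close>

definition L2 :: "'a measure \<Rightarrow> ('a \<Rightarrow> complex) set" where
  "L2 M = {f \<in> borel_measurable M. integrable M (\<lambda>x. (cmod (f x))\<^sup>2)}"

definition L2_inner :: "'a measure \<Rightarrow> ('a \<Rightarrow> complex) \<Rightarrow> ('a \<Rightarrow> complex) \<Rightarrow> complex" where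
  "L2_inner M f g = (LINT x|M. f x * cnj (g x))"

definition L2_norm :: "'a measure \<Rightarrow> ('a \<Rightarrow> complex) \<Rightarrow> real" where
  "L2_norm M f = sqrt (LINT x|M. (cmod (f x))\<^sup>2)"

type_synonym 'a oper = "('a \<Rightarrow> complex) rel"

definition lin_operator :: "'a measure \<Rightarrow> 'a oper \<Rightarrow> bool" where
  "lin_operator M A \<longleftrightarrow>
     A \<subseteq> L2 M \<times> L2 M \<and>
     ((\<lambda>_. 0), (\<lambda>_. 0)) \<in> A \<and>
     (\<forall>f g f' g'. (f, g) \<in> A \<longrightarrow> (f', g') \<in> A \<longrightarrow> ((\<lambda>x. f x + f' x), (\<lambda>x. g x + g' x)) \<in> A) \<and>
     (\<forall>c f g. (f, g) \<in> A \<longrightarrow> ((\<lambda>x. c * f x), (\<lambda>x. c * g x)) \<in> A) \<and>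
     (\<forall>f g f' g'. (f, g) \<in> A \<longrightarrow> f' \<in> L2 M \<longrightarrow> g' \<in> L2 M \<longrightarrow>
        (AE x in M. f x = f' x) \<longrightarrow> (AE x in M. g x = g' x) \<longrightarrow> (f', g') \<in> A) \<and>
     (\<forall>f g g'. (f, g) \<in> A \<longrightarrow> (f, g') \<in> A \<longrightarrow> (AE x in M. g x = g' x))"

definition densely_defined :: "'a measure \<Rightarrow> 'a oper \<Rightarrow> bool" where
  "densely_defined M A \<longleftrightarrow>
     (\<forall>h\<in>L2 M. \<forall>e>0. \<exists>f\<in>Domain A. L2_norm M (\<lambda>x. h x - f x) < e)"

definition adjoint_op :: "'a measure \<Rightarrow> 'a oper \<Rightarrow> 'a oper" where
  "adjoint_op M A = {(f, h). f \<in> L2 M \<and> h \<in> L2 M \<and>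
     (\<forall>(u, v)\<in>A. L2_inner M v f = L2_inner M u h)}"

definition self_adjoint :: "'a measure \<Rightarrow> 'a oper \<Rightarrow> bool" where
  "self_adjoint M A \<longleftrightarrow> lin_operator M A \<and> densely_defined M A \<and> adjoint_op M A = A"

text \<open>For self-adjoint \<open>A\<close> the number \<open>\<langle>Af, f\<rangle>\<close> is automatically real.\<close>

definition positive_self_adjoint :: "'a measure \<Rightarrow> 'a oper \<Rightarrow> bool" where
  "positive_self_adjoint M A \<longleftrightarrow> self_adjoint M A \<and> (\<forall>(f, g)\<in>A. 0 \<le> Re (L2_inner M g f))"

text \<open>\<open>A\<^sup>1\<^sup>/\<^sup>2\<close>, the unique positive self-adjoint square root of a positive self-adjoint \<open>A\<close>.\<close>

definition sqrt_op :: "'a measure \<Rightarrow> 'a oper \<Rightarrow> 'a oper" where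
  "sqrt_op M A = (THE B. positive_self_adjoint M B \<and> B O B = A)"

text \<open>
  The infimum ranges over the representatives \<open>g\<close> of the single class \<open>A\<^sup>1\<^sup>/\<^sup>2 f\<close>; it is \<open>\<infinity>\<close>
  exactly when \<open>f\<close> is outside the domain of \<open>A\<^sup>1\<^sup>/\<^sup>2\<close>.
\<close>

definition energy :: "'a measure \<Rightarrow> 'a oper \<Rightarrow> ('a \<Rightarrow> complex) \<Rightarrow> ennreal" where
  "energy M A f = (INF g\<in>sqrt_op M A `` {f}. ennreal ((L2_norm M g)\<^sup>2))"

definition bounded_operator :: "'a measure \<Rightarrow> 'a oper \<Rightarrow> bool" where
  "bounded_operator M P \<longleftrightarrow> lin_operator M P \<and> Domain P = L2 M \<and>
     (\<exists>C. \<forall>(f, g)\<in>P. L2_norm M g \<le> C * L2_norm M f)"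

text \<open>A representative of the class \<open>P f\<close>, for \<open>f\<close> in the domain of \<open>P\<close>.\<close>

definition op_apply :: "'a oper \<Rightarrow> ('a \<Rightarrow> complex) \<Rightarrow> 'a \<Rightarrow> complex" where
  "op_apply P f = (SOME g. (f, g) \<in> P)"

definition C0_semigroup :: "'a measure \<Rightarrow> (real \<Rightarrow> 'a oper) \<Rightarrow> bool" where
  "C0_semigroup M T \<longleftrightarrow>
     (\<forall>t\<ge>0. bounded_operator M (T t)) \<and>
     (\<forall>f\<in>L2 M. (f, f) \<in> T 0) \<and>
     (\<forall>s\<ge>0. \<forall>t\<ge>0. T (s + t) = T s O T t) \<and>
     (\<forall>f\<in>L2 M. ((\<lambda>t. L2_norm M (\<lambda>x. op_apply (T t) f x - f x)) \<longlongrightarrow> 0) (at_right 0))"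

definition generator :: "'a measure \<Rightarrow> (real \<Rightarrow> 'a oper) \<Rightarrow> 'a oper" where
  "generator M T = {(f, g). f \<in> L2 M \<and> g \<in> L2 M \<and>
     ((\<lambda>t. L2_norm M (\<lambda>x. (op_apply (T t) f x - f x) / complex_of_real t - g x)) \<longlongrightarrow> 0)
       (at_right 0)}"

definition neg_op :: "'a oper \<Rightarrow> 'a oper" where
  "neg_op A = {(f, (\<lambda>x. - g x)) | f g. (f, g) \<in> A}"

text \<open>
  \<open>e\<^sup>-\<^sup>t\<^sup>A\<close> for \<open>t \<ge> 0\<close>: the value at time \<open>t\<close> of the strongly continuous semigroup with generator
  \<open>-A\<close>.  Such a family \<open>T\<close> is determined at nonnegative times only, so the description is
  applied to its value at \<open>t\<close> and not to \<open>T\<close> itself.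
\<close>

definition exp_neg_op :: "'a measure \<Rightarrow> real \<Rightarrow> 'a oper \<Rightarrow> 'a oper" where
  "exp_neg_op M t A =
     (THE P. \<exists>T. C0_semigroup M T \<and> generator M T = neg_op A \<and> P = T t)"

definition ker_op :: "'a oper \<Rightarrow> ('a \<Rightarrow> complex) set" where
  "ker_op A = {f. (f, (\<lambda>_. 0)) \<in> A}"

definition orth_compl :: "'a measure \<Rightarrow> ('a \<Rightarrow> complex) set \<Rightarrow> ('a \<Rightarrow> complex) set" where
  "orth_compl M S = {f \<in> L2 M. \<forall>h\<in>S. L2_inner M f h = 0}"

definition orth_proj :: "'a measure \<Rightarrow> ('a \<Rightarrow> complex) set \<Rightarrow> 'a oper" where
  "orth_proj M V = {(f, g). f \<in> L2 M \<and> g \<in> V \<and> (\<lambda>x. f x - g x) \<in> orth_compl M V}"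

text \<open>
  The norm of \<open>P\<close> as an operator from \<open>L\<^sup>1\<close> to \<open>L\<^sup>\<infinity>\<close>, computed on the dense subspace
  \<open>L\<^sup>1 \<inter> Domain P\<close> of \<open>L\<^sup>1\<close> (\<open>P\<close> being a bounded operator on \<open>L\<^sup>2\<close>); it is \<open>\<infinity>\<close> if \<open>P\<close> does not
  extend boundedly.
\<close>

definition norm_1_inf :: "'a measure \<Rightarrow> 'a oper \<Rightarrow> ennreal" where
  "norm_1_inf M P =
     (SUP (f, g)\<in>{(f, g). (f, g) \<in> P \<and> integrable M f \<and> (LINT x|M. cmod (f x)) \<le> 1}.
        esssup M (\<lambda>x. ennreal (cmod (g x))))"

definition V_space :: "'a measure \<Rightarrow> 'a oper \<Rightarrow> ('a \<Rightarrow> complex) set" where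
  "V_space M A = orth_compl M (ker_op A)"

definition heat_L :: "'a measure \<Rightarrow> 'a oper \<Rightarrow> real \<Rightarrow> ennreal" where
  "heat_L M A t = norm_1_inf M (orth_proj M (V_space M A) O exp_neg_op M t A)"

definition heat_M :: "'a measure \<Rightarrow> 'a oper \<Rightarrow> real \<Rightarrow> ennreal" where
  "heat_M M A t = (\<integral>\<^sup>+u\<in>{t<..}. heat_L M A u \<partial>lborel)"

text \<open>In \<open>ennreal\<close>, \<open>Inf {} = \<infinity>\<close>.\<close>

definition heat_M_inv :: "'a measure \<Rightarrow> 'a oper \<Rightarrow> ennreal \<Rightarrow> ennreal" where
  "heat_M_inv M A y = Inf {ennreal t | t. 0 < t \<and> heat_M M A t \<le> y}"

text \<open>
  For \<open>y > 0\<close>, division in \<open>ennreal\<close> gives \<open>y / \<infinity> = 0\<close> (\<open>y\<close> finite) and \<open>y / 0 = \<infinity>\<close>.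
\<close>

definition heat_N :: "'a measure \<Rightarrow> 'a oper \<Rightarrow> ennreal \<Rightarrow> ennreal" where
  "heat_N M A y = (if y = 0 then 0 else y / heat_M_inv M A y)"

end

theory Submission
  imports Defs "HOL-Computational_Algebra.Polynomial" "HOL-Real_Asymp.Real_Asymp"
begin

text \<open>
  Write \<open>T\<^sub>t = e\<^sup>-\<^sup>t\<^sup>A\<close> and \<open>E = \<E>(f)\<close>.  Two facts about \<open>T\<close> suffice.  First,
  \<open>\<langle>f - T\<^sub>t f, f\<rangle> \<le> t E\<close>.  Secondly, \<open>|T\<^sub>t f|\<^sup>2 \<le> M(2t) E\<close> almost everywhere: if
  \<open>\<parallel>g\<parallel>\<^sub>1 \<le> 1\<close> and \<open>h = T\<^sub>t \<Pi>\<^sub>V g\<close>, then \<open>\<langle>T\<^sub>t f, g\<rangle> = \<langle>f, h\<rangle>\<close> is the energy product of \<open>f\<close>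
  with \<open>\<integral>\<^sub>0\<^sup>\<infinity> T\<^sub>s h ds\<close>, whose energy is \<open>\<integral>\<^sub>0\<^sup>\<infinity> \<langle>T\<^sub>s h, h\<rangle> ds \<le> \<integral>\<^sub>0\<^sup>\<infinity> L(2t + s) ds\<close>.

  With \<open>y = |f|\<^sup>2 / (4E)\<close>, \<open>N(y)\<close> is the integral of \<open>y / s\<^sup>2\<close> over \<open>s > M\<^sup>-\<^sup>1(y)\<close>.  For such \<open>s\<close> one has
  \<open>|T\<^sub>s\<^sub>/\<^sub>2 f| \<le> |f| / 2\<close>, hence \<open>y E \<le> |f - T\<^sub>s\<^sub>/\<^sub>2 f|\<^sup>2\<close>, and the left-hand side is at most
  \<open>E\<^sup>-\<^sup>1 \<integral>\<^sub>0\<^sup>\<infinity> \<parallel>f - T\<^sub>s\<^sub>/\<^sub>2 f\<parallel>\<^sup>2 s\<^sup>-\<^sup>2 ds\<close>.  With \<open>\<psi>(t) = \<langle>f - T\<^sub>t f, f\<rangle>\<close> the squared norm is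
  \<open>2 \<psi>(s/2) - \<psi>(s)\<close>; the integral telescopes and is at most \<open>E ln 2\<close> because \<open>\<psi>(t) \<le> t E\<close>.

  Existence and uniqueness of \<open>A\<^sup>1\<^sup>/\<^sup>2\<close> and \<open>T\<close> come from a continuous functional calculus for
  \<open>R = (1 + A)\<^sup>-\<^sup>1\<close>, in which \<open>A\<^sup>1\<^sup>/\<^sup>2 = {(R\<^sup>1\<^sup>/\<^sup>2 x, (1 - R)\<^sup>1\<^sup>/\<^sup>2 x)}\<close> and \<open>T\<^sub>t = exp (- t (1 - R) / R)\<close>.
\<close>

section \<open>A continuous functional calculus\<close>

text \<open>\<open>sqrt_op\<close> and \<open>exp_neg_op\<close> are definite descriptions, so
  nothing can be said about either of them before existence and uniqueness are settled; this
  accounts for most of the length. No spectral measure is used. Passing from A to (1 + A)^-1 moves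
  the spectrum into [0, 1], and the whole calculus there rests on one fact: a polynomial that is
  nonnegative on [0, 1] gives a nonnegative operator. The abstract theory is real: the inner product
  is Re <f, g>. Complex linearity survives as commutation with multiplication by i, a property that
  every function of the resolvent inherits. In the heat kernel bound no integral of a vector-valued
  function is formed. Riemann sums and a telescoping identity take its place, so that only integrals
  of numerical functions occur. The 4 in the statement is the square of the 2 in the threshold
  |f|/2. The number ln 2 is the integral of 1/s over [e/2, e], the only part that the dilation of s
  by 1/2 leaves over. Membership of f in V means that <T_t f, g> sees only the component of g in V,
  and this component dies out under the heat flow.\<close>

definition poly_op :: "('h::real_normed_vector \<Rightarrow>\<^sub>L 'h) \<Rightarrow> real poly \<Rightarrow> 'h \<Rightarrow>\<^sub>L 'h" where
  "poly_op R p = fold_coeffs (\<lambda>a X. a *\<^sub>R id_blinfun + (R o\<^sub>L X)) p 0"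

lemma poly_op_0 [simp]: "poly_op R 0 = 0"
  by (simp add: poly_op_def)

lemma poly_op_pCons [simp]: "poly_op R (pCons a p) = a *\<^sub>R id_blinfun + (R o\<^sub>L poly_op R p)"
  by (cases "p = 0 \<and> a = 0") (auto simp: poly_op_def)

lemma poly_op_1 [simp]: "poly_op R 1 = id_blinfun"
  by (auto intro!: blinfun_eqI simp: one_pCons blinfun.bilinear_simps)

lemma poly_op_add: "poly_op R (p + q) = poly_op R p + poly_op R q"
  by (induction p q rule: poly_induct2)
     (auto intro!: blinfun_eqI simp: blinfun.bilinear_simps scaleR_left_distrib)

lemma poly_op_smult: "poly_op R (smult c p) = c *\<^sub>R poly_op R p"
  by (induction p) (auto intro!: blinfun_eqI simp: blinfun.bilinear_simps scaleR_right_distrib)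

lemma poly_op_diff: "poly_op R (p - q) = poly_op R p - poly_op R q"
  using poly_op_add[of R p "smult (-1) q"] poly_op_smult[of R "-1" q] by simp

lemma poly_op_sum: "poly_op R (sum p I) = (\<Sum>i\<in>I. poly_op R (p i))"
  by (induction I rule: infinite_finite_induct) (auto simp: poly_op_add)

lemma poly_op_mult: "poly_op R (p * q) = poly_op R p o\<^sub>L poly_op R q"
  by (induction p)
     (auto intro!: blinfun_eqI simp: blinfun.bilinear_simps poly_op_add poly_op_smult)

lemma poly_op_commute:
  assumes "X o\<^sub>L R = R o\<^sub>L X"
  shows "X o\<^sub>L poly_op R p = poly_op R p o\<^sub>L X"
proof (induction p)
  case (pCons a p)
  have 1: "X (R x) = R (X x)" for x
    using arg_cong[OF assms, of "\<lambda>Y. Y x"] by simp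
  have 2: "X (poly_op R p x) = poly_op R p (X x)" for x
    using arg_cong[OF pCons.IH, of "\<lambda>Y. Y x"] by simp
  show ?case
    by (intro blinfun_eqI) (simp add: blinfun.bilinear_simps 1 2)
qed (auto intro: blinfun_eqI)

section \<open>Polynomials in Bernstein form\<close>

text \<open>The coefficient sequence is arbitrary so that two cases fall under one definition:
  samples c k = f(k/n), which give the Bernstein approximant of f, and the exact Bernstein
  coefficients of a given polynomial.\<close>

definition bern_poly :: "nat \<Rightarrow> (nat \<Rightarrow> real) \<Rightarrow> real poly" where
  "bern_poly n c = (\<Sum>k\<le>n. smult (c k * of_nat (n choose k)) ([:0, 1:] ^ k * [:1, -1:] ^ (n - k)))"

lemma poly_bern_poly: "poly (bern_poly n c) x = (\<Sum>k\<le>n. c k * Bernstein n k x)"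
  by (simp add: bern_poly_def poly_sum Bernstein_def mult.assoc)

lemma bern_poly_add: "bern_poly n (\<lambda>k. c k + d k) = bern_poly n c + bern_poly n d"
  by (rule poly_eqI) (simp add: bern_poly_def sum.distrib coeff_sum algebra_simps flip: sum.distrib)

lemma bern_poly_smult: "bern_poly n (\<lambda>k. a * c k) = smult a (bern_poly n c)"
  by (rule poly_eqI) (simp add: bern_poly_def coeff_sum sum_distrib_left algebra_simps)

lemma bern_poly_sum: "bern_poly n (\<lambda>k. \<Sum>i\<in>I. c i k) = (\<Sum>i\<in>I. bern_poly n (c i))"
proof (induction I rule: infinite_finite_induct)
  case (insert i I)
  then show ?case by (simp add: bern_poly_add)
qed (simp_all add: bern_poly_def)

text \<open>Absorption k (n choose k) = n (n - 1 choose k - 1), iterated j times. It identifies the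
  Bernstein coefficients of a monomial.\<close>

lemma binomial_falling_factorial:
  assumes "j \<le> k" "k \<le> n"
  shows "real (n choose k) * (\<Prod>i<j. (real k - real i)) =
         real ((n - j) choose (k - j)) * (\<Prod>i<j. (real n - real i))"
  using assms(1)
proof (induction j)
  case (Suc j)
  have "k - j = Suc (k - Suc j)" "n - j = Suc (n - Suc j)"
    using Suc.prems assms(2) by auto
  then have "(k - j) * ((n - j) choose (k - j)) = (n - j) * ((n - Suc j) choose (k - Suc j))"
    by (metis Suc_times_binomial)
  then have "real (k - j) * real ((n - j) choose (k - j))
      = real (n - j) * real ((n - Suc j) choose (k - Suc j))"
    by (metis of_nat_mult)
  then have *: "(real k - real j) * real ((n - j) choose (k - j))
      = (real n - real j) * real ((n - Suc j) choose (k - Suc j))"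
    using Suc.prems assms(2) by (simp add: of_nat_diff)
  have "real (n choose k) * (\<Prod>i<Suc j. (real k - real i))
      = (real (n choose k) * (\<Prod>i<j. (real k - real i))) * (real k - real j)"
    by simp
  also have "\<dots> = (\<Prod>i<j. (real n - real i)) * ((real k - real j) * real ((n - j) choose (k - j)))"
    using Suc by simp
  also have "\<dots> = real ((n - Suc j) choose (k - Suc j)) * (\<Prod>i<Suc j. (real n - real i))"
    unfolding * by simp
  finally show ?case .
qed simp

text \<open>Degree elevation: x^j is multiplied by (x + (1 - x))^(n - j) = 1 and expanded. The term
  x^k (1 - x)^(n - k) then has the coefficient (n - j choose k - j), which is (n choose k) times a
  ratio of falling factorials.\<close>

lemma monom_eq_bern_poly:
  assumes "j \<le> n"
  shows "monom 1 j = bern_poly n (\<lambda>k. \<Prod>i<j. (real k - real i) / (real n - real i))"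
proof -
  let ?X = "[:0, 1:] :: real poly" and ?Y = "[:1, -1:] :: real poly"
  let ?c = "\<lambda>k. \<Prod>i<j. (real k - real i) / (real n - real i)"
  have nz: "(\<Prod>i<j. (real n - real i)) \<noteq> 0"
    using assms by (simp add: prod_zero_iff)
  have c: "?c k * real (n choose k) = real ((n - j) choose (k - j))" if "j \<le> k" "k \<le> n" for k
    using binomial_falling_factorial[OF that] nz by (simp add: prod_dividef field_simps)
  have c0: "?c k = 0" if "k < j" for k
    using that by (auto simp: prod_zero_iff)
  have "?X + ?Y = 1" by (simp add: one_pCons)
  then have "monom 1 j = ?X ^ j * (?X + ?Y) ^ (n - j)"
    by (simp only: monom_altdef power_one mult_1_right smult_1_left)
  also have "\<dots> = (\<Sum>m\<le>n-j. smult (of_nat ((n-j) choose m)) (?X ^ (m+j) * ?Y ^ (n - (m + j))))"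
    unfolding binomial_ring sum_distrib_left
  proof (rule sum.cong[OF refl])
    fix m assume "m \<in> {..n-j}"
    then have "n - j - m = n - (m + j)" by auto
    then show "?X ^ j * (of_nat (n - j choose m) * ?X ^ m * ?Y ^ (n - j - m)) =
      smult (of_nat (n - j choose m)) (?X ^ (m + j) * ?Y ^ (n - (m + j)))"
      by (simp add: power_add of_nat_poly mult_ac)
  qed
  also have "\<dots> = (\<Sum>k\<in>{j..n}. smult (of_nat ((n-j) choose (k-j))) (?X ^ k * ?Y ^ (n - k)))"
    by (rule sum.reindex_bij_witness[of _ "\<lambda>k. k - j" "\<lambda>m. m + j"]) (use assms in auto)
  also have "\<dots> = (\<Sum>k\<in>{j..n}. smult (?c k * of_nat (n choose k)) (?X ^ k * ?Y ^ (n - k)))"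
    by (rule sum.cong) (auto simp: c)
  \<comment> \<open>For k < j the product contains the factor with i = k, which is 0, so the
    summation may start at 0.\<close>
  also have "\<dots> = bern_poly n ?c"
    unfolding bern_poly_def by (rule sum.mono_neutral_left) (auto simp: c0)
  finally show ?thesis .
qed

text \<open>The Bernstein coefficients of x^j differ from the samples of x^j at k/n by O(1/n),
  because the two products differ in each factor by at most d/(n - d). The condition 2 d < n keeps
  every factor in [-1, 1], also the negative ones with k < i, as \<open>norm_prod_diff\<close>
  demands.\<close>

lemma falling_factorial_power_diff:
  assumes "k \<le> n" "2 * d < n" "j \<le> d"
  shows "\<bar>(\<Prod>i<j. (real k - real i) / (real n - real i)) - (real k / real n) ^ j\<bar>
         \<le> real d * (real d / (real n - real d))"
proof -
  have pos: "0 < real n - real i" if "i < j" for i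
    using assms that by simp
  have "\<bar>(\<Prod>i<j. (real k - real i) / (real n - real i)) - (\<Prod>i<j. real k / real n)\<bar>
      \<le> (\<Sum>i<j. \<bar>(real k - real i) / (real n - real i) - real k / real n\<bar>)"
    unfolding real_norm_def[symmetric]
    by (rule norm_prod_diff) (use assms pos in \<open>auto simp: divide_le_eq_1 abs_le_iff divide_simps\<close>)
  also have "\<dots> \<le> (\<Sum>i<j. real d / (real n - real d))"
  proof (rule sum_mono)
    fix i assume "i \<in> {..<j}"
    then have i: "i < j" by simp
    have "(real k - real i) / (real n - real i) - real k / real n
        = - (real i / (real n - real i)) * ((real n - real k) / real n)"
      using pos[OF i] assms by (simp add: divide_simps) (simp add: algebra_simps)
    then have "\<bar>(real k - real i) / (real n - real i) - real k / real n\<bar>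
        = (real i / (real n - real i)) * ((real n - real k) / real n)"
      using pos[OF i] assms by (simp add: abs_mult)
    also have "\<dots> \<le> (real i / (real n - real i)) * 1"
      using pos[OF i] assms by (intro mult_left_mono) auto
    also have "\<dots> \<le> real d / (real n - real d)"
      using i assms by (simp add: frac_le)
    finally show "\<bar>(real k - real i) / (real n - real i) - real k / real n\<bar> \<le> real d / (real n - real d)" .
  qed
  also have "\<dots> \<le> real d * (real d / (real n - real d))"
    using assms by (simp add: mult_right_mono divide_right_mono)
  finally show ?thesis by simp
qed

lemma ratio_unit_interval: "k \<le> n \<Longrightarrow> 0 \<le> real k / real n \<and> real k / real n \<le> 1"
  by (cases "n = 0") (auto simp: divide_le_eq_1)

section \<open>Functional calculus of an operator between 0 and 1\<close>

text \<open>The intended instance is the resolvent (1 + A)^-1: functions of the unbounded operator A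
  become functions on a compact interval.\<close>

locale unit_op =
  fixes R :: "'h::{real_inner,banach} \<Rightarrow>\<^sub>L 'h"
  assumes sym: "R x \<bullet> y = x \<bullet> R y"
    and nonneg: "0 \<le> R x \<bullet> x"
    and le: "R x \<bullet> x \<le> x \<bullet> x"
begin

lemma poly_op_sym: "poly_op R p x \<bullet> y = x \<bullet> poly_op R p y"
proof (induction p arbitrary: x y)
  case (pCons a p)
  have "R (poly_op R p y) = poly_op R p (R y)" for y
    using arg_cong[OF poly_op_commute[of R R p], of "\<lambda>Y. Y y"] by simp
  then show ?case
    using pCons by (simp add: blinfun.bilinear_simps inner_left_distrib inner_right_distrib sym)
qed simp

text \<open>Half of the even part of each power is moved to the other side by symmetry. What remains
  in the middle is one of 1, R, 1 - R and R (1 - R).\<close>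

lemma poly_op_bernstein_nonneg: "0 \<le> poly_op R ([:0, 1:] ^ i * [:1, -1:] ^ j) x \<bullet> x"
proof -
  let ?P = "\<lambda>i j. poly_op R ([:0, 1:] ^ i * [:1, -1:] ^ j)"
  \<comment> \<open>R (1 - R) = (1 - R) R (1 - R) + R (1 - R) R, and both terms are
    nonnegative.\<close>
  have sq: "R x \<bullet> R x \<le> R x \<bullet> x" for x
  proof -
    have "R x \<bullet> x - R x \<bullet> R x = R (x - R x) \<bullet> (x - R x) + (R x \<bullet> R x - R (R x) \<bullet> R x)"
      by (simp add: blinfun.bilinear_simps inner_diff_left inner_diff_right sym)
    also have "\<dots> \<ge> 0" using nonneg[of "x - R x"] le[of "R x"] by simp
    finally show ?thesis by simp
  qed
  have base: "0 \<le> ?P e e' x \<bullet> x" if "e \<in> {0,1}" "e' \<in> {0,1}" for e e' x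
    using that nonneg[of x] le[of x] sq[of x]
    by (auto simp: blinfun.bilinear_simps inner_diff_left sym)
  have "[:0, 1:] ^ i * [:1, -1:] ^ j
      = ([:0, 1:] ^ (i div 2) * [:1, -1::real:] ^ (j div 2)) *
        ([:0, 1:] ^ (i mod 2) * [:1, -1:] ^ (j mod 2)) * ([:0, 1:] ^ (i div 2) * [:1, -1:] ^ (j div 2))"
  proof -
    have "z ^ m = z ^ (m div 2) * z ^ (m mod 2) * z ^ (m div 2)" for z :: "real poly" and m
    proof -
      have "m = m div 2 + m mod 2 + m div 2" by presburger
      then show ?thesis by (metis power_add)
    qed
    from arg_cong2[where f = "(*)", OF this[of "[:0, 1:]" i] this[of "[:1, -1:]" j]] show ?thesis
      by (simp only: mult_ac)
  qed
  then have "?P i j = (?P (i div 2) (j div 2)) o\<^sub>L (?P (i mod 2) (j mod 2)) o\<^sub>L (?P (i div 2) (j div 2))"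
    by (simp only: poly_op_mult)
  then have "?P i j x \<bullet> x
      = ?P (i mod 2) (j mod 2) (?P (i div 2) (j div 2) x) \<bullet> ?P (i div 2) (j div 2) x"
    by (simp only: blinfun_apply_blinfun_compose poly_op_sym)
  also have "\<dots> \<ge> 0" by (rule base) auto
  finally show ?thesis .
qed

lemma bern_poly_op_mono:
  assumes "\<And>k. k \<le> n \<Longrightarrow> c k \<le> d k"
  shows "poly_op R (bern_poly n c) x \<bullet> x \<le> poly_op R (bern_poly n d) x \<bullet> x"
proof -
  have "poly_op R (bern_poly n c) x \<bullet> x
      = (\<Sum>k\<le>n. c k * (real (n choose k) * (poly_op R ([:0, 1:] ^ k * [:1, -1:] ^ (n - k)) x \<bullet> x)))" for c
    by (simp only: bern_poly_def poly_op_sum poly_op_smult blinfun.sum_left blinfun.scaleR_left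
        inner_sum_left inner_scaleR_left mult.assoc)
  then show ?thesis
    using assms by (auto intro!: sum_mono mult_right_mono mult_nonneg_nonneg poly_op_bernstein_nonneg)
qed

lemma bern_poly_op_const: "poly_op R (bern_poly n (\<lambda>_. c)) x = c *\<^sub>R x"
proof -
  have "bern_poly n (\<lambda>_. c * 1) = smult c (monom 1 0)"
    unfolding bern_poly_smult by (subst monom_eq_bern_poly[of 0 n]) auto
  then have "bern_poly n (\<lambda>_. c) = [:c:]" by (simp add: monom_0)
  then show ?thesis by (simp add: blinfun.bilinear_simps)
qed

text \<open>As n grows, the Bernstein coefficients of p approach the samples p(k/n) \<ge> 0, so they
  are bounded below by -O(1/n). Since the Bernstein basis gives nonnegative operators, the form of
  p(R) has a lower bound of the same order, which tends to 0.\<close>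

lemma poly_op_nonneg:
  assumes "\<And>r. 0 \<le> r \<Longrightarrow> r \<le> 1 \<Longrightarrow> 0 \<le> poly p r"
  shows "0 \<le> poly_op R p x \<bullet> x"
proof -
  have gen: "a * (u - v) \<le> \<bar>a\<bar> * \<bar>v - u\<bar>" for a u v :: real
    by (metis abs_ge_self abs_minus_commute abs_mult)
  define d where "d = degree p"
  define s where "s = (\<Sum>j\<le>d. \<bar>coeff p j\<bar>)"
  have "- (s * (real d * (real d / (real n - real d)))) * (x \<bullet> x) \<le> poly_op R p x \<bullet> x"
    if n: "2 * d < n" for n
  proof -
    define c where "c = (\<lambda>k. \<Sum>j\<le>d. coeff p j * (\<Prod>i<j. (real k - real i) / (real n - real i)))"
    let ?e = "real d * (real d / (real n - real d))"
    have "p = (\<Sum>j\<le>d. smult (coeff p j) (monom 1 j))"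
      by (simp add: d_def poly_as_sum_of_monoms smult_monom)
    also have "\<dots> = bern_poly n c"
      using n unfolding c_def bern_poly_sum bern_poly_smult
      by (intro sum.cong refl arg_cong[where f = "smult _"] monom_eq_bern_poly) auto
    finally have p: "p = bern_poly n c" .
    have "- (s * ?e) \<le> c k" if k: "k \<le> n" for k
    proof -
      have "0 \<le> poly p (real k / real n)"
        using assms k n by (simp add: divide_le_eq_1)
      also have "\<dots> = (\<Sum>j\<le>d. coeff p j * (real k / real n) ^ j)"
        by (simp add: poly_altdef d_def)
      finally have "- c k \<le> (\<Sum>j\<le>d. coeff p j * (real k / real n) ^ j) - c k" by simp
      also have "\<dots> = (\<Sum>j\<le>d. coeff p j * ((real k / real n) ^ j - (\<Prod>i<j. (real k - real i) / (real n - real i))))"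
        unfolding c_def by (simp add: sum_subtractf algebra_simps)
      also have "\<dots> \<le> (\<Sum>j\<le>d. \<bar>coeff p j\<bar> * ?e)"
      proof (rule sum_mono)
        fix j assume "j \<in> {..d}"
        have "coeff p j * ((real k / real n) ^ j - (\<Prod>i<j. (real k - real i) / (real n - real i)))
          \<le> \<bar>coeff p j\<bar> * \<bar>(\<Prod>i<j. (real k - real i) / (real n - real i)) - (real k / real n) ^ j\<bar>"
          by (rule gen)
        also have "\<dots> \<le> \<bar>coeff p j\<bar> * ?e"
          using \<open>j \<in> {..d}\<close> n k by (intro mult_left_mono falling_factorial_power_diff) auto
        finally show "coeff p j * ((real k / real n) ^ j - (\<Prod>i<j. (real k - real i) / (real n - real i)))
          \<le> \<bar>coeff p j\<bar> * ?e" .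
      qed
      also have "\<dots> = s * ?e" by (simp only: s_def sum_distrib_right)
      finally show ?thesis by simp
    qed
    then have "poly_op R (bern_poly n (\<lambda>_. - (s * ?e))) x \<bullet> x \<le> poly_op R (bern_poly n c) x \<bullet> x"
      by (rule bern_poly_op_mono)
    then show ?thesis
      by (simp add: p[symmetric] bern_poly_op_const)
  qed
  then have ev: "\<forall>\<^sub>F n in sequentially. - (s * (real d * (real d / (real n - real d)))) * (x \<bullet> x) \<le> poly_op R p x \<bullet> x"
    by (intro eventually_sequentiallyI[of "2 * d + 1"]) auto
  have lim: "(\<lambda>n. - (s * (real d * (real d / (real n - real d)))) * (x \<bullet> x)) \<longlonglongrightarrow> 0"
    by real_asymp
  show ?thesis by (rule tendsto_upperbound[OF lim ev]) simp
qed

text \<open>The squared norm of p(R) x is the form of p^2 at x, and M^2 - p^2 is nonnegative on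
  [0, 1].\<close>

lemma poly_op_norm_le:
  assumes "\<And>r. 0 \<le> r \<Longrightarrow> r \<le> 1 \<Longrightarrow> \<bar>poly p r\<bar> \<le> M"
  shows "norm (poly_op R p) \<le> M"
proof -
  have M: "0 \<le> M" using assms[of 0] by simp
  have "norm (poly_op R p x) \<le> M * norm x" for x
  proof -
    have "(norm (poly_op R p x))\<^sup>2 = poly_op R (p * p) x \<bullet> x"
      by (simp add: power2_norm_eq_inner poly_op_mult poly_op_sym)
    also have "\<dots> \<le> M\<^sup>2 * (x \<bullet> x)"
    proof -
      have "0 \<le> poly_op R ([:M\<^sup>2:] - p * p) x \<bullet> x"
      proof (rule poly_op_nonneg)
        fix r :: real assume "0 \<le> r" "r \<le> 1"
        then have "(poly p r)\<^sup>2 \<le> M\<^sup>2"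
          using assms[of r] M by (metis abs_le_square_iff abs_of_nonneg)
        then show "0 \<le> poly ([:M\<^sup>2:] - p * p) r" by (simp add: power2_eq_square)
      qed
      then show ?thesis
        by (simp add: poly_op_diff blinfun.bilinear_simps inner_diff_left)
    qed
    also have "\<dots> = (M * norm x)\<^sup>2"
      by (simp add: power_mult_distrib power2_norm_eq_inner)
    finally show ?thesis by (rule power2_le_imp_le) (use M in simp)
  qed
  with M show ?thesis by (intro norm_blinfun_bound)
qed

text \<open>The explicit approximants sample f only at points of [0, 1], so values of f outside the
  interval never matter; this is what makes \<open>fcalc_cong\<close> available.\<close>

definition fcalc :: "(real \<Rightarrow> real) \<Rightarrow> 'h \<Rightarrow>\<^sub>L 'h" where
  "fcalc f = lim (\<lambda>n. poly_op R (bern_poly n (\<lambda>k. f (real k / real n))))"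

lemma uniform_limit_bern_poly:
  assumes "continuous_on {0..1} f"
  shows "uniform_limit {0..1} (\<lambda>n. poly (bern_poly n (\<lambda>k. f (real k / real n)))) f sequentially"
proof (rule uniform_limitI)
  fix e :: real assume "0 < e"
  from Bernstein_Weierstrass[OF assms this] obtain N where
    "\<And>n x. N \<le> n \<Longrightarrow> x \<in> {0..1} \<Longrightarrow> \<bar>f x - (\<Sum>k\<le>n. f(k/n) * Bernstein n k x)\<bar> < e"
    by blast
  then show "\<forall>\<^sub>F n in sequentially. \<forall>x\<in>{0..1}. dist (poly (bern_poly n (\<lambda>k. f (real k / real n))) x) (f x) < e"
    by (intro eventually_sequentiallyI[of N]) (auto simp: poly_bern_poly dist_real_def abs_minus_commute)
qed

lemma poly_op_Cauchy:
  assumes "uniform_limit {0..1} (\<lambda>n. poly (p n)) f sequentially"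
  shows "Cauchy (\<lambda>n. poly_op R (p n))"
proof (rule CauchyI)
  fix e :: real assume e: "0 < e"
  have "\<forall>\<^sub>F n in sequentially. \<forall>x\<in>{0..1}. dist (poly (p n) x) (f x) < e / 4"
    using assms e by (intro uniform_limitD) auto
  then obtain N where N: "\<And>n x. N \<le> n \<Longrightarrow> x \<in> {0..1} \<Longrightarrow> dist (poly (p n) x) (f x) < e / 4"
    unfolding eventually_sequentially by blast
  have "norm (poly_op R (p m) - poly_op R (p n)) < e" if "N \<le> m" "N \<le> n" for m n
  proof -
    have "norm (poly_op R (p m - p n)) \<le> e / 2"
    proof (rule poly_op_norm_le)
      fix r :: real assume "0 \<le> r" "r \<le> 1"
      then show "\<bar>poly (p m - p n) r\<bar> \<le> e / 2"
        using dist_triangle2[of "poly (p m) r" "poly (p n) r" "f r"] N[OF that(1), of r] N[OF that(2), of r]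
        by (simp add: dist_real_def)
    qed
    then show ?thesis using e by (simp add: poly_op_diff)
  qed
  then show "\<exists>N. \<forall>m\<ge>N. \<forall>n\<ge>N. norm (poly_op R (p m) - poly_op R (p n)) < e" by blast
qed

text \<open>The norm bound for polynomials makes the limit independent of the approximating
  sequence. Hence a product may be approximated by the product of the approximants, and a polynomial
  by itself.\<close>

lemma fcalc_LIMSEQ:
  assumes "continuous_on {0..1} f" and p: "uniform_limit {0..1} (\<lambda>n. poly (p n)) f sequentially"
  shows "(\<lambda>n. poly_op R (p n)) \<longlonglongrightarrow> fcalc f"
proof -
  define q where "q = (\<lambda>n. bern_poly n (\<lambda>k. f (real k / real n)))"
  have q: "uniform_limit {0..1} (\<lambda>n. poly (q n)) f sequentially"
    unfolding q_def by (rule uniform_limit_bern_poly) fact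
  have lim: "(\<lambda>n. poly_op R (q n)) \<longlonglongrightarrow> fcalc f"
    using poly_op_Cauchy[OF q]
    by (simp add: fcalc_def q_def Cauchy_convergent_iff convergent_LIMSEQ_iff)
  have "(\<lambda>n. poly_op R (p n) - poly_op R (q n)) \<longlonglongrightarrow> 0"
  proof (rule LIMSEQ_I)
    fix e :: real assume e: "0 < e"
    have "\<forall>\<^sub>F n in sequentially. (\<forall>x\<in>{0..1}. dist (poly (p n) x) (f x) < e / 4)
        \<and> (\<forall>x\<in>{0..1}. dist (poly (q n) x) (f x) < e / 4)"
      using p q e by (intro eventually_conj uniform_limitD) auto
    then obtain N where N: "\<And>n x. N \<le> n \<Longrightarrow> x \<in> {0..1} \<Longrightarrow>
        dist (poly (p n) x) (f x) < e / 4 \<and> dist (poly (q n) x) (f x) < e / 4"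
      unfolding eventually_sequentially by blast
    have "norm (poly_op R (p n) - poly_op R (q n) - 0) < e" if "N \<le> n" for n
    proof -
      have "norm (poly_op R (p n - q n)) \<le> e / 2"
      proof (rule poly_op_norm_le)
        fix r :: real assume "0 \<le> r" "r \<le> 1"
        then show "\<bar>poly (p n - q n) r\<bar> \<le> e / 2"
          using dist_triangle2[of "poly (p n) r" "poly (q n) r" "f r"] N[OF that, of r]
          by (simp add: dist_real_def)
      qed
      then show ?thesis using e by (simp add: poly_op_diff)
    qed
    then show "\<exists>N. \<forall>n\<ge>N. norm (poly_op R (p n) - poly_op R (q n) - 0) < e" by blast
  qed
  from tendsto_add[OF this lim] show ?thesis by simp
qed

lemma fcalc_LIMSEQ_bern:
  "continuous_on {0..1} f \<Longrightarrow>
    (\<lambda>n. poly_op R (bern_poly n (\<lambda>k. f (real k / real n)))) \<longlonglongrightarrow> fcalc f"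
  by (intro fcalc_LIMSEQ uniform_limit_bern_poly)

lemma fcalc_poly: "fcalc (poly p) = poly_op R p"
  using fcalc_LIMSEQ[of "poly p" "\<lambda>_. p"]
  by (simp add: continuous_intros LIMSEQ_const_iff uniform_limit_iff)

lemma fcalc_cong:
  assumes "\<And>r. 0 \<le> r \<Longrightarrow> r \<le> 1 \<Longrightarrow> f r = g r"
  shows "fcalc f = fcalc g"
proof -
  have "bern_poly n (\<lambda>k. f (real k / real n)) = bern_poly n (\<lambda>k. g (real k / real n))" for n
    unfolding bern_poly_def using assms ratio_unit_interval by (intro sum.cong refl) auto
  then show ?thesis by (simp add: fcalc_def)
qed

lemma fcalc_1 [simp]: "fcalc (\<lambda>_. 1) = id_blinfun"
  using fcalc_poly[of 1] fcalc_cong[of "poly 1" "\<lambda>_. 1"] by simp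

lemma fcalc_ident [simp]: "fcalc (\<lambda>r. r) = R"
  using fcalc_poly[of "[:0, 1:]"] fcalc_cong[of "poly [:0, 1:]" "\<lambda>r. r"]
  by (auto intro!: blinfun_eqI simp: blinfun.bilinear_simps)

lemma fcalc_mult:
  assumes f: "continuous_on {0..1} f" and g: "continuous_on {0..1} g"
  shows "fcalc (\<lambda>r. f r * g r) = fcalc f o\<^sub>L fcalc g"
proof -
  let ?p = "\<lambda>f n. bern_poly n (\<lambda>k. f (real k / real n))"
  have "bounded (f ` {0..1})" "bounded (g ` {0..1})"
    using f g by (auto intro!: compact_imp_bounded compact_continuous_image)
  then have "uniform_limit {0..1} (\<lambda>n. poly (?p f n * ?p g n)) (\<lambda>r. f r * g r) sequentially"
    using bounded_bilinear.bounded_uniform_limit[OF bounded_bilinear_mult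
        uniform_limit_bern_poly[OF f] uniform_limit_bern_poly[OF g]]
    by (simp add: poly_mult[abs_def])
  then have "(\<lambda>n. poly_op R (?p f n * ?p g n)) \<longlonglongrightarrow> fcalc (\<lambda>r. f r * g r)"
    by (intro fcalc_LIMSEQ continuous_intros f g)
  moreover have "(\<lambda>n. poly_op R (?p f n * ?p g n)) \<longlonglongrightarrow> (fcalc f o\<^sub>L fcalc g)"
    unfolding poly_op_mult
    by (intro bounded_bilinear.tendsto[OF bounded_bilinear_blinfun_compose] fcalc_LIMSEQ_bern f g)
  ultimately show ?thesis by (rule LIMSEQ_unique)
qed

lemma fcalc_mult_apply:
  "continuous_on {0..1} f \<Longrightarrow> continuous_on {0..1} g \<Longrightarrow>
    fcalc (\<lambda>r. f r * g r) x = fcalc f (fcalc g x)"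
  by (simp add: fcalc_mult)

lemma fcalc_add:
  assumes f: "continuous_on {0..1} f" and g: "continuous_on {0..1} g"
  shows "fcalc (\<lambda>r. f r + g r) = fcalc f + fcalc g"
proof -
  have "(\<lambda>n. poly_op R (bern_poly n (\<lambda>k. f (real k / real n) + g (real k / real n)))) \<longlonglongrightarrow> fcalc f + fcalc g"
    unfolding bern_poly_add poly_op_add by (intro tendsto_add fcalc_LIMSEQ_bern f g)
  moreover have "(\<lambda>n. poly_op R (bern_poly n (\<lambda>k. f (real k / real n) + g (real k / real n)))) \<longlonglongrightarrow> fcalc (\<lambda>r. f r + g r)"
    by (intro fcalc_LIMSEQ_bern continuous_intros f g)
  ultimately show ?thesis using LIMSEQ_unique by blast
qed

lemma fcalc_scaleR:
  assumes f: "continuous_on {0..1} f"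
  shows "fcalc (\<lambda>r. c * f r) = c *\<^sub>R fcalc f"
proof -
  have "(\<lambda>n. poly_op R (bern_poly n (\<lambda>k. c * f (real k / real n)))) \<longlonglongrightarrow> c *\<^sub>R fcalc f"
    unfolding bern_poly_smult poly_op_smult by (intro tendsto_intros fcalc_LIMSEQ_bern f)
  moreover have "(\<lambda>n. poly_op R (bern_poly n (\<lambda>k. c * f (real k / real n)))) \<longlonglongrightarrow> fcalc (\<lambda>r. c * f r)"
    by (intro fcalc_LIMSEQ_bern continuous_intros f)
  ultimately show ?thesis using LIMSEQ_unique by blast
qed

lemma fcalc_diff:
  assumes f: "continuous_on {0..1} f" and g: "continuous_on {0..1} g"
  shows "fcalc (\<lambda>r. f r - g r) = fcalc f - fcalc g"
  using fcalc_add[OF f continuous_on_mult_left[OF g, of "-1"]] fcalc_scaleR[OF g, of "-1"] by simp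

lemma fcalc_sym:
  assumes f: "continuous_on {0..1} f"
  shows "fcalc f x \<bullet> y = x \<bullet> fcalc f y"
proof -
  let ?P = "\<lambda>n. poly_op R (bern_poly n (\<lambda>k. f (real k / real n)))"
  have "(\<lambda>n. ?P n x \<bullet> y) \<longlonglongrightarrow> fcalc f x \<bullet> y" "(\<lambda>n. x \<bullet> ?P n y) \<longlonglongrightarrow> x \<bullet> fcalc f y"
    by (intro tendsto_intros fcalc_LIMSEQ_bern f)+
  then show ?thesis unfolding poly_op_sym using LIMSEQ_unique by blast
qed

lemma fcalc_nonneg:
  assumes f: "continuous_on {0..1} f" and "\<And>r. 0 \<le> r \<Longrightarrow> r \<le> 1 \<Longrightarrow> 0 \<le> f r"
  shows "0 \<le> fcalc f x \<bullet> x"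
proof -
  let ?P = "\<lambda>n. poly_op R (bern_poly n (\<lambda>k. f (real k / real n)))"
  have lim: "(\<lambda>n. ?P n x \<bullet> x) \<longlonglongrightarrow> fcalc f x \<bullet> x"
    by (intro tendsto_intros fcalc_LIMSEQ_bern f)
  have "0 \<le> ?P n x \<bullet> x" for n
  proof (rule poly_op_nonneg)
    fix r :: real assume "0 \<le> r" "r \<le> 1"
    then show "0 \<le> poly (bern_poly n (\<lambda>k. f (real k / real n))) r"
      unfolding poly_bern_poly using assms(2) ratio_unit_interval
      by (intro sum_nonneg mult_nonneg_nonneg Bernstein_nonneg) auto
  qed
  then show ?thesis by (intro LIMSEQ_le_const[OF lim]) blast
qed

lemma fcalc_mono:
  assumes f: "continuous_on {0..1} f" and g: "continuous_on {0..1} g"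
    and "\<And>r. 0 \<le> r \<Longrightarrow> r \<le> 1 \<Longrightarrow> f r \<le> g r"
  shows "fcalc f x \<bullet> x \<le> fcalc g x \<bullet> x"
  using fcalc_nonneg[OF continuous_on_diff[OF g f], of x] assms(3)
  by (simp add: fcalc_diff[OF g f] blinfun.bilinear_simps inner_diff_left)

lemma fcalc_norm_le:
  assumes f: "continuous_on {0..1} f" and "\<And>r. 0 \<le> r \<Longrightarrow> r \<le> 1 \<Longrightarrow> \<bar>f r\<bar> \<le> M"
  shows "norm (fcalc f) \<le> M"
proof -
  let ?p = "\<lambda>n. bern_poly n (\<lambda>k. f (real k / real n))"
  have "norm (poly_op R (?p n)) \<le> M" for n
  proof (rule poly_op_norm_le)
    fix r :: real assume r: "0 \<le> r" "r \<le> 1"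
    have "\<bar>poly (?p n) r\<bar> \<le> (\<Sum>k\<le>n. \<bar>f (real k / real n) * Bernstein n k r\<bar>)"
      unfolding poly_bern_poly by (rule sum_abs)
    also have "\<dots> \<le> (\<Sum>k\<le>n. M * Bernstein n k r)"
      using r assms(2) ratio_unit_interval
      by (intro sum_mono) (auto simp: abs_mult Bernstein_nonneg intro!: mult_right_mono)
    also have "\<dots> = M" by (simp flip: sum_distrib_left)
    finally show "\<bar>poly (?p n) r\<bar> \<le> M" .
  qed
  then show ?thesis
    by (intro LIMSEQ_le_const2[OF tendsto_norm[OF fcalc_LIMSEQ_bern[OF f]]]) blast
qed

text \<open>Meant for two operators X: multiplication by i, and the projection onto the copy of a
  single L2 space. Both then commute with every function of the resolvent.\<close>

lemma fcalc_commute: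
  assumes "X o\<^sub>L R = R o\<^sub>L X" and f: "continuous_on {0..1} f"
  shows "X (fcalc f x) = fcalc f (X x)"
proof -
  let ?P = "\<lambda>n. poly_op R (bern_poly n (\<lambda>k. f (real k / real n)))"
  have "X (?P n x) = ?P n (X x)" for n
    using arg_cong[OF poly_op_commute[OF assms(1)], of "\<lambda>Y. Y x"] by simp
  moreover have "(\<lambda>n. X (?P n x)) \<longlonglongrightarrow> X (fcalc f x)" "(\<lambda>n. ?P n (X x)) \<longlonglongrightarrow> fcalc f (X x)"
    by (intro tendsto_intros fcalc_LIMSEQ_bern f)+
  ultimately show ?thesis using LIMSEQ_unique by auto
qed

lemma unit_op_fcalc:
  assumes f: "continuous_on {0..1} f" and "\<And>r. 0 \<le> r \<Longrightarrow> r \<le> 1 \<Longrightarrow> 0 \<le> f r \<and> f r \<le> 1"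
  shows "unit_op (fcalc f)"
proof
  show "fcalc f x \<bullet> x \<le> x \<bullet> x" for x
    using fcalc_mono[OF f, of "\<lambda>_. 1" x] assms(2) by simp
qed (use fcalc_sym[OF f] fcalc_nonneg[OF f] assms(2) in auto)

text \<open>For polynomials g this is multiplicativity; uniform approximation of g on [0, 1] does
  the rest because f takes its values there. It serves the uniqueness of the square root, where one
  resolvent is a function of another.\<close>

lemma fcalc_compose:
  assumes f: "continuous_on {0..1} f" and ran: "\<And>r. 0 \<le> r \<Longrightarrow> r \<le> 1 \<Longrightarrow> 0 \<le> f r \<and> f r \<le> 1"
    and g: "continuous_on {0..1} g"
  shows "unit_op.fcalc (fcalc f) g = fcalc (\<lambda>r. g (f r))"
proof -
  interpret F: unit_op "fcalc f" by (rule unit_op_fcalc[OF f ran])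
  let ?p = "\<lambda>n. bern_poly n (\<lambda>k. g (real k / real n))"
  have gf: "continuous_on {0..1} (\<lambda>r. g (f r))"
    by (rule continuous_on_compose2[OF g f]) (use ran in auto)
  have p: "poly_op (fcalc f) q = fcalc (\<lambda>r. poly q (f r))" for q
  proof (induction q)
    case 0
    show ?case using fcalc_poly[of 0] fcalc_cong[of "poly 0" "\<lambda>_. 0"] by simp
  next
    case (pCons a q)
    have "fcalc (\<lambda>r. a * 1 + f r * poly q (f r)) = a *\<^sub>R id_blinfun + (fcalc f o\<^sub>L fcalc (\<lambda>r. poly q (f r)))"
      by (subst fcalc_add fcalc_mult fcalc_scaleR; (intro continuous_intros f)?)+ simp
    with pCons show ?case by simp
  qed
  have "(\<lambda>n. poly_op (fcalc f) (?p n)) \<longlonglongrightarrow> fcalc (\<lambda>r. g (f r))"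
  proof (rule LIMSEQ_I)
    fix e :: real assume e: "0 < e"
    have "\<forall>\<^sub>F n in sequentially. \<forall>x\<in>{0..1}. dist (poly (?p n) x) (g x) < e / 2"
      using e by (intro uniform_limitD[OF uniform_limit_bern_poly[OF g]]) auto
    then obtain N where N: "\<And>n x. N \<le> n \<Longrightarrow> x \<in> {0..1} \<Longrightarrow> dist (poly (?p n) x) (g x) < e / 2"
      unfolding eventually_sequentially by blast
    have "norm (poly_op (fcalc f) (?p n) - fcalc (\<lambda>r. g (f r))) < e" if "N \<le> n" for n
    proof -
      have c: "continuous_on {0..1} (\<lambda>r. poly (?p n) (f r))" by (intro continuous_intros f)
      have "norm (fcalc (\<lambda>r. poly (?p n) (f r) - g (f r))) \<le> e / 2"
        using N[OF that] ran
        by (intro fcalc_norm_le continuous_intros f gf) (auto simp: dist_real_def intro!: less_imp_le)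
      then show ?thesis using e by (simp add: p fcalc_diff[OF c gf])
    qed
    then show "\<exists>N. \<forall>n\<ge>N. norm (poly_op (fcalc f) (?p n) - fcalc (\<lambda>r. g (f r))) < e" by blast
  qed
  with F.fcalc_LIMSEQ_bern[OF g] show ?thesis using LIMSEQ_unique by blast
qed

end

section \<open>Positive self-adjoint operators\<close>

lemma orth_dense_eq_0:
  fixes v :: "'h::real_inner"
  assumes "closure D = UNIV" "\<And>u. u \<in> D \<Longrightarrow> u \<bullet> v = 0"
  shows "v = 0"
proof -
  have "closed {u. u \<bullet> v = 0}" by (intro closed_Collect_eq continuous_intros)
  then have "closure D \<subseteq> {u. u \<bullet> v = 0}" using assms(2) by (intro closure_minimal) auto
  then have "v \<in> {u. u \<bullet> v = 0}" using assms(1) by blast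
  then show ?thesis by simp
qed

lemma subspace_closure:
  fixes S :: "'h::real_normed_vector set"
  assumes "subspace S"
  shows "subspace (closure S)"
proof (rule subspaceI)
  show "0 \<in> closure S" using subspace_0[OF assms] closure_subset by blast
next
  fix x y assume "x \<in> closure S" "y \<in> closure S"
  then obtain f g where "\<forall>n. f n \<in> S" "f \<longlonglongrightarrow> x" "\<forall>n. g n \<in> S" "g \<longlonglongrightarrow> y"
    unfolding closure_sequential by blast
  then show "x + y \<in> closure S"
    unfolding closure_sequential
    by (intro exI[of _ "\<lambda>n. f n + g n"]) (auto intro: subspace_add[OF assms] tendsto_add)
next
  fix c :: real and x assume "x \<in> closure S"
  then obtain f where "\<forall>n. f n \<in> S" "f \<longlonglongrightarrow> x" unfolding closure_sequential by blast
  then show "c *\<^sub>R x \<in> closure S"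
    unfolding closure_sequential
    by (intro exI[of _ "\<lambda>n. c *\<^sub>R f n"]) (auto intro: subspace_scale[OF assms] tendsto_scaleR)
qed

lemma closed_subspace_projection:
  fixes W :: "'h::{real_inner,banach} set"
  assumes W: "subspace W" "closed W"
  obtains y where "y \<in> W" "\<And>w. w \<in> W \<Longrightarrow> (x - y) \<bullet> w = 0"
proof -
  have ne: "W \<noteq> {}" using W(1) subspace_0 by blast
  define d where "d = infdist x W"
  have d0: "0 \<le> d" by (simp add: d_def infdist_nonneg)
  have dle: "d \<le> dist x w" if "w \<in> W" for w using infdist_le[OF that] by (simp add: d_def)
  have "\<exists>y\<in>W. dist x y < d + 1 / real (Suc n)" for n
  proof (rule ccontr)
    assume "\<not> (\<exists>y\<in>W. dist x y < d + 1 / real (Suc n))"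
    then have "d + 1 / real (Suc n) \<le> infdist x W"
      unfolding infdist_notempty[OF ne] by (intro cINF_greatest ne) (auto simp: not_less)
    then show False by (simp add: d_def)
  qed
  then obtain y where y: "\<And>n. y n \<in> W" "\<And>n. dist x (y n) < d + 1 / real (Suc n)" by metis
  \<comment> \<open>Parallelogram law for x - a and x - b, with their half sum written through the
    midpoint of a and b.\<close>
  have par: "(norm (a - b))\<^sup>2 = 2 * (norm (x - a))\<^sup>2 + 2 * (norm (x - b))\<^sup>2 - 4 * (dist x ((1/2) *\<^sub>R (a + b)))\<^sup>2" for a b
    unfolding dist_norm power2_norm_eq_inner
    by (simp add: inner_diff_left inner_diff_right inner_add_left inner_add_right inner_commute algebra_simps)
  \<comment> \<open>The midpoint lies in W and so has distance at least d from x. The constant comes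
    from 4 (d + e)^2 - 4 d^2 = (8 d + 4 e) e with e = 1/(N + 1) \<le> 1.\<close>
  have key: "(norm (y m - y n))\<^sup>2 \<le> (8 * d + 4) / real (Suc N)" if "N \<le> m" "N \<le> n" for m n N
  proof -
    let ?e = "1 / real (Suc N)"
    have e: "0 < ?e" "?e \<le> 1" by auto
    have b: "(norm (x - y k))\<^sup>2 \<le> (d + ?e)\<^sup>2" if "N \<le> k" for k
    proof -
      have "norm (x - y k) \<le> d + 1 / real (Suc k)" using y(2)[of k] by (simp add: dist_norm)
      also have "\<dots> \<le> d + ?e" using that by (simp add: frac_le)
      finally show ?thesis by (intro power_mono) auto
    qed
    have "(1/2) *\<^sub>R (y m + y n) \<in> W" using W(1) y(1) by (intro subspace_scale subspace_add)
    then have "d\<^sup>2 \<le> (dist x ((1/2) *\<^sub>R (y m + y n)))\<^sup>2" using dle d0 by (intro power_mono) auto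
    then have "(norm (y m - y n))\<^sup>2 \<le> 4 * (d + ?e)\<^sup>2 - 4 * d\<^sup>2"
      using par[of "y m" "y n"] b[OF that(1)] b[OF that(2)] by simp
    also have "\<dots> = (8 * d + 4 * ?e) * ?e" by (simp add: power2_eq_square algebra_simps)
    also have "\<dots> \<le> (8 * d + 4) * ?e" using e by (intro mult_right_mono) linarith+
    finally show ?thesis by simp
  qed
  have "Cauchy y"
  proof (rule CauchyI)
    fix e :: real assume e: "0 < e"
    obtain N where N: "(8 * d + 4) / e\<^sup>2 < real N" using reals_Archimedean2 by blast
    have "norm (y m - y n) < e" if "N \<le> m" "N \<le> n" for m n
    proof -
      have "(8 * d + 4) < real N * e\<^sup>2" using N e by (simp add: field_simps)
      also have "\<dots> \<le> real (Suc N) * e\<^sup>2" by (intro mult_right_mono) auto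
      finally have "(8 * d + 4) < real (Suc N) * e\<^sup>2" .
      then have "(8 * d + 4) / real (Suc N) < e\<^sup>2" by (simp add: field_simps)
      with key[OF that] have "(norm (y m - y n))\<^sup>2 < e\<^sup>2" by simp
      then show ?thesis by (rule power2_less_imp_less) (use e in simp)
    qed
    then show "\<exists>N. \<forall>m\<ge>N. \<forall>n\<ge>N. norm (y m - y n) < e" by blast
  qed
  then obtain z where z: "y \<longlonglongrightarrow> z" by (auto simp: Cauchy_convergent_iff convergent_def)
  have zW: "z \<in> W" using closed_sequentially[OF W(2) _ z] y(1) by blast
  have "dist x z \<le> d"
  proof (rule LIMSEQ_le)
    show "(\<lambda>n. dist x (y n)) \<longlonglongrightarrow> dist x z" by (intro tendsto_intros z)
    show "(\<lambda>n. d + 1 / real (Suc n)) \<longlonglongrightarrow> d" by real_asymp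
  qed (use y(2) less_imp_le in blast)
  have orth: "(x - z) \<bullet> w = 0" if w: "w \<in> W" for w
  proof (cases "w = 0")
    case False
    \<comment> \<open>The value of t that minimises the distance from x to z + t w.\<close>
    define t where "t = ((x - z) \<bullet> w) / (w \<bullet> w)"
    have "z + t *\<^sub>R w \<in> W" using W(1) zW w by (intro subspace_add subspace_scale)
    from dle[OF this] \<open>dist x z \<le> d\<close> have "norm (x - z) \<le> norm (x - z - t *\<^sub>R w)"
      by (simp add: dist_norm algebra_simps)
    then have "(x - z) \<bullet> (x - z) \<le> (x - z - t *\<^sub>R w) \<bullet> (x - z - t *\<^sub>R w)"
      by (simp add: norm_le)
    also have "\<dots> = (x - z) \<bullet> (x - z) - 2 * t * ((x - z) \<bullet> w) + t\<^sup>2 * (w \<bullet> w)"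
    proof -
      have "(a - t *\<^sub>R w) \<bullet> (a - t *\<^sub>R w) = a \<bullet> a - 2 * t * (a \<bullet> w) + t\<^sup>2 * (w \<bullet> w)" for a
        using inner_commute[of w a]
        by (simp add: inner_diff_left inner_diff_right power2_eq_square algebra_simps)
      then show ?thesis .
    qed
    also have "\<dots> = (x - z) \<bullet> (x - z) - ((x - z) \<bullet> w)\<^sup>2 / (w \<bullet> w)"
      using False by (simp add: t_def power2_eq_square divide_simps) 
    finally have "((x - z) \<bullet> w)\<^sup>2 / (w \<bullet> w) \<le> 0" by simp
    moreover have "0 < ((x - z) \<bullet> w)\<^sup>2 / (w \<bullet> w)" if "(x - z) \<bullet> w \<noteq> 0"
      using that False by (intro divide_pos_pos) simp_all
    ultimately show ?thesis by (meson not_less)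
  qed simp
  from that[OF zW orth] show thesis .
qed

section \<open>Graphs of positive self-adjoint operators and their resolvents\<close>

text \<open>Single-valuedness is a consequence: if (0, v) is in the graph, then v is orthogonal to
  the dense domain; see \<open>psa_single\<close>.\<close>

definition psa :: "('h::real_inner \<times> 'h) set \<Rightarrow> bool" where
  "psa A \<longleftrightarrow> subspace A \<and> closure (Domain A) = UNIV \<and>
     {(f, h). \<forall>(u, v)\<in>A. v \<bullet> f = u \<bullet> h} = A \<and> (\<forall>(u, v)\<in>A. 0 \<le> v \<bullet> u)"

lemma psa_iff: "psa A \<Longrightarrow> (f, h) \<in> A \<longleftrightarrow> (\<forall>u v. (u, v) \<in> A \<longrightarrow> v \<bullet> f = u \<bullet> h)"
  unfolding psa_def by blast

lemma psa_sym: "psa A \<Longrightarrow> (f, h) \<in> A \<Longrightarrow> (u, v) \<in> A \<Longrightarrow> v \<bullet> f = u \<bullet> h"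
  using psa_iff by blast

lemma psa_closed: "psa A \<Longrightarrow> closed A"
proof -
  assume A: "psa A"
  have "A = (\<Inter>q\<in>A. {p. snd q \<bullet> fst p = fst q \<bullet> snd p})"
  proof (intro set_eqI iffI)
    fix p assume "p \<in> A"
    then show "p \<in> (\<Inter>q\<in>A. {p. snd q \<bullet> fst p = fst q \<bullet> snd p})"
      using psa_sym[OF A, of "fst p" "snd p"] by auto
  next
    fix p assume "p \<in> (\<Inter>q\<in>A. {p. snd q \<bullet> fst p = fst q \<bullet> snd p})"
    then have "v \<bullet> fst p = u \<bullet> snd p" if "(u, v) \<in> A" for u v using that by force
    then show "p \<in> A" using psa_iff[OF A, of "fst p" "snd p"] by simp
  qed
  moreover have "closed (\<Inter>q\<in>A. {p. snd q \<bullet> fst p = fst q \<bullet> snd p})"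
    by (intro closed_INT ballI closed_Collect_eq continuous_intros)
  ultimately show ?thesis by simp
qed

text \<open>Positivity bounds both components of a pair (u, v) by u + v, so 1 + A is injective with
  closed range. A vector z orthogonal to the range satisfies (z, -z) \<in> A by self-adjointness,
  and positivity forces z = 0. The resolvent sends u + v to u.\<close>

lemma psa_resolvent:
  fixes A :: "('h::{real_inner,banach} \<times> 'h) set"
  assumes A: "psa A"
  obtains R where "unit_op R" "A = range (\<lambda>x. (blinfun_apply R x, x - R x))"
proof -
  have sub: "subspace A" and pos: "\<And>u v. (u, v) \<in> A \<Longrightarrow> 0 \<le> v \<bullet> u"
    using A by (auto simp: psa_def)
  have lb: "norm u \<le> norm (u + v)" "norm v \<le> norm (u + v)" if "(u, v) \<in> A" for u v
  proof -
    have "(u + v) \<bullet> (u + v) = u \<bullet> u + 2 * (v \<bullet> u) + v \<bullet> v"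
      by (simp add: inner_add_left inner_add_right inner_commute)
    then show "norm u \<le> norm (u + v)" "norm v \<le> norm (u + v)"
      using pos[OF that] by (auto simp: norm_le)
  qed
  define W where "W = (\<lambda>(u, v). u + v) ` A"
  have "linear (\<lambda>(u, v). u + v :: 'h)"
    by (intro linearI) (auto simp: algebra_simps)
  then have subW: "subspace W" unfolding W_def by (rule linear_subspace_image) (rule sub)
  have "closed W"
    unfolding closed_sequential_limits
  proof (intro allI impI, elim conjE)
    fix w l assume w: "\<forall>n. w n \<in> W" and l: "w \<longlonglongrightarrow> l"
    then have "\<forall>n. \<exists>p. p \<in> A \<and> w n = fst p + snd p" unfolding W_def image_iff split_beta by blast
    then obtain p where p: "\<And>n. p n \<in> A" "\<And>n. w n = fst (p n) + snd (p n)" by metis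
    have dp: "norm (fst (p m) - fst (p n)) \<le> norm (w m - w n)"
      "norm (snd (p m) - snd (p n)) \<le> norm (w m - w n)" for m n
    proof -
      have "p m - p n \<in> A" using sub p(1) by (intro subspace_diff)
      then have "(fst (p m) - fst (p n), snd (p m) - snd (p n)) \<in> A"
        by (metis fst_diff prod.collapse snd_diff)
      from lb[OF this] show "norm (fst (p m) - fst (p n)) \<le> norm (w m - w n)"
        "norm (snd (p m) - snd (p n)) \<le> norm (w m - w n)"
        by (simp_all add: p(2) algebra_simps)
    qed
    have w': "Cauchy w" using l by (rule LIMSEQ_imp_Cauchy)
    have "Cauchy f" if "\<And>m n. norm (f m - f n) \<le> norm (w m - w n)" for f :: "nat \<Rightarrow> 'h"
      using w' unfolding Cauchy_iff by (meson that le_less_trans)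
    from this[of "\<lambda>n. fst (p n)", OF dp(1)] this[of "\<lambda>n. snd (p n)", OF dp(2)]
    obtain u v where uv: "(\<lambda>n. fst (p n)) \<longlonglongrightarrow> u" "(\<lambda>n. snd (p n)) \<longlonglongrightarrow> v"
      by (auto simp: Cauchy_convergent_iff convergent_def)
    have "p \<longlonglongrightarrow> (u, v)" using tendsto_Pair[OF uv] by simp
    then have "(u, v) \<in> A"
      using closed_sequentially[OF psa_closed[OF A]] p(1) by blast
    moreover have "l = u + v"
      by (rule LIMSEQ_unique[OF l]) (use tendsto_add[OF uv] in \<open>simp add: p(2)[symmetric]\<close>)
    ultimately show "l \<in> W" unfolding W_def by (intro image_eqI[of _ _ "(u, v)"]) simp_all
  qed
  have "W = UNIV"
  proof (intro equalityI subset_UNIV subsetI)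
    fix x :: 'h
    obtain y where y: "y \<in> W" "\<And>w. w \<in> W \<Longrightarrow> (x - y) \<bullet> w = 0"
      using closed_subspace_projection[OF subW \<open>closed W\<close>] by blast
    define z where "z = x - y"
    have "v \<bullet> z = u \<bullet> (- z)" if "(u, v) \<in> A" for u v
    proof -
      have "z \<bullet> (u + v) = 0" unfolding z_def W_def[symmetric] using that
        by (intro y(2)) (auto simp: W_def intro!: image_eqI[of _ _ "(u, v)"])
      then show ?thesis by (simp add: inner_add_right inner_commute)
    qed
    then have "(z, - z) \<in> A" using psa_iff[OF A] by blast
    from pos[OF this] have "z \<bullet> z = 0"
      using inner_ge_zero[of z] by (simp only: inner_minus_left)
    then have "x = y" by (simp add: z_def)
    then show "x \<in> W" using y(1) by simp
  qed
  have ex: "\<exists>u. (u, w - u) \<in> A" for w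
  proof -
    from \<open>W = UNIV\<close> have "w \<in> W" by simp
    then obtain u v where "(u, v) \<in> A" "w = u + v" by (auto simp: W_def)
    then show ?thesis by (intro exI[of _ u]) simp
  qed
  have un: "u = u'" if "(u, w - u) \<in> A" "(u', w - u') \<in> A" for u u' w
  proof -
    have "(u - u', (w - u) - (w - u')) \<in> A"
      using subspace_diff[OF sub that] by simp
    from lb(1)[OF this] show ?thesis by simp
  qed
  define r where "r w = (THE u. (u, w - u) \<in> A)" for w
  have r: "(r w, w - r w) \<in> A" for w
    unfolding r_def using theI'[of "\<lambda>u. (u, w - u) \<in> A"] ex un by blast
  have r_eq: "u = r (u + v)" if "(u, v) \<in> A" for u v
    using un[OF _ r[of "u + v"], of u] that by simp
  have "bounded_linear r"
  proof (rule bounded_linear_intro[of _ 1])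
    fix x y :: 'h and c :: real
    have "(r x + r y, (x - r x) + (y - r y)) \<in> A" using subspace_add[OF sub r[of x] r[of y]] by simp
    from r_eq[OF this] show "r (x + y) = r x + r y" by (simp add: algebra_simps)
    have "(c *\<^sub>R r x, c *\<^sub>R (x - r x)) \<in> A" using subspace_scale[OF sub r[of x]] by simp
    from r_eq[OF this] show "r (c *\<^sub>R x) = c *\<^sub>R r x" by (simp add: algebra_simps)
    show "norm (r x) \<le> norm x * 1" using lb(1)[OF r[of x]] by simp
  qed
  then have rb: "blinfun_apply (Blinfun r) = r" by (rule bounded_linear_Blinfun_apply)
  have "unit_op (Blinfun r)"
  proof (unfold_locales, unfold rb)
    fix x y
    have "(y - r y) \<bullet> r x = r y \<bullet> (x - r x)" by (rule psa_sym[OF A r r])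
    then show "r x \<bullet> y = x \<bullet> r y"
      by (simp add: inner_diff_left inner_diff_right inner_commute)
    have p: "0 \<le> (x - r x) \<bullet> r x" by (rule pos[OF r])
    have "r x \<bullet> x = r x \<bullet> r x + (x - r x) \<bullet> r x"
      by (simp add: inner_diff_left inner_diff_right inner_commute)
    also have "\<dots> \<ge> 0" using p by simp
    finally show "0 \<le> r x \<bullet> x" .
    have "x \<bullet> x = r x \<bullet> x + (x - r x) \<bullet> r x + (x - r x) \<bullet> (x - r x)"
      by (simp add: inner_diff_left inner_diff_right inner_commute)
    then show "r x \<bullet> x \<le> x \<bullet> x" using p inner_ge_zero[of "x - r x"] by simp
  qed
  moreover have "A = range (\<lambda>x. (Blinfun r x, x - Blinfun r x))"
  proof (unfold rb, intro equalityI subrelI)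
    fix u v assume "(u, v) \<in> A"
    then have "u = r (u + v)" by (rule r_eq)
    then show "(u, v) \<in> range (\<lambda>x. (r x, x - r x))" by (intro range_eqI[of _ _ "u + v"]) simp
  qed (use r in auto)
  ultimately show thesis by (rule that)
qed

text \<open>The graph of the quotient Q/P, for commuting symmetric P and Q with P^2 + Q^2 = 1. If
  (f, h) is in the adjoint, then Q f = P h, and P f + Q h is the parameter that produces (f, h).
  Injectivity of the symmetric P makes its range, the domain, dense.\<close>

lemma psa_range:
  fixes P Q :: "'h::{real_inner,banach} \<Rightarrow>\<^sub>L 'h"
  assumes P: "\<And>x y. P x \<bullet> y = x \<bullet> P y" and Q: "\<And>x y. Q x \<bullet> y = x \<bullet> Q y"
    and PQ: "\<And>x. P (Q x) = Q (P x)" and one: "\<And>x. P (P x) + Q (Q x) = x"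
    and pos: "\<And>x. 0 \<le> P (Q x) \<bullet> x" and inj: "\<And>x. P x = 0 \<Longrightarrow> x = 0"
  shows "psa (range (\<lambda>x. (P x, Q x)))" (is "psa ?A")
  unfolding psa_def
proof (intro conjI)
  show "subspace ?A"
    by (rule linear_subspace_image[OF _ subspace_UNIV], rule linearI) (simp_all add: blinfun.bilinear_simps)
  show "closure (Domain ?A) = UNIV"
  proof (intro equalityI subset_UNIV subsetI)
    fix x
    have D: "Domain ?A = range P" by auto
    have sub: "subspace (closure (range P))"
      by (intro subspace_closure linear_subspace_image[OF _ subspace_UNIV] linearI)
         (simp_all add: blinfun.bilinear_simps)
    obtain y where y: "y \<in> closure (range P)" "\<And>w. w \<in> closure (range P) \<Longrightarrow> (x - y) \<bullet> w = 0"
      using closed_subspace_projection[OF sub closed_closure] by blast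
    have "P (x - y) \<bullet> P (x - y) = (x - y) \<bullet> P (P (x - y))" by (rule P)
    also have "\<dots> = 0" by (intro y(2) closure_subset[THEN subsetD]) auto
    finally have "P (x - y) = 0" by simp
    then have "x - y = 0" by (rule inj)
    with y(1) show "x \<in> closure (Domain ?A)" by (simp add: D)
  qed
  have "Q x \<bullet> P y = P x \<bullet> Q y" for x y
    using P[of "Q x" y] Q[of "P x" y] by (simp only: PQ)
  then have 1: "?A \<subseteq> {(f, h). \<forall>(u, v)\<in>?A. v \<bullet> f = u \<bullet> h}" by auto
  have 2: "(f, h) \<in> ?A" if "\<And>x. Q x \<bullet> f = P x \<bullet> h" for f h
  proof -
    have "(Q f - P h) \<bullet> (Q f - P h) = 0"
      unfolding inner_diff_right[of "Q f - P h" "Q f"]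
      using that[of "Q f - P h"] P[of "Q f - P h" h] Q[of "Q f - P h" f] by linarith
    then have *: "Q f = P h" by simp
    have "P (P f + Q h) = f" using one[of f] by (simp only: blinfun.add_right PQ * [symmetric])
    moreover have "Q (P f + Q h) = h" using one[of h] by (simp only: blinfun.add_right PQ[symmetric] *)
    ultimately show ?thesis by (intro range_eqI[of _ _ "P f + Q h"]) simp
  qed
  show "{(f, h). \<forall>(u, v)\<in>?A. v \<bullet> f = u \<bullet> h} = ?A"
  proof (rule equalityI[OF _ 1], intro subrelI)
    fix f h assume "(f, h) \<in> {(f, h). \<forall>(u, v)\<in>?A. v \<bullet> f = u \<bullet> h}"
    then show "(f, h) \<in> ?A" by (intro 2) blast
  qed
  have "0 \<le> Q x \<bullet> P x" for x using pos[of x] by (simp only: P)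
  then show "\<forall>(u, v)\<in>?A. 0 \<le> v \<bullet> u" by auto
qed

section \<open>The positive square root\<close>

context unit_op begin

definition sqrt_graph :: "('h \<times> 'h) set" where
  "sqrt_graph = range (\<lambda>x. (fcalc sqrt x, fcalc (\<lambda>r. sqrt (1 - r)) x))"

lemma fcalc_sqrt: "fcalc sqrt (fcalc sqrt x) = R x"
proof -
  have "fcalc sqrt (fcalc sqrt x) = fcalc (\<lambda>r. sqrt r * sqrt r) x"
    by (subst fcalc_mult) (auto intro!: continuous_intros)
  also have "fcalc (\<lambda>r. sqrt r * sqrt r) = fcalc (\<lambda>r. r)" by (rule fcalc_cong) simp
  finally show ?thesis by simp
qed

lemma fcalc_sqrt_compl: "fcalc (\<lambda>r. sqrt (1 - r)) (fcalc (\<lambda>r. sqrt (1 - r)) x) = x - R x"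
proof -
  have "fcalc (\<lambda>r. sqrt (1 - r)) (fcalc (\<lambda>r. sqrt (1 - r)) x) = fcalc (\<lambda>r. sqrt (1 - r) * sqrt (1 - r)) x"
    by (subst fcalc_mult) (auto intro!: continuous_intros)
  also have "fcalc (\<lambda>r. sqrt (1 - r) * sqrt (1 - r)) = fcalc (\<lambda>r. 1 - r)" by (rule fcalc_cong) simp
  also have "\<dots> x = x - R x" by (subst fcalc_diff) (auto intro!: continuous_intros simp: blinfun.bilinear_simps)
  finally show ?thesis .
qed

lemma fcalc_comm:
  "continuous_on {0..1} f \<Longrightarrow> continuous_on {0..1} g \<Longrightarrow> fcalc f (fcalc g x) = fcalc g (fcalc f x)"
  using fcalc_mult_apply[of f g x] fcalc_mult_apply[of g f x] by (simp add: mult.commute)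

lemma psa_sqrt_graph:
  assumes inj: "\<And>x. R x = 0 \<Longrightarrow> x = 0"
  shows "psa sqrt_graph"
  unfolding sqrt_graph_def
proof (rule psa_range)
  have c: "continuous_on {0..1} sqrt" "continuous_on {0..1} (\<lambda>r. sqrt (1 - r))"
    by (intro continuous_intros)+
  show "fcalc sqrt x \<bullet> y = x \<bullet> fcalc sqrt y" for x y by (intro fcalc_sym c)
  show "fcalc (\<lambda>r. sqrt (1 - r)) x \<bullet> y = x \<bullet> fcalc (\<lambda>r. sqrt (1 - r)) y" for x y
    by (intro fcalc_sym c)
  show "fcalc sqrt (fcalc (\<lambda>r. sqrt (1 - r)) x) = fcalc (\<lambda>r. sqrt (1 - r)) (fcalc sqrt x)" for x
    by (intro fcalc_comm c)
  show "fcalc sqrt (fcalc sqrt x) + fcalc (\<lambda>r. sqrt (1 - r)) (fcalc (\<lambda>r. sqrt (1 - r)) x) = x" for x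
    by (simp add: fcalc_sqrt fcalc_sqrt_compl)
  show "0 \<le> fcalc sqrt (fcalc (\<lambda>r. sqrt (1 - r)) x) \<bullet> x" for x
    unfolding fcalc_mult_apply[OF c, symmetric] by (intro fcalc_nonneg continuous_intros) auto
  show "x = 0" if "fcalc sqrt x = 0" for x
    using that fcalc_sqrt[of x] inj[of x] by (simp add: blinfun.bilinear_simps)
qed

lemma sqrt_graph_comp: "sqrt_graph O sqrt_graph = range (\<lambda>x. (R x, x - R x))"
proof -
  have c: "continuous_on {0..1} sqrt" "continuous_on {0..1} (\<lambda>r. sqrt (1 - r))"
    by (intro continuous_intros)+
  let ?C = "fcalc sqrt" and ?D = "fcalc (\<lambda>r. sqrt (1 - r))"
  have comm: "?C (?D x) = ?D (?C x)" for x by (intro fcalc_comm c)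
  have one: "?C (?C x) + ?D (?D x) = x" for x by (simp add: fcalc_sqrt fcalc_sqrt_compl)
  have "(?C x, ?D y) \<in> range (\<lambda>x. (R x, x - R x))" if "?D x = ?C y" for x y
  proof -
    \<comment> \<open>The common parameter of both pairs: C z = C^2 x + D C y = (C^2 + D^2) x = x,
      and likewise D z = y.\<close>
    define z where "z = ?C x + ?D y"
    have "?C z = x" using one[of x] by (simp only: z_def blinfun.add_right comm that[symmetric])
    moreover have "?D z = y" using one[of y] by (simp only: z_def blinfun.add_right comm[symmetric] that)
    ultimately show ?thesis
      using fcalc_sqrt[of z] fcalc_sqrt_compl[of z] by (intro range_eqI[of _ _ z]) simp
  qed
  moreover have "(R z, z - R z) \<in> sqrt_graph O sqrt_graph" for z
  proof
    show "(R z, ?D (?C z)) \<in> sqrt_graph"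
      unfolding sqrt_graph_def by (rule range_eqI[of _ _ "?C z"]) (simp add: fcalc_sqrt)
    show "(?D (?C z), z - R z) \<in> sqrt_graph"
      unfolding sqrt_graph_def by (rule range_eqI[of _ _ "?D z"]) (simp add: fcalc_sqrt_compl comm)
  qed
  ultimately show ?thesis by (auto simp: sqrt_graph_def)
qed

end

text \<open>
  With \<open>Z = (1 + B)\<^sup>-\<^sup>1\<close> one has \<open>(1 + B\<^sup>2)\<^sup>-\<^sup>1 = \<rho>(Z)\<close> for \<open>\<rho>(z) = z\<^sup>2 / (z\<^sup>2 + (1 - z)\<^sup>2)\<close>,
  so the calculus of \<open>(1 + B\<^sup>2)\<^sup>-\<^sup>1\<close> is that of \<open>Z\<close>.
\<close>

lemma psa_sqrt_unique:
  fixes B :: "('h::{real_inner,banach} \<times> 'h) set"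
  assumes R: "unit_op R" and B: "psa B" and BB: "B O B = range (\<lambda>x. (blinfun_apply R x, x - R x))"
  shows "B = unit_op.sqrt_graph R"
proof -
  interpret R: unit_op R by fact
  obtain Z where "unit_op Z" and BZ: "B = range (\<lambda>x. (blinfun_apply Z x, x - Z x))"
    using psa_resolvent[OF B] .
  interpret Z: unit_op Z by fact
  \<comment> \<open>For z = 1/(1 + b) one has n(z) = z^2 (1 + b^2). The factor \<omega> puts the
    point (z, 1 - z) on the unit circle: z \<omega> and (1 - z) \<omega> are the square roots of
    \<rho> and 1 - \<rho>.\<close>
  define n :: "real \<Rightarrow> real" where "n = (\<lambda>z. z\<^sup>2 + (1 - z)\<^sup>2)"
  have npos: "0 < n z" for z unfolding n_def by (cases "z = 0") (auto intro: add_pos_nonneg)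
  then have nz: "n z \<noteq> 0" for z by (metis less_irrefl)
  have cn: "continuous_on {0..1} n" unfolding n_def by (intro continuous_intros)
  define \<rho> where "\<rho> = (\<lambda>z. z\<^sup>2 / n z)"
  define \<omega> where "\<omega> = (\<lambda>z. 1 / sqrt (n z))"
  have c\<rho>: "continuous_on {0..1} \<rho>" unfolding \<rho>_def by (intro continuous_intros cn) (simp add: nz)
  have c\<omega>: "continuous_on {0..1} \<omega>" unfolding \<omega>_def by (intro continuous_intros cn) (simp add: nz)
  have cs: "continuous_on {0..1} (\<lambda>z. sqrt (n z))" by (intro continuous_intros cn)
  have ci: "continuous_on {0..1} (\<lambda>z. 1 / n z)" by (intro continuous_intros cn) (simp add: nz)
  have \<rho>01: "0 \<le> \<rho> z \<and> \<rho> z \<le> 1" for z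
    using npos[of z] by (simp add: \<rho>_def divide_le_eq_1) (simp add: n_def)
  have "R w = Z.fcalc \<rho> w" for w
  proof -
    \<comment> \<open>Applying B twice to Z^2 q gives (1 - Z)^2 q, and the two vectors add up to
      n(Z) q = w. Hence the resolvent of B^2 sends w to Z^2 q.\<close>
    define q where "q = Z.fcalc (\<lambda>z. 1 / n z) w"
    have "(Z (Z q), Z q - Z (Z q)) \<in> B" "(Z (q - Z q), (q - Z q) - Z (q - Z q)) \<in> B"
      unfolding BZ by auto
    moreover have "Z (q - Z q) = Z q - Z (Z q)" by (simp add: blinfun.bilinear_simps)
    ultimately have "(Z (Z q), (q - Z q) - Z (q - Z q)) \<in> B O B" by (metis relcomp.relcompI)
    then obtain x where x: "Z (Z q) = R x" "(q - Z q) - Z (q - Z q) = x - R x"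
      unfolding BB by auto
    have id2: "Z (Z p) = Z.fcalc (\<lambda>z. z * z) p" for p
      using Z.fcalc_mult_apply[of "\<lambda>z. z" "\<lambda>z. z" p] by (simp add: continuous_intros)
    have "Z (Z q) = Z.fcalc (\<lambda>z. (z * z) * (1 / n z)) w"
      unfolding id2 q_def by (subst Z.fcalc_mult_apply) (auto intro!: continuous_intros ci)
    also have "\<dots> = Z.fcalc \<rho> w" by (simp add: \<rho>_def power2_eq_square)
    finally have 1: "Z (Z q) = Z.fcalc \<rho> w" .
    have "x = Z (Z q) + ((q - Z q) - Z (q - Z q))" using x by simp
    also have "\<dots> = 2 *\<^sub>R Z (Z q) + q - 2 *\<^sub>R Z q"
      by (simp add: blinfun.bilinear_simps scaleR_2)
    also have "\<dots> = Z.fcalc (\<lambda>z. 2 * (z * z) + 1 - 2 * z) q"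
      unfolding id2
      by (subst Z.fcalc_diff Z.fcalc_add Z.fcalc_scaleR; (intro continuous_intros)?)+
         (simp add: blinfun.bilinear_simps)
    also have "\<dots> = Z.fcalc (\<lambda>z. (2 * (z * z) + 1 - 2 * z) * (1 / n z)) w"
      unfolding q_def by (subst Z.fcalc_mult_apply) (auto intro!: continuous_intros ci)
    also have "Z.fcalc (\<lambda>z. (2 * (z * z) + 1 - 2 * z) * (1 / n z)) = Z.fcalc (\<lambda>_. 1)"
    proof (rule Z.fcalc_cong)
      fix z :: real
      have "2 * (z * z) + 1 - 2 * z = n z" by (simp add: n_def power2_eq_square algebra_simps)
      then show "(2 * (z * z) + 1 - 2 * z) * (1 / n z) = 1" using nz[of z] by simp
    qed
    finally have "x = w" by simp
    with 1 x show ?thesis by simp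
  qed
  then have R\<rho>: "R = Z.fcalc \<rho>" by (intro blinfun_eqI)
  have 1: "R.fcalc sqrt x = Z (Z.fcalc \<omega> x)" for x
  proof -
    have "R.fcalc sqrt = Z.fcalc (\<lambda>z. sqrt (\<rho> z))"
      unfolding R\<rho> by (intro Z.fcalc_compose c\<rho> \<rho>01 continuous_intros)
    also have "\<dots> = Z.fcalc (\<lambda>z. z * \<omega> z)"
      by (rule Z.fcalc_cong) (simp add: \<rho>_def \<omega>_def real_sqrt_divide)
    also have "\<dots> x = Z (Z.fcalc \<omega> x)"
      by (subst Z.fcalc_mult_apply) (auto intro!: continuous_intros c\<omega>)
    finally show ?thesis .
  qed
  have 2: "R.fcalc (\<lambda>r. sqrt (1 - r)) x = Z.fcalc \<omega> x - Z (Z.fcalc \<omega> x)" for x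
  proof -
    have "R.fcalc (\<lambda>r. sqrt (1 - r)) = Z.fcalc (\<lambda>z. sqrt (1 - \<rho> z))"
      unfolding R\<rho> by (intro Z.fcalc_compose c\<rho> \<rho>01 continuous_intros)
    also have "\<dots> = Z.fcalc (\<lambda>z. (1 - z) * \<omega> z)"
    proof (rule Z.fcalc_cong)
      fix z :: real assume z: "0 \<le> z" "z \<le> 1"
      have "1 - \<rho> z = (1 - z)\<^sup>2 / n z"
        using nz[of z] by (simp add: \<rho>_def divide_simps) (simp add: n_def)
      then show "sqrt (1 - \<rho> z) = (1 - z) * \<omega> z" using z by (simp add: \<omega>_def real_sqrt_divide)
    qed
    also have "\<dots> x = Z.fcalc (\<lambda>z. 1 - z) (Z.fcalc \<omega> x)"
      by (subst Z.fcalc_mult_apply) (auto intro!: continuous_intros c\<omega>)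
    also have "\<dots> = Z.fcalc \<omega> x - Z (Z.fcalc \<omega> x)"
      by (subst Z.fcalc_diff) (auto intro!: continuous_intros simp: blinfun.bilinear_simps)
    finally show ?thesis .
  qed
  \<comment> \<open>\<omega> has no zero, so \<omega>(Z) is onto and the two parametrisations have
    the same range.\<close>
  have "(Z p, p - Z p) \<in> R.sqrt_graph" for p
  proof -
    have "Z.fcalc \<omega> (Z.fcalc (\<lambda>z. sqrt (n z)) p) = Z.fcalc (\<lambda>z. \<omega> z * sqrt (n z)) p"
      by (subst Z.fcalc_mult_apply[OF c\<omega> cs]) simp
    also have "Z.fcalc (\<lambda>z. \<omega> z * sqrt (n z)) = Z.fcalc (\<lambda>_. 1)"
      by (rule Z.fcalc_cong) (simp add: \<omega>_def nz)
    finally have "Z.fcalc \<omega> (Z.fcalc (\<lambda>z. sqrt (n z)) p) = p" by simp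
    then show ?thesis unfolding R.sqrt_graph_def 1 2
      by (intro range_eqI[of _ _ "Z.fcalc (\<lambda>z. sqrt (n z)) p"]) simp
  qed
  moreover have "R.sqrt_graph \<subseteq> B" unfolding R.sqrt_graph_def 1 2 BZ by auto
  ultimately show ?thesis unfolding BZ by blast
qed

section \<open>The heat semigroup\<close>

lemma norm_blinfun_le: "norm X \<le> K \<Longrightarrow> norm (blinfun_apply X z) \<le> K * norm z"
  by (rule order_trans[OF norm_blinfun mult_right_mono]) auto

lemma strong_limit_0_dense:
  fixes X :: "real \<Rightarrow> 'h::real_normed_vector \<Rightarrow>\<^sub>L 'h"
  assumes dense: "closure D = UNIV" and K: "\<forall>\<^sub>F t in F. norm (X t) \<le> K"
    and D: "\<And>y. y \<in> D \<Longrightarrow> ((\<lambda>t. X t y) \<longlongrightarrow> 0) F"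
  shows "((\<lambda>t. X t x) \<longlongrightarrow> 0) F"
proof (rule tendstoI)
  fix e :: real assume e: "0 < e"
  have K1: "0 < \<bar>K\<bar> + 1" by simp
  have "x \<in> closure D" using dense by simp
  then obtain y where y: "y \<in> D" "dist y x < e / (2 * (\<bar>K\<bar> + 1))"
    unfolding closure_approachable using e K1 by (meson divide_pos_pos mult_pos_pos zero_less_numeral)
  have "\<forall>\<^sub>F t in F. dist (X t y) 0 < e / 2"
    using e by (intro tendstoD[OF D[OF y(1)]]) simp
  with K show "\<forall>\<^sub>F t in F. dist (X t x) 0 < e"
  proof eventually_elim
    fix t assume 1: "norm (X t) \<le> K" and 2: "dist (X t y) 0 < e / 2"
    have "norm (X t (x - y)) \<le> norm (X t) * norm (x - y)" by (rule norm_blinfun)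
    also have "\<dots> \<le> (\<bar>K\<bar> + 1) * norm (x - y)" using 1 by (intro mult_right_mono) auto
    also have "\<dots> \<le> (\<bar>K\<bar> + 1) * (e / (2 * (\<bar>K\<bar> + 1)))"
      using y(2) K1 by (intro mult_left_mono) (auto simp: dist_norm norm_minus_commute)
    also have "\<dots> = e / 2" using K1 by (simp add: field_simps)
    finally have 3: "norm (X t (x - y)) \<le> e / 2" .
    have "X t x = X t y + X t (x - y)" by (simp only: blinfun.diff_right) simp
    then have "norm (X t x) \<le> norm (X t y) + norm (X t (x - y))" by (metis norm_triangle_ineq)
    with 2 3 show "dist (X t x) 0 < e" unfolding dist_norm by simp
  qed
qed

section \<open>The functions exp (- t a) in the variable r = 1/(1 + a)\<close>

text \<open>At r = 0, where a is infinite, division by zero would give exp 0 = 1 instead of the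
  limit 0; hence the case distinction. Time 0 is exempt because there the function is the constant
  1.\<close>

definition heat :: "real \<Rightarrow> real \<Rightarrow> real" where
  "heat t r = (if r \<le> 0 \<and> 0 < t then 0 else exp (- t * (1 - r) / r))"

lemma heat_0 [simp]: "heat 0 r = 1"
  by (simp add: heat_def)

lemma heat_bounds: "0 \<le> t \<Longrightarrow> 0 \<le> r \<Longrightarrow> r \<le> 1 \<Longrightarrow> 0 \<le> heat t r \<and> heat t r \<le> 1"
  by (auto simp: heat_def intro!: divide_nonneg_nonneg mult_nonneg_nonneg)

lemma heat_add: "0 \<le> s \<Longrightarrow> 0 \<le> t \<Longrightarrow> 0 \<le> r \<Longrightarrow> heat (s + t) r = heat s r * heat t r"
  by (cases "r = 0"; cases "s = 0"; cases "t = 0")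
     (auto simp: heat_def exp_add[symmetric] add_divide_distrib[symmetric] algebra_simps)

lemma continuous_on_heat:
  assumes "0 \<le> t"
  shows "continuous_on {0..1} (heat t)"
proof (cases "t = 0")
  case False
  then have t: "0 < t" using assms by simp
  have cont: "isCont (\<lambda>r. exp (- t * (1 - r) / r)) x" if "0 < x" for x
    using that by (intro continuous_intros) auto
  have ev: "\<forall>\<^sub>F r in nhds x. heat t r = exp (- t * (1 - r) / r)" if "0 < x" for x
  proof -
    have "\<forall>\<^sub>F r in nhds x. r \<in> {0<..}" by (rule eventually_nhds_in_open) (use that in auto)
    then show ?thesis by eventually_elim (auto simp: heat_def)
  qed
  have isC: "isCont (heat t) x" if "0 < x" for x
    using isCont_cong[OF ev[OF that]] cont[OF that] by simp
  show ?thesis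
  proof (rule continuous_on_IccI)
    have "((\<lambda>r. exp (- t * (1 - r) / r)) \<longlongrightarrow> 0) (at_right 0)"
      using t by real_asymp
    moreover have "\<forall>\<^sub>F r in at_right 0. exp (- t * (1 - r) / r) = heat t r"
      using eventually_at_right_less[of "0::real"] by eventually_elim (auto simp: heat_def)
    ultimately show "(heat t \<longlongrightarrow> heat t 0) (at_right 0)"
      using t by (simp add: heat_def[of t 0] tendsto_cong)
    show "(heat t \<longlongrightarrow> heat t 1) (at_left 1)"
      using isC[of 1] by (simp add: isCont_def filterlim_at_split)
    show "heat t \<midarrow>x\<rightarrow> heat t x" if "0 < x" "x < 1" for x
      using isC[OF that(1)] by (simp add: isCont_def)
  qed simp
qed (simp add: continuous_on_const)

text \<open>This is 1 - exp (- t a) \<le> t a for a = (1 - r)/r, multiplied by r so that it extends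
  to r = 0. It yields the energy bound, strong continuity and the boundedness of the difference
  quotients.\<close>

lemma heat_first_order:
  assumes "0 \<le> t" "0 \<le> r" "r \<le> 1"
  shows "r * (1 - heat t r) \<le> t * (1 - r)"
proof (cases "r = 0")
  case False
  then have r: "0 < r" using assms by simp
  have "1 - heat t r \<le> t * (1 - r) / r"
    using exp_ge_add_one_self[of "- t * (1 - r) / r"] r by (simp add: heat_def)
  then have "r * (1 - heat t r) \<le> r * (t * (1 - r) / r)" using r by (intro mult_left_mono) auto
  then show ?thesis using r by simp
qed (use assms in auto)

text \<open>The expansion 0 \<le> exp (-x) - 1 + x \<le> x^2 at x = t a, with the upper bound
  obtained from exp (-x) \<le> 1/(1 + x). The additional factor r absorbs the growth of a^2, since
  r^2 a^2 = (1 - r)^2.\<close>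

lemma heat_second_order:
  assumes "0 < t" "0 \<le> r" "r \<le> 1"
  shows "\<bar>((1 / t) * (heat t r * r - r) + (1 - r)) * r\<bar> \<le> t"
proof (cases "r = 0")
  case False
  then have r: "0 < r" using assms by simp
  define a where "a = (1 - r) / r"
  have a: "0 \<le> a" "a * r = 1 - r" using r assms by (auto simp: a_def)
  define E where "E = exp (- (t * a))"
  have h: "heat t r = E" using r by (simp add: heat_def E_def a_def)
  have E1: "1 - t * a \<le> E" using exp_ge_add_one_self[of "- (t * a)"] by (simp add: E_def)
  have ta: "0 \<le> t * a" using assms a by simp
  have "E \<le> 1 / (1 + t * a)"
    using exp_ge_add_one_self[of "t * a"] ta
    by (simp add: E_def exp_minus inverse_eq_divide frac_le)
  also have "\<dots> \<le> 1 - t * a + (t * a)\<^sup>2"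
  proof -
    have "1 \<le> 1 + (t * a)^3" using ta by simp
    also have "\<dots> = (1 - t * a + (t * a)\<^sup>2) * (1 + t * a)"
      by (simp add: power2_eq_square power3_eq_cube algebra_simps)
    finally show ?thesis using ta by (simp add: divide_le_eq)
  qed
  finally have E2: "E - 1 + t * a \<le> (t * a)\<^sup>2" by simp
  have "((1 / t) * (heat t r * r - r) + (1 - r)) * r = (r\<^sup>2 / t) * (E - 1 + t * a)"
    using assms unfolding h a(2)[symmetric] by (simp add: power2_eq_square field_simps)
  moreover have "0 \<le> (r\<^sup>2 / t) * (E - 1 + t * a)"
    using assms E1 by (intro mult_nonneg_nonneg) auto
  moreover have "(r\<^sup>2 / t) * (E - 1 + t * a) \<le> (r\<^sup>2 / t) * (t * a)\<^sup>2"
    using assms by (intro mult_left_mono E2) auto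
  moreover have "(r\<^sup>2 / t) * (t * a)\<^sup>2 = t * (1 - r)\<^sup>2"
    using assms unfolding a(2)[symmetric] by (simp add: power2_eq_square)
  moreover have "t * (1 - r)\<^sup>2 \<le> t * 1"
    using assms by (intro mult_left_mono power_le_one) auto
  ultimately show ?thesis by linarith
qed (use assms in auto)

text \<open>The generator is -A. The last clause is an equivalence, so that it fixes the domain as
  well as the values.\<close>

definition c0_gen :: "(real \<Rightarrow> 'h::real_normed_vector \<Rightarrow>\<^sub>L 'h) \<Rightarrow> ('h \<times> 'h) set \<Rightarrow> bool" where
  "c0_gen T A \<longleftrightarrow>
     T 0 = id_blinfun \<and> (\<forall>s\<ge>0. \<forall>t\<ge>0. T (s + t) = T s o\<^sub>L T t) \<and>
     (\<forall>x. ((\<lambda>t. T t x) \<longlongrightarrow> x) (at_right 0)) \<and>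
     (\<forall>f g. ((\<lambda>t. (1 / t) *\<^sub>R (T t f - f)) \<longlongrightarrow> g) (at_right 0) \<longleftrightarrow> (f, - g) \<in> A)"

section \<open>The semigroup built from the resolvent\<close>

context unit_op
begin

definition sgr :: "real \<Rightarrow> 'h \<Rightarrow>\<^sub>L 'h" where "sgr t = fcalc (heat t)"

lemma sgr_sym: "0 \<le> t \<Longrightarrow> sgr t x \<bullet> y = x \<bullet> sgr t y"
  unfolding sgr_def by (intro fcalc_sym continuous_on_heat)

lemma sgr_nonneg: "0 \<le> t \<Longrightarrow> 0 \<le> sgr t x \<bullet> x"
  unfolding sgr_def using heat_bounds by (intro fcalc_nonneg continuous_on_heat) auto

lemma norm_sgr_le: "0 \<le> t \<Longrightarrow> norm (sgr t) \<le> 1"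
  unfolding sgr_def using heat_bounds by (intro fcalc_norm_le continuous_on_heat) auto

lemma sgr_add: "0 \<le> s \<Longrightarrow> 0 \<le> t \<Longrightarrow> sgr (s + t) = sgr s o\<^sub>L sgr t"
  unfolding sgr_def
  by (subst fcalc_mult[OF continuous_on_heat continuous_on_heat, symmetric])
     (auto intro!: fcalc_cong heat_add)

lemma sgr_0 [simp]: "sgr 0 = id_blinfun"
  unfolding sgr_def fcalc_1[symmetric] by (rule fcalc_cong) simp

text \<open>With u = R^(1/2) x and w = (1 - R)^(1/2) x both sides become forms of functions of R at
  x, and the functions are compared by \<open>heat_first_order\<close>.\<close>

lemma sgr_sqrt_graph:
  assumes "(u, w) \<in> sqrt_graph" "0 \<le> t"
  shows "(u - sgr t u) \<bullet> u \<le> t * (w \<bullet> w)"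
proof -
  have c: "continuous_on {0..1} sqrt" "continuous_on {0..1} (\<lambda>r. sqrt (1 - r))"
    by (intro continuous_intros)+
  have ch: "continuous_on {0..1} (\<lambda>r. 1 - heat t r)"
    by (intro continuous_intros continuous_on_heat assms)
  obtain x where x: "u = fcalc sqrt x" "w = fcalc (\<lambda>r. sqrt (1 - r)) x"
    using assms(1) by (auto simp: sqrt_graph_def)
  have "u - sgr t u = fcalc (\<lambda>r. 1 - heat t r) u"
    unfolding sgr_def
    by (subst fcalc_diff) (auto intro!: continuous_intros continuous_on_heat assms simp: blinfun.diff_left)
  then have "(u - sgr t u) \<bullet> u = fcalc (\<lambda>r. 1 - heat t r) u \<bullet> u" by simp
  also have "\<dots> = fcalc sqrt (fcalc (\<lambda>r. 1 - heat t r) (fcalc sqrt x)) \<bullet> x"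
    unfolding x by (rule fcalc_sym[OF c(1), symmetric])
  also have "\<dots> = fcalc (\<lambda>r. sqrt r * ((1 - heat t r) * sqrt r)) x \<bullet> x"
    by (simp only: fcalc_mult_apply continuous_on_mult c ch)
  also have "\<dots> \<le> fcalc (\<lambda>r. t * (sqrt (1 - r) * sqrt (1 - r))) x \<bullet> x"
  proof (rule fcalc_mono)
    fix r :: real assume r: "0 \<le> r" "r \<le> 1"
    have "sqrt r * ((1 - heat t r) * sqrt r) = r * (1 - heat t r)" using r by simp
    also have "\<dots> \<le> t * (1 - r)" by (rule heat_first_order[OF assms(2) r])
    finally show "sqrt r * ((1 - heat t r) * sqrt r) \<le> t * (sqrt (1 - r) * sqrt (1 - r))" using r by simp
  qed (intro continuous_intros continuous_on_heat assms)+
  also have "\<dots> = t * (w \<bullet> w)"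
    by (simp only: fcalc_scaleR fcalc_mult continuous_on_mult c blinfun.scaleR_left
        blinfun_apply_blinfun_compose inner_scaleR_left x fcalc_sym[OF c(2)])
  finally show ?thesis .
qed

text \<open>On the range of R the deviation is O(t), because heat t r and 1 differ by at most t
  after multiplication by r. The operators are contractions, so density of this range is
  enough.\<close>

lemma sgr_tendsto:
  assumes dense: "closure (range (blinfun_apply R)) = UNIV"
  shows "((\<lambda>t. sgr t x) \<longlongrightarrow> x) (at_right 0)"
proof -
  have pos: "\<forall>\<^sub>F t in at_right 0. (0::real) < t" by (rule eventually_at_right_less)
  have "((\<lambda>t. (sgr t - id_blinfun) x) \<longlongrightarrow> 0) (at_right 0)"
  proof (rule strong_limit_0_dense[OF dense, where K = 2])
    show "\<forall>\<^sub>F t in at_right 0. norm (sgr t - id_blinfun) \<le> 2"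
      using pos
    proof eventually_elim
      fix t :: real assume "0 < t"
      have "norm (sgr t - id_blinfun) \<le> norm (sgr t) + norm (id_blinfun :: 'h \<Rightarrow>\<^sub>L 'h)"
        by (rule norm_triangle_ineq4)
      also have "\<dots> \<le> 1 + 1"
        using norm_sgr_le[of t] \<open>0 < t\<close> norm_blinfun_id_le by (intro add_mono) auto
      finally show "norm (sgr t - id_blinfun) \<le> 2" by simp
    qed
  next
    fix y assume "y \<in> range (blinfun_apply R)"
    then obtain z where z: "y = R z" by auto
    show "((\<lambda>t. (sgr t - id_blinfun) y) \<longlongrightarrow> 0) (at_right 0)"
    proof (rule tendsto_0_le[where K = "norm z"])
      show "((\<lambda>t::real. t) \<longlongrightarrow> 0) (at_right 0)" by (rule tendsto_ident_at)
      show "\<forall>\<^sub>F t in at_right 0. norm ((sgr t - id_blinfun) y) \<le> norm t * norm z"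
        using pos
      proof eventually_elim
        fix t :: real assume t: "0 < t"
        then have c: "continuous_on {0..1} (heat t)" by (intro continuous_on_heat) simp
        have "(sgr t - id_blinfun) y = fcalc (\<lambda>r. heat t r * r - r) z"
          unfolding sgr_def z
          by (simp add: fcalc_diff fcalc_mult c continuous_on_mult continuous_on_id blinfun.diff_left)
        moreover have "norm (fcalc (\<lambda>r. heat t r * r - r)) \<le> t"
        proof (rule fcalc_norm_le)
          fix r :: real assume r: "0 \<le> r" "r \<le> 1"
          have "r * (1 - heat t r) \<le> t * (1 - r)" using t r by (intro heat_first_order) auto
          also have "\<dots> \<le> t * 1" using t r by (intro mult_left_mono) auto
          moreover have "0 \<le> r * (1 - heat t r)"
            using heat_bounds[of t r] t r by (intro mult_nonneg_nonneg) auto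
          moreover have "heat t r * r - r = - (r * (1 - heat t r))" by (simp add: algebra_simps)
          ultimately show "\<bar>heat t r * r - r\<bar> \<le> t" by linarith
        qed (intro continuous_intros c)
        ultimately show "norm ((sgr t - id_blinfun) y) \<le> norm t * norm z"
          using t norm_blinfun_le by (simp only: real_norm_def abs_of_pos)
      qed
    qed
  qed
  then have "((\<lambda>t. (sgr t - id_blinfun) x + x) \<longlongrightarrow> 0 + x) (at_right 0)" by (intro tendsto_intros)
  then show ?thesis by (simp add: blinfun.diff_left)
qed

text \<open>The points R y exhaust the domain of A, and A sends R y to y - R y. The error is (g
  t)(R) y: its operator norm is at most 1 by the first-order estimate, and on the range of R it is
  O(t) by the second-order one.\<close>

lemma sgr_generator:
  assumes dense: "closure (range (blinfun_apply R)) = UNIV"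
  shows "((\<lambda>t. (1 / t) *\<^sub>R (sgr t (R y) - R y)) \<longlongrightarrow> - (y - R y)) (at_right 0)"
proof -
  have pos: "\<forall>\<^sub>F t in at_right 0. (0::real) < t" by (rule eventually_at_right_less)
  define g where "g = (\<lambda>t r. (1 / t) * (heat t r * r - r) + (1 - r))"
  have c: "continuous_on {0..1} (g t)" if "0 < t" for t
    unfolding g_def using that by (intro continuous_intros continuous_on_heat) auto
  have g: "fcalc (g t) x = (1 / t) *\<^sub>R (sgr t (R x) - R x) + (x - R x)" if t: "0 < t" for t x
  proof -
    have ch: "continuous_on {0..1} (heat t)" using t by (intro continuous_on_heat) simp
    have c1: "continuous_on {0..1} (\<lambda>r. heat t r * r)" by (intro continuous_intros ch)
    have c2: "continuous_on {0..1} (\<lambda>r. heat t r * r - r)" by (intro continuous_intros ch)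
    have c3: "continuous_on {0..1} (\<lambda>r. (1 / t) * (heat t r * r - r))" by (intro continuous_intros ch)
    have c4: "continuous_on {0..1} (\<lambda>r. 1 - r :: real)" by (intro continuous_intros)
    have "fcalc (g t) = (1 / t) *\<^sub>R ((fcalc (heat t) o\<^sub>L R) - R) + (id_blinfun - R)"
      unfolding g_def fcalc_add[OF c3 c4] fcalc_scaleR[OF c2] fcalc_diff[OF c1 continuous_on_id]
        fcalc_mult[OF ch continuous_on_id] fcalc_diff[OF continuous_on_const continuous_on_id]
      by simp
    then show ?thesis by (simp add: blinfun.bilinear_simps sgr_def)
  qed
  have "((\<lambda>t. fcalc (g t) y) \<longlongrightarrow> 0) (at_right 0)"
  proof (rule strong_limit_0_dense[OF dense, where K = 1])
    show "\<forall>\<^sub>F t in at_right 0. norm (fcalc (g t)) \<le> 1"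
      using pos
    proof eventually_elim
      fix t :: real assume t: "0 < t"
      show "norm (fcalc (g t)) \<le> 1"
      proof (rule fcalc_norm_le[OF c[OF t]])
        fix r :: real assume r: "0 \<le> r" "r \<le> 1"
        have "(1 / t) * (r * (1 - heat t r)) \<le> (1 / t) * (t * (1 - r))"
          using t r by (intro mult_left_mono heat_first_order) auto
        moreover have "0 \<le> (1 / t) * (r * (1 - heat t r))"
          using heat_bounds[of t r] t r by (intro mult_nonneg_nonneg) auto
        moreover have "g t r = (1 - r) - (1 / t) * (r * (1 - heat t r))"
          unfolding g_def by (simp add: algebra_simps)
        moreover have "(1 / t) * (t * (1 - r)) = 1 - r" using t by simp
        ultimately show "\<bar>g t r\<bar> \<le> 1" using r by linarith
      qed
    qed
  next
    fix x assume "x \<in> range (blinfun_apply R)"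
    then obtain z where z: "x = R z" by auto
    show "((\<lambda>t. fcalc (g t) x) \<longlongrightarrow> 0) (at_right 0)"
    proof (rule tendsto_0_le[where K = "norm z"])
      show "((\<lambda>t::real. t) \<longlongrightarrow> 0) (at_right 0)" by (rule tendsto_ident_at)
      show "\<forall>\<^sub>F t in at_right 0. norm (fcalc (g t) x) \<le> norm t * norm z"
        using pos
      proof eventually_elim
        fix t :: real assume t: "0 < t"
        have "fcalc (g t) x = fcalc (\<lambda>r. g t r * r) z"
          unfolding z using fcalc_mult_apply[OF c[OF t] continuous_on_id, of z] by simp
        moreover have "norm (fcalc (\<lambda>r. g t r * r)) \<le> t"
          unfolding g_def
          by (rule fcalc_norm_le) (use t heat_second_order in \<open>auto intro!: continuous_intros continuous_on_heat\<close>)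
        ultimately show "norm (fcalc (g t) x) \<le> norm t * norm z"
          using t norm_blinfun_le by (simp only: real_norm_def abs_of_pos)
      qed
    qed
  qed
  then have "((\<lambda>t. fcalc (g t) y - (y - R y)) \<longlongrightarrow> 0 - (y - R y)) (at_right 0)" by (intro tendsto_intros)
  moreover have "\<forall>\<^sub>F t in at_right 0. fcalc (g t) y - (y - R y) = (1 / t) *\<^sub>R (sgr t (R y) - R y)"
    using pos by eventually_elim (simp add: g)
  ultimately show ?thesis by (simp add: tendsto_cong)
qed

lemma c0_gen_sgr:
  assumes A: "psa A" and AR: "A = range (\<lambda>x. (R x, x - R x))"
  shows "c0_gen sgr A"
  unfolding c0_gen_def
proof (intro conjI allI impI)
  have "Domain A = range (blinfun_apply R)" unfolding AR by auto
  then have dense: "closure (range (blinfun_apply R)) = UNIV" using A by (simp add: psa_def)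
  show "((\<lambda>t. sgr t x) \<longlongrightarrow> x) (at_right 0)" for x by (rule sgr_tendsto[OF dense])
  show "((\<lambda>t. (1 / t) *\<^sub>R (sgr t f - f)) \<longlongrightarrow> g) (at_right 0) \<longleftrightarrow> (f, - g) \<in> A" for f g
  proof
    assume "(f, - g) \<in> A"
    then obtain y where "f = R y" "- g = y - R y" unfolding AR by auto
    then show "((\<lambda>t. (1 / t) *\<^sub>R (sgr t f - f)) \<longlongrightarrow> g) (at_right 0)"
      using sgr_generator[OF dense, of y] by (metis minus_minus)
  next
    assume g: "((\<lambda>t. (1 / t) *\<^sub>R (sgr t f - f)) \<longlongrightarrow> g) (at_right 0)"
    \<comment> \<open>The difference quotients are symmetric operators, so in the limit (f, -g)
      satisfies the adjoint relation with every pair of A; self-adjointness then places it in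
      A.\<close>
    have "v \<bullet> f = u \<bullet> (- g)" if uv: "(u, v) \<in> A" for u v
    proof -
      obtain y where y: "u = R y" "v = y - R y" using uv unfolding AR by auto
      have "((\<lambda>t. (1 / t) *\<^sub>R (sgr t u - u)) \<longlongrightarrow> - v) (at_right 0)"
        unfolding y by (rule sgr_generator[OF dense])
      then have 1: "((\<lambda>t. ((1 / t) *\<^sub>R (sgr t u - u)) \<bullet> f) \<longlongrightarrow> - v \<bullet> f) (at_right 0)"
        by (intro tendsto_intros)
      have 2: "((\<lambda>t. u \<bullet> ((1 / t) *\<^sub>R (sgr t f - f))) \<longlongrightarrow> u \<bullet> g) (at_right 0)"
        by (intro tendsto_intros g)
      have "\<forall>\<^sub>F t in at_right 0. (0::real) < t" by (rule eventually_at_right_less)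
      then have "\<forall>\<^sub>F t in at_right 0. ((1 / t) *\<^sub>R (sgr t u - u)) \<bullet> f = u \<bullet> ((1 / t) *\<^sub>R (sgr t f - f))"
        by eventually_elim (simp add: inner_diff_left inner_diff_right sgr_sym)
      from Lim_transform_eventually[OF 1 this]
      have "((\<lambda>t. u \<bullet> ((1 / t) *\<^sub>R (sgr t f - f))) \<longlongrightarrow> - v \<bullet> f) (at_right 0)" .
      from tendsto_unique[OF _ this 2] have "- v \<bullet> f = u \<bullet> g" by simp
      then show ?thesis by (simp add: inner_minus_left inner_minus_right)
    qed
    then show "(f, - g) \<in> A" using psa_iff[OF A] by blast
  qed
qed (simp_all add: sgr_add)

end

section \<open>Uniqueness of a semigroup with a given generator\<close>

text \<open>Banach-Steinhaus through Baire: one of the closed sets E n contains a ball of radius e,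
  and c y is the difference of two of its points for c = e/|y|, whence the constant 2 n/e.\<close>

lemma uniform_boundedness:
  fixes F :: "'i \<Rightarrow> 'a::banach \<Rightarrow>\<^sub>L 'b::real_normed_vector"
  assumes bdd: "\<And>x. \<exists>C. \<forall>i\<in>I. norm (F i x) \<le> C"
  shows "\<exists>C. \<forall>i\<in>I. norm (F i) \<le> C"
proof -
  define E where "E n = (\<Inter>i\<in>I. {x. norm (F i x) \<le> real n})" for n
  have cl: "closed (E n)" for n
    unfolding E_def by (intro closed_INT ballI closed_Collect_le continuous_intros)
  have un: "(\<Union>n. E n) = UNIV"
  proof (intro equalityI subset_UNIV subsetI)
    fix x
    obtain C where C: "\<forall>i\<in>I. norm (F i x) \<le> C" using bdd by blast
    obtain n where "C \<le> real n" using real_arch_simple by blast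
    with C have "x \<in> E n" unfolding E_def by (auto intro: order_trans)
    then show "x \<in> (\<Union>n. E n)" by blast
  qed
  have "\<exists>n. interior (E n) \<noteq> {}"
  proof (rule ccontr)
    assume neg: "\<nexists>n. interior (E n) \<noteq> {}"
    have "euclidean interior_of \<Union>(range E) = {}"
    proof (rule Baire_category_alt)
      show "completely_metrizable_space (euclidean :: 'a topology) \<or>
        locally_compact_space (euclidean :: 'a topology) \<and> regular_space (euclidean :: 'a topology)"
        using completely_metrizable_space_euclidean by blast
    qed (use neg cl in auto)
    then show False by (simp add: un)
  qed
  then obtain n x where "x \<in> interior (E n)" by blast
  then obtain e where e: "0 < e" "cball x e \<subseteq> E n"
    by (meson mem_interior_cball)
  have "norm (F i) \<le> 2 * real n / e" if i: "i \<in> I" for i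
  proof (rule norm_blinfun_bound)
    show "0 \<le> 2 * real n / e" using e by simp
    fix y
    show "norm (F i y) \<le> 2 * real n / e * norm y"
    proof (cases "y = 0")
      case False
      define c where "c = e / norm y"
      have c: "0 < c" using False e by (simp add: c_def)
      have "x + c *\<^sub>R y \<in> E n" "x \<in> E n"
        using e c False by (auto intro!: subsetD[OF e(2)] simp: dist_norm c_def)
      then have "norm (F i (x + c *\<^sub>R y)) \<le> real n" "norm (F i x) \<le> real n"
        using i by (auto simp: E_def)
      moreover have "c *\<^sub>R F i y = F i (x + c *\<^sub>R y) - F i x"
        by (simp add: blinfun.bilinear_simps)
      ultimately have "norm (c *\<^sub>R F i y) \<le> real n + real n"
        by (metis add_mono norm_triangle_ineq4 order_trans)
      then show ?thesis using c False e by (simp add: c_def field_simps)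
    qed simp
  qed
  then show ?thesis by blast
qed

text \<open>If T were unbounded near 0, there would be times h n tending to 0 with norms above n;
  but T (h n) x converges for every x, against Banach-Steinhaus. The semigroup law spreads the bound
  from a neighbourhood of 0 to [0, t].\<close>

lemma c0_gen_locally_bounded:
  fixes T :: "real \<Rightarrow> 'h::banach \<Rightarrow>\<^sub>L 'h"
  assumes T: "c0_gen T A"
  shows "\<exists>K. \<forall>s\<in>{0..t}. norm (T s) \<le> K"
proof -
  have add: "T (a + b) = T a o\<^sub>L T b" if "0 \<le> a" "0 \<le> b" for a b
    using T that by (auto simp: c0_gen_def)
  have "\<exists>d C. 0 < d \<and> (\<forall>h. 0 < h \<and> h \<le> d \<longrightarrow> norm (T h) \<le> C)"
  proof (rule ccontr)
    assume "\<nexists>d C. 0 < d \<and> (\<forall>h. 0 < h \<and> h \<le> d \<longrightarrow> norm (T h) \<le> C)"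
    then have "\<exists>h. 0 < h \<and> h \<le> 1 / real (Suc n) \<and> real n < norm (T h)" for n
      by (metis not_le of_nat_0_less_iff zero_less_Suc zero_less_divide_1_iff)
    then obtain h where h: "\<And>n. 0 < h n" "\<And>n. h n \<le> 1 / real (Suc n)" "\<And>n. real n < norm (T (h n))"
      by metis
    have "h \<longlonglongrightarrow> 0"
    proof (rule tendsto_sandwich[of "\<lambda>_. 0" _ _ "\<lambda>n. 1 / real (Suc n)"])
      show "(\<lambda>n. 1 / real (Suc n)) \<longlonglongrightarrow> 0" by real_asymp
    qed (simp_all only: h less_imp_le[OF h(1)] eventually_True tendsto_const)
    then have lim: "filterlim h (at_right 0) sequentially"
    proof -
      have "h n \<in> {0<..} \<and> h n \<noteq> 0" for n using h(1)[of n] by simp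
      with \<open>h \<longlonglongrightarrow> 0\<close> show ?thesis
        unfolding filterlim_at by (intro conjI always_eventually allI) auto
    qed
    have "\<exists>C. \<forall>n\<in>UNIV. norm (T (h n) x) \<le> C" for x
    proof -
      have "(\<lambda>n. T (h n) x) \<longlonglongrightarrow> x"
        by (rule filterlim_compose[OF _ lim]) (use T in \<open>auto simp: c0_gen_def\<close>)
      then have "Bseq (\<lambda>n. T (h n) x)" by (intro convergent_imp_Bseq convergentI)
      then show ?thesis by (auto simp: Bseq_def)
    qed
    from uniform_boundedness[OF this] obtain C where "\<And>n. norm (T (h n)) \<le> C" by blast
    moreover obtain n where "C < real n" using reals_Archimedean2 by blast
    ultimately show False using h(3)[of n] by (meson less_asym order_le_less_trans)
  qed
  then obtain d C where d: "0 < d" and C: "\<And>h. 0 < h \<Longrightarrow> h \<le> d \<Longrightarrow> norm (T h) \<le> C" by blast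
  define D where "D = max C 1"
  have D: "1 \<le> D" by (simp add: D_def)
  have T0: "norm (T 0) \<le> 1" using T norm_blinfun_id_le by (simp add: c0_gen_def)
  have small: "norm (T s) \<le> D" if "0 \<le> s" "s \<le> d" for s
    using C[of s] T0 that by (cases "s = 0") (auto simp: D_def)
  have "norm (T s) \<le> D ^ Suc m" if "0 \<le> s" "s \<le> real (Suc m) * d" for s m
    using that
  proof (induction m arbitrary: s)
    case 0
    then show ?case using small by simp
  next
    case (Suc m)
    show ?case
    proof (cases "s \<le> d")
      case True
      then have "norm (T s) \<le> D" using Suc.prems small by simp
      also have "\<dots> \<le> D ^ Suc (Suc m)" using D by (rule self_le_power) simp
      finally show ?thesis .
    next
      case False
      then have "T s = T (s - d) o\<^sub>L T d" using add[of "s - d" d] d by simp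
      then have "norm (T s) \<le> norm (T (s - d)) * norm (T d)" by (simp add: norm_blinfun_compose)
      also have "\<dots> \<le> D ^ Suc m * D"
        using False Suc.prems d D by (intro mult_mono Suc.IH small) (auto simp: algebra_simps)
      finally show ?thesis by (simp add: mult.commute)
    qed
  qed
  moreover obtain m where "t / d \<le> real m" using real_arch_simple by blast
  then have "t \<le> real (Suc m) * d" using d by (simp add: field_simps)
  ultimately show ?thesis by (intro exI[of _ "D ^ Suc m"] ballI) auto
qed

lemma c0_gen_tendsto:
  assumes T: "c0_gen T A" and xy: "(x, y) \<in> A"
  shows "((\<lambda>t. (1 / t) *\<^sub>R (T t x - x)) \<longlongrightarrow> - y) (at_right 0)"
proof -
  have "(x, - (- y)) \<in> A" using xy by simp
  then show ?thesis using T unfolding c0_gen_def by blast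
qed

lemma c0_gen_commute:
  assumes T: "c0_gen T A" and xy: "(x, y) \<in> A" and s: "0 \<le> s"
  shows "(T s x, T s y) \<in> A"
proof -
  from c0_gen_tendsto[OF T xy]
  have "((\<lambda>t. T s ((1 / t) *\<^sub>R (T t x - x))) \<longlongrightarrow> T s (- y)) (at_right 0)"
    by (intro tendsto_intros)
  moreover have "\<forall>\<^sub>F t in at_right 0. (0::real) < t" by (rule eventually_at_right_less)
  then have "\<forall>\<^sub>F t in at_right 0. T s ((1 / t) *\<^sub>R (T t x - x)) = (1 / t) *\<^sub>R (T t (T s x) - T s x)"
  proof eventually_elim
    fix t :: real assume t: "0 < t"
    have "T (s + t) = T s o\<^sub>L T t" "T (t + s) = T t o\<^sub>L T s"
      using T s t by (simp_all add: c0_gen_def)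
    then have "T s o\<^sub>L T t = T t o\<^sub>L T s" by (simp add: add.commute)
    from arg_cong[OF this, of "\<lambda>X. X x"] have "T s (T t x) = T t (T s x)" by simp
    then show "T s ((1 / t) *\<^sub>R (T t x - x)) = (1 / t) *\<^sub>R (T t (T s x) - T s x)"
      by (simp only: blinfun.scaleR_right blinfun.diff_right)
  qed
  ultimately have "((\<lambda>t. (1 / t) *\<^sub>R (T t (T s x) - T s x)) \<longlongrightarrow> T s (- y)) (at_right 0)"
    by (simp add: tendsto_cong)
  then have "(T s x, - (T s (- y))) \<in> A"
    using T unfolding c0_gen_def by blast
  then show ?thesis by (simp add: blinfun.minus_right)
qed

text \<open>The generator only gives a right derivative at time 0. A difference of T at r and s
  factors through T at the smaller of the two times, so the local norm bound carries the limit to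
  both sides of s.\<close>

lemma c0_gen_derivative:
  fixes T :: "real \<Rightarrow> 'h::banach \<Rightarrow>\<^sub>L 'h"
  assumes T: "c0_gen T A" and xy: "(x, y) \<in> A" and s: "s \<in> {0..t}"
  shows "((\<lambda>s. T s x) has_vector_derivative - T s y) (at s within {0..t})"
  unfolding has_vector_derivative_def has_derivative_within
proof (intro conjI)
  show "bounded_linear (\<lambda>c. c *\<^sub>R - T s y)" by (rule bounded_linear_scaleR_left)
  obtain K0 where K0: "\<And>s. s \<in> {0..t} \<Longrightarrow> norm (T s) \<le> K0"
    using c0_gen_locally_bounded[OF T] by blast
  define K where "K = \<bar>K0\<bar> + 1"
  have K: "0 < K" "\<And>s. s \<in> {0..t} \<Longrightarrow> norm (T s) \<le> K" using K0 by (force simp: K_def)+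
  have add: "T (a + b) = T a o\<^sub>L T b" if "0 \<le> a" "0 \<le> b" for a b
    using T that by (auto simp: c0_gen_def)
  have T0: "T 0 = id_blinfun" using T by (simp add: c0_gen_def)
  define q where "q h = (1 / h) *\<^sub>R (T h x - x)" for h
  have q: "(q \<longlongrightarrow> - y) (at_right 0)"
    unfolding q_def by (rule c0_gen_tendsto[OF T xy])
  have Ty: "((\<lambda>h. T h y) \<longlongrightarrow> y) (at_right 0)" using T by (simp add: c0_gen_def)
  show "((\<lambda>r. (1 / norm (r - s)) *\<^sub>R (T r x - (T s x + (r - s) *\<^sub>R - T s y))) \<longlongrightarrow> 0)
      (at s within {0..t})"
  proof (rule tendstoI)
    fix e :: real assume e: "0 < e"
    define e' where "e' = e / (2 * K)"
    have e': "0 < e'" using e K by (simp add: e'_def)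
    have "\<forall>\<^sub>F h in at_right 0. dist (q h) (- y) < e' \<and> dist (T h y) y < e'"
      using q Ty e' by (intro eventually_conj tendstoD)
    then obtain b where b: "0 < b" "\<And>h. 0 < h \<Longrightarrow> h < b \<Longrightarrow> dist (q h) (- y) < e' \<and> dist (T h y) y < e'"
      unfolding eventually_at_right_field by auto
    have "dist ((1 / norm (r - s)) *\<^sub>R (T r x - (T s x + (r - s) *\<^sub>R - T s y))) 0 < e"
      if r: "r \<in> {0..t}" "r \<noteq> s" "dist r s < b" for r
    proof -
      \<comment> \<open>m is the smaller time, h the gap and \<sigma> the sign of r - s, so that one
        computation serves both sides.\<close>
      define h m where "h = \<bar>r - s\<bar>" and "m = min r s"
      define \<sigma> where "\<sigma> = sgn (r - s)"
      have h: "0 < h" "h < b" using r by (auto simp: h_def dist_real_def)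
      have m: "m \<in> {0..t}" using r s by (auto simp: m_def)
      have \<sigma>: "\<bar>\<sigma>\<bar> = 1" "r - s = \<sigma> * h" using r by (auto simp: \<sigma>_def h_def abs_sgn_eq sgn_mult_abs)
      have Th: "T (m + h) = T m o\<^sub>L T h" using m h by (intro add) auto
      have "T r x - T s x = \<sigma> *\<^sub>R (T m (T h x - x))"
      proof (cases "s < r")
        case True
        then have "m + h = r" "m = s" "\<sigma> = 1" by (auto simp: m_def h_def \<sigma>_def)
        then show ?thesis using Th by (simp add: blinfun.diff_right)
      next
        case False
        then have "m + h = s" "m = r" "\<sigma> = -1" using r by (auto simp: m_def h_def \<sigma>_def)
        then show ?thesis using Th by (simp add: blinfun.diff_right)
      qed
      also have "T h x - x = h *\<^sub>R q h" using h by (simp add: q_def)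
      finally have "T r x - (T s x + (r - s) *\<^sub>R - T s y) = (\<sigma> * h) *\<^sub>R (T m (q h) + T s y)"
        unfolding \<sigma>(2) by (simp add: blinfun.scaleR_right algebra_simps)
      \<comment> \<open>The second term corrects for the base point m in place of s. It vanishes
        from the right and is small from the left, by strong continuity at 0 applied to y.\<close>
      also have "T m (q h) + T s y = T m (q h + y) + (T s y - T m y)"
        by (simp add: blinfun.add_right)
      finally have eq: "T r x - (T s x + (r - s) *\<^sub>R - T s y)
        = (\<sigma> * h) *\<^sub>R (T m (q h + y) + (T s y - T m y))" .
      have 1: "norm (T m (q h + y)) < e / 2"
      proof -
        have "norm (T m (q h + y)) \<le> norm (T m) * norm (q h + y)" by (rule norm_blinfun)
        also have "\<dots> \<le> K * norm (q h + y)" by (intro mult_right_mono K m) simp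
        also have "\<dots> < K * e'" using b(2)[OF h] K by (simp add: dist_norm)
        also have "\<dots> = e / 2" using K by (simp add: e'_def)
        finally show ?thesis .
      qed
      have 2: "norm (T s y - T m y) < e / 2"
      proof (cases "m = s")
        case False
        then have "s = m + h" by (auto simp: m_def h_def)
        then have "T s y - T m y = T m (T h y - y)" using Th by (simp add: blinfun.diff_right)
        then have "norm (T s y - T m y) \<le> norm (T m) * norm (T h y - y)" by (simp add: norm_blinfun)
        also have "\<dots> \<le> K * norm (T h y - y)" by (intro mult_right_mono K m) simp
        also have "\<dots> < K * e'" using b(2)[OF h] K by (simp add: dist_norm)
        also have "\<dots> = e / 2" using K by (simp add: e'_def)
        finally show ?thesis .
      qed (use e in simp)
      have "norm ((1 / norm (r - s)) *\<^sub>R (T r x - (T s x + (r - s) *\<^sub>R - T s y)))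
          = norm (T m (q h + y) + (T s y - T m y))"
        unfolding eq using \<sigma>(1) h by (simp add: h_def[symmetric] abs_mult)
      also have "\<dots> \<le> norm (T m (q h + y)) + norm (T s y - T m y)" by (rule norm_triangle_ineq)
      also have "\<dots> < e" using 1 2 by simp
      finally show ?thesis by (simp only: dist_norm diff_zero)
    qed
    then show "\<forall>\<^sub>F r in at s within {0..t}.
        dist ((1 / norm (r - s)) *\<^sub>R (T r x - (T s x + (r - s) *\<^sub>R - T s y))) 0 < e"
      unfolding eventually_at using b(1) by blast
  qed
qed

text \<open>For x and x' in the domain of A, <T_s x, S_(t-s) x'> is constant in s: its derivative is
  <T_s x, A S_(t-s) x'> - <A T_s x, S_(t-s) x'>, which is 0 by symmetry of A. The ends s = 0 and s =
  t are compared by means of the symmetry of S.\<close>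

theorem c0_gen_unique:
  fixes T S :: "real \<Rightarrow> 'h::{real_inner,banach} \<Rightarrow>\<^sub>L 'h"
  assumes A: "psa A" and T: "c0_gen T A" and S: "c0_gen S A"
    and sym: "\<And>t x y. 0 \<le> t \<Longrightarrow> S t x \<bullet> y = x \<bullet> S t y" and t: "0 \<le> t"
  shows "T t = S t"
proof -
  have dense: "closure (Domain A) = UNIV" using A by (simp add: psa_def)
  have "T t x \<bullet> x' = S t x \<bullet> x'" if xy: "(x, y) \<in> A" and xy': "(x', y') \<in> A" for x y x' y'
  proof -
    have "((\<lambda>s. T s x \<bullet> S (t - s) x') has_field_derivative 0) (at s within {0..t})" if s: "s \<in> {0..t}" for s
    proof -
      have 1: "((\<lambda>s. T s x) has_vector_derivative - T s y) (at s within {0..t})"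
        by (rule c0_gen_derivative[OF T xy s])
      have im: "(\<lambda>s. t - s) ` {0..t} = {0..t}" by simp
      have ts: "t - s \<in> {0..t}" using s by auto
      have "((\<lambda>s. t - s) has_vector_derivative - 1) (at s within {0..t})"
        by (auto intro!: derivative_eq_intros)
      moreover have "((\<lambda>s. S s x') has_vector_derivative - S (t - s) y') (at (t - s) within (\<lambda>s. t - s) ` {0..t})"
        unfolding im by (rule c0_gen_derivative[OF S xy' ts])
      ultimately have "((\<lambda>s. S s x') \<circ> (\<lambda>s. t - s) has_vector_derivative (- 1) *\<^sub>R (- S (t - s) y')) (at s within {0..t})"
        by (rule vector_diff_chain_within)
      then have 2: "((\<lambda>s. S (t - s) x') has_vector_derivative S (t - s) y') (at s within {0..t})"
        by (simp add: o_def)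
      have "((\<lambda>s. T s x \<bullet> S (t - s) x') has_vector_derivative
          (T s x \<bullet> S (t - s) y' + - T s y \<bullet> S (t - s) x')) (at s within {0..t})"
        by (rule bounded_bilinear.has_vector_derivative[OF bounded_bilinear_inner 1 2])
      moreover have "S (t - s) y' \<bullet> T s x = S (t - s) x' \<bullet> T s y"
        using s by (intro psa_sym[OF A] c0_gen_commute[OF T xy] c0_gen_commute[OF S xy']) auto
      ultimately show ?thesis
        by (simp add: has_real_derivative_iff_has_vector_derivative inner_minus_left inner_commute)
    qed
    from has_field_derivative_zero_constant[OF _ this] obtain c
      where "\<And>s. s \<in> {0..t} \<Longrightarrow> T s x \<bullet> S (t - s) x' = c" by auto
    from this[of 0] this[of t] have "T t x \<bullet> S 0 x' = T 0 x \<bullet> S t x'" using t by simp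
    then show ?thesis using T S sym[OF t] by (simp add: c0_gen_def)
  qed
  then have "T t x - S t x = 0" if "x \<in> Domain A" for x
    using that by (intro orth_dense_eq_0[OF dense]) (auto simp: inner_diff_right inner_commute)
  then have "Domain A \<subseteq> {x. T t x = S t x}" by auto
  moreover have "closed {x. T t x = S t x}" by (intro closed_Collect_eq continuous_intros)
  ultimately have "{x. T t x = S t x} = UNIV" using dense closure_minimal by blast
  then show ?thesis by (intro blinfun_eqI) blast
qed

section \<open>The space of square-integrable functions\<close>

lemma L2_borel [measurable_dest]: "f \<in> L2 N \<Longrightarrow> f \<in> borel_measurable N"
  by (simp add: L2_def)

lemma L2_zero [simp]: "(\<lambda>_. 0) \<in> L2 N"
  by (simp add: L2_def)

lemma L2_scale: "f \<in> L2 N \<Longrightarrow> (\<lambda>x. c * f x) \<in> L2 N"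
  by (auto simp: L2_def norm_mult power_mult_distrib)

lemma L2_add:
  assumes "f \<in> L2 N" "g \<in> L2 N"
  shows "(\<lambda>x. f x + g x) \<in> L2 N"
proof -
  have [measurable]: "f \<in> borel_measurable N" "g \<in> borel_measurable N" using assms by (auto simp: L2_def)
  have "integrable N (\<lambda>x. 2 * (cmod (f x))\<^sup>2 + 2 * (cmod (g x))\<^sup>2)"
    using assms by (auto simp: L2_def)
  then have "integrable N (\<lambda>x. (cmod (f x + g x))\<^sup>2)"
  proof (rule Bochner_Integration.integrable_bound)
    show "AE x in N. norm ((cmod (f x + g x))\<^sup>2) \<le> norm (2 * (cmod (f x))\<^sup>2 + 2 * (cmod (g x))\<^sup>2)"
    proof (rule AE_I2)
      fix x
      have "(cmod (f x + g x))\<^sup>2 \<le> (cmod (f x) + cmod (g x))\<^sup>2"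
        by (intro power_mono norm_triangle_ineq norm_ge_zero)
      also have "\<dots> \<le> 2 * (cmod (f x))\<^sup>2 + 2 * (cmod (g x))\<^sup>2"
        using zero_le_power2[of "cmod (f x) - cmod (g x)"] by (simp add: power2_eq_square algebra_simps)
      finally show "norm ((cmod (f x + g x))\<^sup>2) \<le> norm (2 * (cmod (f x))\<^sup>2 + 2 * (cmod (g x))\<^sup>2)"
        by simp
    qed
  qed measurable
  then show ?thesis by (simp add: L2_def)
qed

lemma L2_uminus: "f \<in> L2 N \<Longrightarrow> (\<lambda>x. - f x) \<in> L2 N"
  using L2_scale[of f N "-1"] by simp

lemma L2_diff: "f \<in> L2 N \<Longrightarrow> g \<in> L2 N \<Longrightarrow> (\<lambda>x. f x - g x) \<in> L2 N"
  using L2_add[OF _ L2_uminus, of f N g] by simp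

lemma L2_integrable_mult:
  assumes "f \<in> L2 N" "g \<in> L2 N"
  shows "integrable N (\<lambda>x. cmod (f x) * cmod (g x))"
proof -
  have [measurable]: "f \<in> borel_measurable N" "g \<in> borel_measurable N" using assms by (auto simp: L2_def)
  have "integrable N (\<lambda>x. (cmod (f x))\<^sup>2 + (cmod (g x))\<^sup>2)"
    using assms by (auto simp: L2_def)
  then show ?thesis
  proof (rule Bochner_Integration.integrable_bound)
    show "AE x in N. norm (cmod (f x) * cmod (g x)) \<le> norm ((cmod (f x))\<^sup>2 + (cmod (g x))\<^sup>2)"
    proof (rule AE_I2)
      fix x
      have "0 \<le> cmod (f x) * cmod (g x)" by simp
      moreover have "0 \<le> (cmod (f x) - cmod (g x))\<^sup>2" by simp
      ultimately have "cmod (f x) * cmod (g x) \<le> (cmod (f x))\<^sup>2 + (cmod (g x))\<^sup>2"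
        unfolding power2_diff by linarith
      then show "norm (cmod (f x) * cmod (g x)) \<le> norm ((cmod (f x))\<^sup>2 + (cmod (g x))\<^sup>2)" by simp
    qed
  qed measurable
qed

lemma L2_integrable_cnj:
  assumes "f \<in> L2 N" "g \<in> L2 N"
  shows "integrable N (\<lambda>x. f x * cnj (g x))"
proof -
  have [measurable]: "f \<in> borel_measurable N" "g \<in> borel_measurable N" using assms by (auto simp: L2_def)
  have [measurable]: "(\<lambda>x. cnj (g x)) \<in> borel_measurable N"
    by (rule measurable_compose[of g N borel cnj])
       (auto intro!: borel_measurable_continuous_onI continuous_intros)
  show ?thesis
    by (rule Bochner_Integration.integrable_bound[OF L2_integrable_mult[OF assms]])
       (auto simp: norm_mult)
qed

lemma complex_inner_eq_Re: "z \<bullet> w = Re (z * cnj w)" for z w :: complex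
  by (simp add: inner_complex_def)

lemma L2_integrable_inner:
  "f \<in> L2 N \<Longrightarrow> g \<in> L2 N \<Longrightarrow> integrable N (\<lambda>x. f x \<bullet> g x)"
  unfolding complex_inner_eq_Re by (intro integrable_Re L2_integrable_cnj)

lemma Re_L2_inner: "f \<in> L2 N \<Longrightarrow> g \<in> L2 N \<Longrightarrow> Re (L2_inner N f g) = (LINT x|N. f x \<bullet> g x)"
  unfolding complex_inner_eq_Re L2_inner_def by (simp only: integral_Re L2_integrable_cnj)

text \<open>A fast subsequence converges almost everywhere, and Fatou's lemma turns this into
  convergence in the mean of the full sequence.\<close>

lemma Riesz_Fischer:
  fixes f :: "nat \<Rightarrow> 'b \<Rightarrow> complex"
  assumes f: "\<And>n. f n \<in> L2 N"
    and Cauchy: "\<And>e. 0 < e \<Longrightarrow> \<exists>K. \<forall>m\<ge>K. \<forall>n\<ge>K. (LINT x|N. (cmod (f m x - f n x))\<^sup>2) < e"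
  shows "\<exists>g\<in>L2 N. (\<lambda>n. LINT x|N. (cmod (f n x - g x))\<^sup>2) \<longlonglongrightarrow> 0"
proof -
  have [measurable]: "f n \<in> borel_measurable N" for n using f by (simp add: L2_def)
  have int: "integrable N (\<lambda>x. (cmod (f m x - f n x))\<^sup>2)" for m n
    using L2_diff[OF f f] by (simp add: L2_def)
  have nn: "(\<integral>\<^sup>+x. ennreal ((cmod (f m x - f n x))\<^sup>2) \<partial>N) = ennreal (LINT x|N. (cmod (f m x - f n x))\<^sup>2)" for m n
    by (intro nn_integral_eq_integral int) auto
  have "\<exists>K. \<forall>m\<ge>K. \<forall>n\<ge>K. (LINT x|N. (cmod (f m x - f n x))\<^sup>2) < (1 / 8) ^ k" for k
    by (rule Cauchy) simp
  then obtain K where K: "\<And>k m n. K k \<le> m \<Longrightarrow> K k \<le> n \<Longrightarrow> (LINT x|N. (cmod (f m x - f n x))\<^sup>2) < (1 / 8) ^ k"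
    by metis
  \<comment> \<open>The sum makes r increasing and at least as large as each K k; the summand k
    makes it tend to infinity.\<close>
  define r where "r k = (\<Sum>i\<le>k. K i) + k" for k
  have rK: "K k \<le> r k" for k unfolding r_def by (simp add: sum.atMost_Suc member_le_sum trans_le_add1)
  have r_mono: "r k \<le> r (Suc k)" for k unfolding r_def by simp
  have rk: "k \<le> r k" for k unfolding r_def by simp
  define d where "d k x = cmod (f (r k) x - f (r (Suc k)) x)" for k x
  have [measurable]: "d k \<in> borel_measurable N" for k unfolding d_def by measurable
  \<comment> \<open>The weight 4^k leaves 2^-k of the bound 8^-k, which is still summable; where the
    weighted series is finite, d k x is O(2^-k).\<close>
  have dle: "(\<integral>\<^sup>+x. ennreal (4 ^ k * (d k x)\<^sup>2) \<partial>N) \<le> ennreal ((1 / 2) ^ k)" for k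
  proof -
    have "(\<integral>\<^sup>+x. ennreal (4 ^ k * (d k x)\<^sup>2) \<partial>N) = ennreal (4 ^ k) * (\<integral>\<^sup>+x. ennreal ((d k x)\<^sup>2) \<partial>N)"
      by (simp add: ennreal_mult nn_integral_cmult)
    also have "\<dots> \<le> ennreal (4 ^ k) * ennreal ((1 / 8) ^ k)"
      unfolding d_def nn
      by (intro mult_left_mono ennreal_leI less_imp_le K rK order_trans[OF rK r_mono]) auto
    also have "\<dots> = ennreal (4 ^ k * (1 / 8) ^ k)" by (simp add: ennreal_mult)
    also have "(4::real) ^ k * (1 / 8) ^ k = (1 / 2) ^ k" by (simp flip: power_mult_distrib)
    finally show ?thesis .
  qed
  have "(\<integral>\<^sup>+x. (\<Sum>k. ennreal (4 ^ k * (d k x)\<^sup>2)) \<partial>N) = (\<Sum>k. \<integral>\<^sup>+x. ennreal (4 ^ k * (d k x)\<^sup>2) \<partial>N)"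
    by (intro nn_integral_suminf) measurable
  also have "\<dots> \<le> (\<Sum>k. ennreal ((1 / 2) ^ k))"
    by (intro suminf_le dle) auto
  also have "\<dots> = ennreal (\<Sum>k. (1 / 2) ^ k)"
    by (intro suminf_ennreal2 summable_geometric) auto
  also have "\<dots> < \<infinity>" by simp
  finally have "AE x in N. (\<Sum>k. ennreal (4 ^ k * (d k x)\<^sup>2)) \<noteq> \<infinity>"
    by (intro nn_integral_noteq_infinite) (auto simp: less_top)
  then have conv: "AE x in N. convergent (\<lambda>k. f (r k) x)"
  proof eventually_elim
    fix x assume fin: "(\<Sum>k. ennreal (4 ^ k * (d k x)\<^sup>2)) \<noteq> \<infinity>"
    define C where "C = enn2real (\<Sum>k. ennreal (4 ^ k * (d k x)\<^sup>2))"
    have C0: "0 \<le> C" by (simp add: C_def)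
    have dk: "d k x \<le> sqrt C * (1 / 2) ^ k" for k
    proof -
      have "u k \<le> suminf u" for u :: "nat \<Rightarrow> ennreal"
        using sum_le_suminf[of u "{k}"] by simp
      then have "ennreal (4 ^ k * (d k x)\<^sup>2) \<le> (\<Sum>k. ennreal (4 ^ k * (d k x)\<^sup>2))" .
      also have "\<dots> = ennreal C" using fin by (simp add: C_def less_top)
      finally have "4 ^ k * (d k x)\<^sup>2 \<le> C" using C0 by simp
      moreover have "4 ^ k * (d k x)\<^sup>2 = (2 ^ k * d k x)\<^sup>2"
      proof -
        have "(4::real) ^ k = (2 ^ k)\<^sup>2" by (simp add: power2_eq_square flip: power_mult_distrib)
        then show ?thesis by (simp add: power_mult_distrib)
      qed
      ultimately have "2 ^ k * d k x \<le> sqrt C" by (simp add: real_le_rsqrt)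
      then show ?thesis by (simp add: power_one_over field_simps)
    qed
    have "summable (\<lambda>k. f (r (Suc k)) x - f (r k) x)"
    proof (rule summable_comparison_test')
      show "summable (\<lambda>k. sqrt C * (1 / 2) ^ k)" by (intro summable_mult summable_geometric) auto
      show "norm (f (r (Suc k)) x - f (r k) x) \<le> sqrt C * (1 / 2) ^ k" for k
        using dk[of k] by (simp add: d_def norm_minus_commute)
    qed
    then have "convergent (\<lambda>n. \<Sum>k<n. f (r (Suc k)) x - f (r k) x)"
      by (simp add: summable_iff_convergent)
    then have "convergent (\<lambda>n. (f (r n) x - f (r 0) x))"
      unfolding sum_lessThan_telescope[of "\<lambda>k. f (r k) x"] .
    then have "convergent (\<lambda>n. (f (r n) x - f (r 0) x) + f (r 0) x)"
      by (intro convergent_add convergent_const)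
    then show "convergent (\<lambda>k. f (r k) x)" by simp
  qed
  define g where "g x = lim (\<lambda>k. f (r k) x)" for x
  have [measurable]: "g \<in> borel_measurable N"
    unfolding g_def by (intro borel_measurable_lim_metric) measurable
  have lim: "AE x in N. (\<lambda>k. f (r k) x) \<longlonglongrightarrow> g x"
    using conv unfolding g_def by eventually_elim (simp add: convergent_LIMSEQ_iff)
  have fatou: "(\<integral>\<^sup>+x. ennreal ((cmod (f n x - g x))\<^sup>2) \<partial>N) \<le> ennreal e"
    if e: "\<And>m. n \<le> m \<Longrightarrow> (LINT x|N. (cmod (f n x - f m x))\<^sup>2) \<le> e" for n e
  proof -
    have "(\<integral>\<^sup>+x. ennreal ((cmod (f n x - g x))\<^sup>2) \<partial>N)
        = (\<integral>\<^sup>+x. liminf (\<lambda>k. ennreal ((cmod (f n x - f (r k) x))\<^sup>2)) \<partial>N)"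
    proof (rule nn_integral_cong_AE)
      show "AE x in N. ennreal ((cmod (f n x - g x))\<^sup>2) = liminf (\<lambda>k. ennreal ((cmod (f n x - f (r k) x))\<^sup>2))"
        using lim
      proof eventually_elim
        fix x assume "(\<lambda>k. f (r k) x) \<longlonglongrightarrow> g x"
        then have "(\<lambda>k. ennreal ((cmod (f n x - f (r k) x))\<^sup>2)) \<longlonglongrightarrow> ennreal ((cmod (f n x - g x))\<^sup>2)"
          by (intro tendsto_intros)
        from lim_imp_Liminf[OF _ this]
        show "ennreal ((cmod (f n x - g x))\<^sup>2) = liminf (\<lambda>k. ennreal ((cmod (f n x - f (r k) x))\<^sup>2))" by simp
      qed
    qed
    also have "\<dots> \<le> liminf (\<lambda>k. \<integral>\<^sup>+x. ennreal ((cmod (f n x - f (r k) x))\<^sup>2) \<partial>N)"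
      by (intro nn_integral_liminf) measurable
    also have "\<dots> \<le> liminf (\<lambda>k. ennreal e)"
    proof (rule Liminf_mono, rule eventually_sequentiallyI)
      fix k assume "n \<le> k"
      then have "n \<le> r k" using rk order_trans by blast
      then show "(\<integral>\<^sup>+x. ennreal ((cmod (f n x - f (r k) x))\<^sup>2) \<partial>N) \<le> ennreal e"
        unfolding nn by (intro ennreal_leI e)
    qed
    also have "\<dots> = ennreal e" by (simp add: Liminf_const)
    finally show ?thesis .
  qed
  have ex: "\<exists>K. \<forall>n\<ge>K. \<forall>m\<ge>n. (LINT x|N. (cmod (f n x - f m x))\<^sup>2) \<le> e" if "0 < e" for e
    using Cauchy[OF that] by (meson less_imp_le order_trans)
  have intg: "integrable N (\<lambda>x. (cmod (f n x - g x))\<^sup>2)"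
    if "\<And>m. n \<le> m \<Longrightarrow> (LINT x|N. (cmod (f n x - f m x))\<^sup>2) \<le> e" for n e
  proof (rule integrableI_bounded)
    show "(\<integral>\<^sup>+x. ennreal (norm ((cmod (f n x - g x))\<^sup>2)) \<partial>N) < \<infinity>"
      using fatou[OF that] by (simp add: le_less_trans)
  qed measurable
  obtain K1 where K1: "\<And>n m. K1 \<le> n \<Longrightarrow> n \<le> m \<Longrightarrow> (LINT x|N. (cmod (f n x - f m x))\<^sup>2) \<le> 1"
    using ex[of 1] by auto
  have "(\<lambda>x. f K1 x - g x) \<in> L2 N"
    using intg[OF K1[OF order_refl]] by (simp add: L2_def)
  then have "(\<lambda>x. f K1 x - (f K1 x - g x)) \<in> L2 N" by (rule L2_diff[OF f])
  then have g: "g \<in> L2 N" by simp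
  have "(\<lambda>n. LINT x|N. (cmod (f n x - g x))\<^sup>2) \<longlonglongrightarrow> 0"
  proof (rule LIMSEQ_I)
    fix e :: real assume e: "0 < e"
    then obtain K2 where K2: "\<And>n m. K2 \<le> n \<Longrightarrow> n \<le> m \<Longrightarrow> (LINT x|N. (cmod (f n x - f m x))\<^sup>2) \<le> e / 2"
      using ex[of "e / 2"] by auto
    have "norm ((LINT x|N. (cmod (f n x - g x))\<^sup>2) - 0) < e" if n: "K2 \<le> n" for n
    proof -
      have "ennreal (LINT x|N. (cmod (f n x - g x))\<^sup>2) = (\<integral>\<^sup>+x. ennreal ((cmod (f n x - g x))\<^sup>2) \<partial>N)"
        by (intro nn_integral_eq_integral[symmetric] intg[OF K2[OF n]]) auto
      also have "\<dots> \<le> ennreal (e / 2)" by (rule fatou[OF K2[OF n]])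
      finally have "(LINT x|N. (cmod (f n x - g x))\<^sup>2) \<le> e / 2" using e by simp
      moreover have "0 \<le> (LINT x|N. (cmod (f n x - g x))\<^sup>2)" by (intro Bochner_Integration.integral_nonneg) auto
      ultimately show ?thesis using e by simp
    qed
    then show "\<exists>no. \<forall>n\<ge>no. norm ((LINT x|N. (cmod (f n x - g x))\<^sup>2) - 0) < e" by blast
  qed
  with g show ?thesis by blast
qed

text \<open>
  Types cannot depend on the measure \<open>M\<close>.  The space \<open>L\<^sup>2(M)\<close> is therefore realised as a closed
  subspace of a Hilbert space type that depends only on the type of the points, namely \<open>L\<^sup>2\<close> of the
  direct sum of all measures on that type.
\<close>

definition direct_sum :: "('a measure \<times> 'a) measure" where
  "direct_sum = measure_of UNIV {S. \<forall>m. Pair m -` S \<inter> space m \<in> sets m}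
     (\<lambda>S. \<integral>\<^sup>+m. emeasure m (Pair m -` S \<inter> space m) \<partial>count_space UNIV)"

lemma sigma_algebra_direct_sum:
  "sigma_algebra UNIV {S :: ('a measure \<times> 'a) set. \<forall>m. Pair m -` S \<inter> space m \<in> sets m}"
proof (rule sigma_algebra_iff2[THEN iffD2], intro conjI ballI allI impI)
  fix S :: "('a measure \<times> 'a) set" assume "S \<in> {S. \<forall>m. Pair m -` S \<inter> space m \<in> sets m}"
  then have "space m - (Pair m -` S \<inter> space m) \<in> sets m" for m by blast
  moreover have "space m - (Pair m -` S \<inter> space m) = Pair m -` (UNIV - S) \<inter> space m" for m :: "'a measure"
    by auto
  ultimately show "UNIV - S \<in> {S. \<forall>m. Pair m -` S \<inter> space m \<in> sets m}" by simp
next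
  fix A :: "nat \<Rightarrow> ('a measure \<times> 'a) set" assume A: "range A \<subseteq> {S. \<forall>m. Pair m -` S \<inter> space m \<in> sets m}"
  have "Pair m -` (\<Union>i. A i) \<inter> space m = (\<Union>i. Pair m -` A i \<inter> space m)" for m :: "'a measure" by auto
  moreover have "(\<Union>i. Pair m -` A i \<inter> space m) \<in> sets m" for m
    by (rule sets.countable_UN) (use A in auto)
  ultimately show "(\<Union>i. A i) \<in> {S. \<forall>m. Pair m -` S \<inter> space m \<in> sets m}" by simp
qed auto

lemma space_direct_sum [simp]: "space direct_sum = UNIV"
  by (simp add: direct_sum_def space_measure_of_conv)

lemma sets_direct_sum: "S \<in> sets direct_sum \<longleftrightarrow> (\<forall>m. Pair m -` S \<inter> space m \<in> sets m)"
  unfolding direct_sum_def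
  by (subst sigma_algebra.sets_measure_of_eq[OF sigma_algebra_direct_sum]) simp

lemma emeasure_direct_sum:
  fixes S :: "('a measure \<times> 'a) set"
  assumes "S \<in> sets direct_sum"
  shows "emeasure direct_sum S = (\<integral>\<^sup>+m. emeasure m (Pair m -` S \<inter> space m) \<partial>count_space UNIV)"
proof (rule emeasure_measure_of[OF direct_sum_def])
  show "countably_additive (sets (direct_sum :: ('a measure \<times> 'a) measure))
      (\<lambda>S. \<integral>\<^sup>+m. emeasure m (Pair m -` S \<inter> space m) \<partial>count_space UNIV)"
  proof (rule countably_additiveI)
    fix A :: "nat \<Rightarrow> ('a measure \<times> 'a) set"
    assume A: "range A \<subseteq> sets direct_sum" "disjoint_family A"
    have "(\<Sum>i. \<integral>\<^sup>+m. emeasure m (Pair m -` A i \<inter> space m) \<partial>count_space UNIV)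
        = (\<integral>\<^sup>+m. (\<Sum>i. emeasure m (Pair m -` A i \<inter> space m)) \<partial>count_space UNIV)"
      by (intro nn_integral_suminf[symmetric]) simp
    also have "\<dots> = (\<integral>\<^sup>+m. emeasure m (Pair m -` (\<Union>i. A i) \<inter> space m) \<partial>count_space UNIV)"
    proof (rule nn_integral_cong)
      fix m :: "'a measure"
      have "(\<Sum>i. emeasure m (Pair m -` A i \<inter> space m)) = emeasure m (\<Union>i. Pair m -` A i \<inter> space m)"
        using A by (intro suminf_emeasure) (auto simp: sets_direct_sum disjoint_family_on_def)
      also have "(\<Union>i. Pair m -` A i \<inter> space m) = Pair m -` (\<Union>i. A i) \<inter> space m" by auto
      finally show "(\<Sum>i. emeasure m (Pair m -` A i \<inter> space m)) = emeasure m (Pair m -` (\<Union>i. A i) \<inter> space m)" .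
    qed
    finally show "(\<Sum>i. \<integral>\<^sup>+m. emeasure m (Pair m -` A i \<inter> space m) \<partial>count_space UNIV)
        = (\<integral>\<^sup>+m. emeasure m (Pair m -` (\<Union>i. A i) \<inter> space m) \<partial>count_space UNIV)" .
  qed
qed (use assms in \<open>auto simp: positive_def\<close>)

lemma measurable_Pair_direct_sum [measurable]: "Pair M \<in> measurable M direct_sum"
  by (rule measurableI) (auto simp: sets_direct_sum)

definition extend0 :: "'a measure \<Rightarrow> ('a \<Rightarrow> 'b::zero) \<Rightarrow> 'a measure \<times> 'a \<Rightarrow> 'b" where
  "extend0 M f = (\<lambda>(m, x). if m = M then f x else 0)"

lemma extend0_Pair [simp]: "extend0 M f (M, x) = f x"
  by (simp add: extend0_def)

lemma extend0_measurable:
  fixes f :: "'a \<Rightarrow> 'b::{zero,topological_space}"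
  assumes f: "f \<in> borel_measurable M"
  shows "extend0 M f \<in> borel_measurable direct_sum"
proof (rule measurableI)
  fix B :: "'b set" assume B: "B \<in> sets borel"
  have "Pair m -` (extend0 M f -` B) \<inter> space m \<in> sets m" for m
  proof (cases "m = M")
    case True
    then have "Pair m -` (extend0 M f -` B) \<inter> space m = f -` B \<inter> space M"
      by (auto simp: extend0_def)
    then show ?thesis using measurable_sets[OF f B] True by simp
  next
    case False
    then have "Pair m -` (extend0 M f -` B) \<inter> space m = (if 0 \<in> B then space m else {})"
      by (auto simp: extend0_def)
    then show ?thesis by simp
  qed
  then show "extend0 M f -` B \<inter> space direct_sum \<in> sets direct_sum" by (simp add: sets_direct_sum)
qed simp

definition fibre :: "'a measure \<Rightarrow> ('a measure \<times> 'a) set" where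
  "fibre M = {M} \<times> UNIV"

lemma fibre_sets [measurable]: "fibre M \<in> sets direct_sum"
proof -
  have "Pair m -` fibre M \<inter> space m = (if m = M then space m else {})" for m
    by (auto simp: fibre_def)
  then show ?thesis by (simp add: sets_direct_sum)
qed

text \<open>Restricted to one fibre, the direct sum is the image of that single measure.
  Almost-everywhere statements, integrability and integrals over M all pass through this
  identity.\<close>

lemma density_fibre: "density direct_sum (indicator (fibre M)) = distr M direct_sum (Pair M)"
proof (rule measure_eqI)
  fix S assume "S \<in> sets (density direct_sum (indicator (fibre M)))"
  then have S: "S \<in> sets direct_sum" by simp
  have fS: "fibre M \<inter> S \<in> sets direct_sum" using S by simp
  have "emeasure (density direct_sum (indicator (fibre M))) S
      = (\<integral>\<^sup>+p. indicator (fibre M) p * indicator S p \<partial>direct_sum)"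
    using S by (intro emeasure_density) auto
  also have "\<dots> = (\<integral>\<^sup>+p. indicator (fibre M \<inter> S) p \<partial>direct_sum)"
    by (simp only: indicator_inter_arith)
  also have "\<dots> = emeasure direct_sum (fibre M \<inter> S)"
    using fS by (rule nn_integral_indicator)
  also have "\<dots> = (\<integral>\<^sup>+m. emeasure m (Pair m -` (fibre M \<inter> S) \<inter> space m) \<partial>count_space UNIV)"
    by (rule emeasure_direct_sum[OF fS])
  \<comment> \<open>The section of the fibre over any m \<noteq> M is empty, so the sum over all
    measures has one term.\<close>
  also have "\<dots> = (\<integral>\<^sup>+m. emeasure M (Pair M -` S \<inter> space M) * indicator {M} m \<partial>count_space UNIV)"
    by (intro nn_integral_cong) (auto simp: fibre_def vimage_def indicator_def)
  also have "\<dots> = emeasure M (Pair M -` S \<inter> space M)"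
    by (simp add: nn_integral_cmult_indicator)
  also have "\<dots> = emeasure (distr M direct_sum (Pair M)) S"
    using S by (simp add: emeasure_distr)
  finally show "emeasure (density direct_sum (indicator (fibre M))) S = emeasure (distr M direct_sum (Pair M)) S" .
qed simp

lemma density_fibre_real:
  "density direct_sum (\<lambda>p. ennreal (indicator (fibre M) p)) = distr M direct_sum (Pair M)"
proof -
  have "(\<lambda>p. ennreal (indicator (fibre M) p)) = indicator (fibre M)"
    by (auto simp: fun_eq_iff indicator_def)
  then show ?thesis by (simp add: density_fibre)
qed

lemma AE_fibre:
  assumes "{p. P p} \<in> sets direct_sum"
  shows "(AE p in direct_sum. p \<in> fibre M \<longrightarrow> P p) \<longleftrightarrow> (AE x in M. P (M, x))"
proof -
  have "(AE x in M. P (M, x)) \<longleftrightarrow> (AE p in distr M direct_sum (Pair M). P p)"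
    using assms by (subst AE_distr_iff) auto
  also have "\<dots> \<longleftrightarrow> (AE p in direct_sum. p \<in> fibre M \<longrightarrow> P p)"
    unfolding density_fibre[symmetric]
    by (subst AE_density) (auto simp: indicator_def zero_less_iff_neq_zero)
  finally show ?thesis by simp
qed

lemma integrable_fibre:
  fixes F :: "_ \<Rightarrow> 'c::{banach, second_countable_topology}"
  assumes [measurable]: "F \<in> borel_measurable direct_sum"
  shows "integrable M (\<lambda>x. F (M, x)) \<longleftrightarrow> integrable direct_sum (\<lambda>p. indicator (fibre M) p *\<^sub>R F p)"
proof -
  have "integrable M (\<lambda>x. F (M, x)) \<longleftrightarrow> integrable (distr M direct_sum (Pair M)) F"
    by (subst integrable_distr_eq) auto
  also have "\<dots> \<longleftrightarrow> integrable direct_sum (\<lambda>p. indicator (fibre M) p *\<^sub>R F p)"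
    unfolding density_fibre_real[symmetric] by (subst integrable_density) auto
  finally show ?thesis .
qed

lemma integral_fibre:
  fixes F :: "_ \<Rightarrow> 'c::{banach, second_countable_topology}"
  assumes [measurable]: "F \<in> borel_measurable direct_sum"
  shows "(LINT x|M. F (M, x)) = (LINT p|direct_sum. indicator (fibre M) p *\<^sub>R F p)"
proof -
  have "(LINT x|M. F (M, x)) = (LINT p|distr M direct_sum (Pair M). F p)"
    by (subst integral_distr) auto
  also have "\<dots> = (LINT p|direct_sum. indicator (fibre M) p *\<^sub>R F p)"
    unfolding density_fibre_real[symmetric] by (subst integral_density) auto
  finally show ?thesis .
qed

lemma L2_fibre:
  assumes F: "F \<in> L2 direct_sum"
  shows "(\<lambda>x. F (M, x)) \<in> L2 M"
proof -
  have [measurable]: "F \<in> borel_measurable direct_sum" using F by (simp add: L2_def)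
  have "integrable direct_sum (\<lambda>p. indicator (fibre M) p *\<^sub>R (cmod (F p))\<^sup>2)"
    using F by (intro integrable_mult_indicator) (auto simp: L2_def)
  then have "integrable M (\<lambda>x. (cmod (F (M, x)))\<^sup>2)"
    using integrable_fibre[of "\<lambda>p. (cmod (F p))\<^sup>2" M] by simp
  then show ?thesis by (simp add: L2_def)
qed

lemma L2_extend0:
  assumes f: "f \<in> L2 M"
  shows "extend0 M f \<in> L2 direct_sum"
proof -
  have [measurable]: "extend0 M f \<in> borel_measurable direct_sum"
    using f by (intro extend0_measurable) (simp add: L2_def)
  have "integrable M (\<lambda>x. (cmod (extend0 M f (M, x)))\<^sup>2)" using f by (simp add: L2_def)
  then have "integrable direct_sum (\<lambda>p. indicator (fibre M) p *\<^sub>R (cmod (extend0 M f p))\<^sup>2)"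
    by (subst (asm) integrable_fibre[of "\<lambda>p. (cmod (extend0 M f p))\<^sup>2" M]) auto
  also have "(\<lambda>p. indicator (fibre M) p *\<^sub>R (cmod (extend0 M f p))\<^sup>2) = (\<lambda>p. (cmod (extend0 M f p))\<^sup>2)"
    by (auto simp: fun_eq_iff extend0_def fibre_def indicator_def)
  finally show ?thesis by (simp add: L2_def)
qed

lemma AE_extend0:
  assumes "f \<in> borel_measurable M" "g \<in> borel_measurable M" "AE x in M. f x = (g x :: complex)"
  shows "AE p in direct_sum. extend0 M f p = extend0 M g p"
proof -
  have [measurable]: "extend0 M f \<in> borel_measurable direct_sum" "extend0 M g \<in> borel_measurable direct_sum"
    using assms by (auto intro: extend0_measurable)
  have "{p \<in> space direct_sum. extend0 M f p = extend0 M g p} \<in> sets direct_sum" by measurable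
  then have "AE p in direct_sum. p \<in> fibre M \<longrightarrow> extend0 M f p = extend0 M g p"
    using assms(3) by (subst AE_fibre) auto
  then show ?thesis
  proof eventually_elim
    fix p assume "p \<in> fibre M \<longrightarrow> extend0 M f p = extend0 M g p"
    then show "extend0 M f p = extend0 M g p"
      by (cases "p \<in> fibre M") (auto simp: extend0_def fibre_def split: prod.splits)
  qed
qed

lemma AE_section:
  assumes "AE p in direct_sum. F p = G p"
  shows "AE x in M. F (M, x) = G (M, x)"
proof -
  have "AE p in density direct_sum (indicator (fibre M)). F p = G p"
    using assms by (subst AE_density) auto
  then show ?thesis unfolding density_fibre by (rule AE_distrD[rotated]) simp
qed

section \<open>The Hilbert space type of the direct sum\<close>

text \<open>Reflexive exactly on the square-integrable functions, which makes the quotient partial: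
  no other function represents a vector.\<close>

definition hil_rel :: "('a measure \<times> 'a \<Rightarrow> complex) \<Rightarrow> ('a measure \<times> 'a \<Rightarrow> complex) \<Rightarrow> bool" where
  "hil_rel f g \<longleftrightarrow> f \<in> L2 direct_sum \<and> g \<in> L2 direct_sum \<and> (AE p in direct_sum. f p = g p)"

quotient_type 'a hil = "'a measure \<times> 'a \<Rightarrow> complex" / partial: hil_rel
proof (rule part_equivpI)
  show "\<exists>f. hil_rel f f" by (intro exI[of _ "\<lambda>_. 0"]) (simp add: hil_rel_def)
  show "symp hil_rel" by (intro sympI) (auto simp: hil_rel_def)
  show "transp hil_rel"
  proof (rule transpI)
    fix f g h assume "hil_rel f g" "hil_rel g h"
    then show "hil_rel f h" unfolding hil_rel_def by (auto elim: AE_mp)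
  qed
qed

lemma hil_relI: "f \<in> L2 direct_sum \<Longrightarrow> f = g \<Longrightarrow> hil_rel f g"
  by (simp add: hil_rel_def)

lemma hil_rel_L2: "hil_rel f f \<Longrightarrow> f \<in> L2 direct_sum"
  by (simp add: hil_rel_def)

lemma AE_map2:
  "AE x in N. f x = f' x \<Longrightarrow> AE x in N. g x = g' x \<Longrightarrow> AE x in N. h (f x) (g x) = h (f' x) (g' x)"
  by (erule (1) eventually_elim2) simp

instantiation hil :: (type) real_vector
begin

lift_definition zero_hil :: "'a hil" is "\<lambda>_. 0"
  by (simp add: hil_rel_def)

lift_definition plus_hil :: "'a hil \<Rightarrow> 'a hil \<Rightarrow> 'a hil" is "\<lambda>f g p. f p + g p"
  unfolding hil_rel_def by (elim conjE, intro conjI L2_add AE_map2[where h = "(+)"])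

lift_definition minus_hil :: "'a hil \<Rightarrow> 'a hil \<Rightarrow> 'a hil" is "\<lambda>f g p. f p - g p"
  unfolding hil_rel_def by (elim conjE, intro conjI L2_diff AE_map2[where h = "(-)"])

lift_definition uminus_hil :: "'a hil \<Rightarrow> 'a hil" is "\<lambda>f p. - f p"
  unfolding hil_rel_def by (auto intro!: L2_uminus)

lift_definition scaleR_hil :: "real \<Rightarrow> 'a hil \<Rightarrow> 'a hil" is "\<lambda>c f p. complex_of_real c * f p"
  unfolding hil_rel_def by (auto intro!: L2_scale)

instance
  by standard
    (transfer, rule hil_relI,
     (intro L2_add L2_scale L2_diff L2_uminus L2_zero hil_rel_L2; assumption)?,
     simp add: fun_eq_iff algebra_simps)+

end

text \<open>Scalars of the type are real, and its inner product is the real part of the complex one.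
  The complex structure is kept as this one operator, through which imaginary parts are recovered
  (\<open>Im_L2_inner\<close>).\<close>

lift_definition imul :: "'a hil \<Rightarrow> 'a hil" is "\<lambda>f p. \<i> * f p"
  unfolding hil_rel_def by (auto intro!: L2_scale)

lemma imul_imul: "imul (imul u) = - u"
  by transfer (rule hil_relI, intro L2_scale hil_rel_L2, assumption, simp add: fun_eq_iff flip: mult.assoc)

instantiation hil :: (type) real_inner
begin

lift_definition inner_hil :: "'a hil \<Rightarrow> 'a hil \<Rightarrow> real" is "\<lambda>f g. LINT p|direct_sum. f p \<bullet> g p"
  unfolding hil_rel_def
  by (elim conjE, intro integral_cong_AE borel_measurable_inner L2_borel AE_map2[where h = "(\<bullet>)"])

definition norm_hil :: "'a hil \<Rightarrow> real" where "norm_hil u = sqrt (u \<bullet> u)"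
definition dist_hil :: "'a hil \<Rightarrow> 'a hil \<Rightarrow> real" where "dist_hil u v = norm (u - v)"
definition sgn_hil :: "'a hil \<Rightarrow> 'a hil" where "sgn_hil u = u /\<^sub>R norm u"
definition uniformity_hil :: "('a hil \<times> 'a hil) filter" where
  "uniformity_hil = (INF e\<in>{0<..}. principal {(u, v). dist u v < e})"
definition open_hil :: "'a hil set \<Rightarrow> bool" where
  "open_hil U \<longleftrightarrow> (\<forall>x\<in>U. \<forall>\<^sub>F (x', y) in uniformity. x' = x \<longrightarrow> y \<in> U)"

instance
proof
  fix u v w :: "'a hil" and c :: real
  show "dist u v = norm (u - v)" by (rule dist_hil_def)
  show "sgn u = u /\<^sub>R norm u" by (rule sgn_hil_def)
  show "(uniformity :: ('a hil \<times> 'a hil) filter) = (INF e\<in>{0<..}. principal {(u, v). dist u v < e})"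
    by (rule uniformity_hil_def)
  show "open U \<longleftrightarrow> (\<forall>x\<in>U. \<forall>\<^sub>F (x', y) in uniformity. x' = x \<longrightarrow> y \<in> U)" for U :: "'a hil set"
    by (rule open_hil_def)
  show "u \<bullet> v = v \<bullet> u" by transfer (simp add: inner_commute)
  show "(u + v) \<bullet> w = u \<bullet> w + v \<bullet> w"
    by transfer (simp add: hil_rel_def inner_add_left L2_integrable_inner)
  show "(c *\<^sub>R u) \<bullet> v = c * (u \<bullet> v)"
    by transfer (simp add: hil_rel_def flip: scaleR_conv_of_real)
  show "0 \<le> u \<bullet> u" by transfer (auto intro!: Bochner_Integration.integral_nonneg)
  show "u \<bullet> u = 0 \<longleftrightarrow> u = 0"
  proof transfer
    fix f :: "'a measure \<times> 'a \<Rightarrow> complex" assume "hil_rel f f"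
    then have f: "f \<in> L2 direct_sum" by (simp add: hil_rel_def)
    have "(LINT p|direct_sum. f p \<bullet> f p) = 0 \<longleftrightarrow> (AE p in direct_sum. f p \<bullet> f p = 0)"
      by (intro integral_nonneg_eq_0_iff_AE L2_integrable_inner f) auto
    then show "(LINT p|direct_sum. f p \<bullet> f p) = 0 \<longleftrightarrow> hil_rel f (\<lambda>_. 0)"
      using f by (simp add: hil_rel_def)
  qed
  show "norm u = sqrt (u \<bullet> u)" by (rule norm_hil_def)
qed

end

lemma rep_hil_L2: "rep_hil u \<in> L2 direct_sum"
  using Quotient3_rep_reflp[OF Quotient3_hil] by (auto simp: hil_rel_def)

lemma abs_rep_hil: "abs_hil (rep_hil u) = u"
  by (rule Quotient3_abs_rep[OF Quotient3_hil])

lemma abs_hil_eq_iff: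
  "f \<in> L2 direct_sum \<Longrightarrow> g \<in> L2 direct_sum \<Longrightarrow> abs_hil f = abs_hil g \<longleftrightarrow> (AE p in direct_sum. f p = g p)"
  using Quotient3_rel[OF Quotient3_hil, of f g] by (auto simp: hil_rel_def)

lemma norm_abs_hil_diff:
  assumes "f \<in> L2 direct_sum" "g \<in> L2 direct_sum"
  shows "(norm (abs_hil f - abs_hil g))\<^sup>2 = (LINT p|direct_sum. (cmod (f p - g p))\<^sup>2)"
proof -
  have "abs_hil f - abs_hil g = abs_hil (\<lambda>p. f p - g p)"
    using assms by (intro minus_hil.abs_eq) (auto simp: hil_rel_def)
  moreover have "abs_hil (\<lambda>p. f p - g p) \<bullet> abs_hil (\<lambda>p. f p - g p)
      = (LINT p|direct_sum. (f p - g p) \<bullet> (f p - g p))"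
    using L2_diff[OF assms] by (intro inner_hil.abs_eq) (auto simp: hil_rel_def)
  ultimately show ?thesis by (simp add: power2_norm_eq_inner)
qed

instance hil :: (type) complete_space
proof
  fix X :: "nat \<Rightarrow> 'a hil" assume X: "Cauchy X"
  define f where "f n = rep_hil (X n)" for n
  have f: "f n \<in> L2 direct_sum" and Xf: "X n = abs_hil (f n)" for n
    by (simp_all add: f_def rep_hil_L2 abs_rep_hil)
  have "\<exists>g\<in>L2 direct_sum. (\<lambda>n. LINT p|direct_sum. (cmod (f n p - g p))\<^sup>2) \<longlonglongrightarrow> 0"
  proof (rule Riesz_Fischer[OF f])
    fix e :: real assume "0 < e"
    then obtain K where K: "\<And>m n. K \<le> m \<Longrightarrow> K \<le> n \<Longrightarrow> norm (X m - X n) < sqrt e"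
      using CauchyD[OF X, of "sqrt e"] by auto
    have "(LINT p|direct_sum. (cmod (f m p - f n p))\<^sup>2) < e" if "K \<le> m" "K \<le> n" for m n
    proof -
      have "(norm (X m - X n))\<^sup>2 < (sqrt e)\<^sup>2" using K[OF that] by (intro power_strict_mono) auto
      then show ?thesis using \<open>0 < e\<close> by (simp add: Xf norm_abs_hil_diff f)
    qed
    then show "\<exists>K. \<forall>m\<ge>K. \<forall>n\<ge>K. (LINT p|direct_sum. (cmod (f m p - f n p))\<^sup>2) < e" by blast
  qed
  then obtain g where g: "g \<in> L2 direct_sum" "(\<lambda>n. LINT p|direct_sum. (cmod (f n p - g p))\<^sup>2) \<longlonglongrightarrow> 0"
    by blast
  have "(\<lambda>n. (norm (X n - abs_hil g))\<^sup>2) \<longlonglongrightarrow> 0"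
    using g(2) by (simp add: Xf norm_abs_hil_diff f g(1))
  from tendsto_real_sqrt[OF this] have "(\<lambda>n. norm (X n - abs_hil g)) \<longlonglongrightarrow> 0" by simp
  then have "X \<longlonglongrightarrow> abs_hil g" using LIM_zero_iff tendsto_norm_zero_iff by blast
  then show "convergent X" by (rule convergentI)
qed

instance hil :: (type) banach ..

section \<open>The space over a single measure\<close>

definition emb :: "'a measure \<Rightarrow> ('a \<Rightarrow> complex) \<Rightarrow> 'a hil" where
  "emb M f = abs_hil (extend0 M f)"

text \<open>A chosen representative is restricted to the fibre, so \<open>sec\<close> is linear only
  up to null sets; following it by \<open>emb\<close> removes the ambiguity.\<close>

definition sec :: "'a measure \<Rightarrow> 'a hil \<Rightarrow> 'a \<Rightarrow> complex" where
  "sec M u = (\<lambda>x. rep_hil u (M, x))"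

lemma AE_rep_abs_hil: "F \<in> L2 direct_sum \<Longrightarrow> AE p in direct_sum. rep_hil (abs_hil F) p = F p"
  using abs_hil_eq_iff[OF rep_hil_L2, of F "abs_hil F"] by (simp add: abs_rep_hil)

lemma sec_L2 [simp]: "sec M u \<in> L2 M"
  unfolding sec_def by (rule L2_fibre[OF rep_hil_L2])

lemma AE_sec_abs_hil: "F \<in> L2 direct_sum \<Longrightarrow> AE x in M. sec M (abs_hil F) x = F (M, x)"
  using AE_section[OF AE_rep_abs_hil, of F M] by (simp add: sec_def)

lemma AE_sec_emb: "f \<in> L2 M \<Longrightarrow> AE x in M. sec M (emb M f) x = f x"
  using AE_sec_abs_hil[OF L2_extend0, of f M M] by (simp add: emb_def)

lemma emb_cong: "f \<in> L2 M \<Longrightarrow> g \<in> L2 M \<Longrightarrow> AE x in M. f x = g x \<Longrightarrow> emb M f = emb M g"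
  unfolding emb_def by (subst abs_hil_eq_iff) (auto intro: L2_extend0 AE_extend0 L2_borel)

lemma emb_eq_iff: "f \<in> L2 M \<Longrightarrow> g \<in> L2 M \<Longrightarrow> emb M f = emb M g \<longleftrightarrow> (AE x in M. f x = g x)"
proof
  assume f: "f \<in> L2 M" "g \<in> L2 M" and "emb M f = emb M g"
  then have "AE p in direct_sum. extend0 M f p = extend0 M g p"
    unfolding emb_def by (subst (asm) abs_hil_eq_iff) (auto intro: L2_extend0)
  from AE_section[OF this, of M] show "AE x in M. f x = g x" by simp
qed (rule emb_cong)

lemma emb_sec_emb: "f \<in> L2 M \<Longrightarrow> emb M (sec M (emb M f)) = emb M f"
  by (intro emb_cong AE_sec_emb sec_L2)

lemma hil_rel_refl: "F \<in> L2 direct_sum \<Longrightarrow> hil_rel F F"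
  by (simp add: hil_rel_def)

lemma emb_0 [simp]: "emb M (\<lambda>_. 0) = 0"
proof -
  have "extend0 M (\<lambda>_. 0 :: complex) = (\<lambda>_. 0)" by (auto simp: extend0_def)
  then show ?thesis by (simp add: emb_def zero_hil.abs_eq)
qed

lemma emb_add:
  assumes "f \<in> L2 M" "g \<in> L2 M"
  shows "emb M (\<lambda>x. f x + g x) = emb M f + emb M g"
proof -
  have "extend0 M (\<lambda>x. f x + g x) = (\<lambda>p. extend0 M f p + extend0 M g p)" by (auto simp: extend0_def)
  then show ?thesis
    unfolding emb_def using plus_hil.abs_eq[OF hil_rel_refl hil_rel_refl] L2_extend0[OF assms(1)] L2_extend0[OF assms(2)]
    by metis
qed

lemma emb_scaleR:
  assumes "f \<in> L2 M"
  shows "emb M (\<lambda>x. complex_of_real c * f x) = c *\<^sub>R emb M f"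
proof -
  have "extend0 M (\<lambda>x. complex_of_real c * f x) = (\<lambda>p. complex_of_real c * extend0 M f p)" by (auto simp: extend0_def)
  then show ?thesis
    unfolding emb_def using scaleR_hil.abs_eq[OF hil_rel_refl] L2_extend0[OF assms] by metis
qed

lemma emb_imul:
  assumes "f \<in> L2 M"
  shows "emb M (\<lambda>x. \<i> * f x) = imul (emb M f)"
proof -
  have "extend0 M (\<lambda>x. \<i> * f x) = (\<lambda>p. \<i> * extend0 M f p)" by (auto simp: extend0_def)
  then show ?thesis
    unfolding emb_def using imul.abs_eq[OF hil_rel_refl] L2_extend0[OF assms] by metis
qed

lemma emb_uminus: "f \<in> L2 M \<Longrightarrow> emb M (\<lambda>x. - f x) = - emb M f"
  using emb_scaleR[of f M "-1"] by simp

lemma emb_diff: "f \<in> L2 M \<Longrightarrow> g \<in> L2 M \<Longrightarrow> emb M (\<lambda>x. f x - g x) = emb M f - emb M g"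
  using emb_add[OF _ L2_uminus, of f M g] by (simp add: emb_uminus)

text \<open>\<open>sec\<close> is adjoint to \<open>emb\<close>: a product with an extension by zero
  sees only the fibre.\<close>

lemma inner_emb:
  assumes f: "f \<in> L2 M"
  shows "u \<bullet> emb M f = (LINT x|M. sec M u x \<bullet> f x)"
proof -
  have F: "extend0 M f \<in> L2 direct_sum" by (rule L2_extend0[OF f])
  have [measurable]: "rep_hil u \<in> borel_measurable direct_sum" "extend0 M f \<in> borel_measurable direct_sum"
    using rep_hil_L2[of u] F by (simp_all add: L2_def)
  have "u \<bullet> emb M f = (LINT p|direct_sum. rep_hil u p \<bullet> extend0 M f p)"
    unfolding emb_def
    using inner_hil.abs_eq[OF hil_rel_refl[OF rep_hil_L2] hil_rel_refl[OF F], of u] by (simp add: abs_rep_hil)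
  also have "\<dots> = (LINT p|direct_sum. indicator (fibre M) p *\<^sub>R (rep_hil u p \<bullet> extend0 M f p))"
    by (intro Bochner_Integration.integral_cong)
       (auto simp: extend0_def fibre_def indicator_def split: if_splits)
  also have "\<dots> = (LINT x|M. rep_hil u (M, x) \<bullet> extend0 M f (M, x))"
    by (rule integral_fibre[symmetric]) measurable
  finally show ?thesis by (simp add: sec_def)
qed

lemma inner_emb_emb:
  assumes "f \<in> L2 M" "g \<in> L2 M"
  shows "emb M f \<bullet> emb M g = Re (L2_inner M f g)"
proof -
  have [measurable]: "f \<in> borel_measurable M" "g \<in> borel_measurable M" "sec M (emb M f) \<in> borel_measurable M"
    using assms by (auto intro: L2_borel)
  have "(LINT x|M. sec M (emb M f) x \<bullet> g x) = (LINT x|M. f x \<bullet> g x)"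
    using AE_sec_emb[OF assms(1)] by (intro integral_cong_AE) auto
  then show ?thesis using assms by (simp add: inner_emb Re_L2_inner)
qed

lemma norm_emb: "f \<in> L2 M \<Longrightarrow> norm (emb M f) = L2_norm M f"
  by (simp add: norm_eq_sqrt_inner inner_emb_emb Re_L2_inner L2_norm_def power2_norm_eq_inner)

lemma emb_eq_0_iff: "f \<in> L2 M \<Longrightarrow> emb M f = 0 \<longleftrightarrow> (AE x in M. f x = 0)"
  using emb_eq_iff[of f M "\<lambda>_. 0"] by simp

lemma imul_inner: "imul u \<bullet> imul v = u \<bullet> v"
proof transfer
  fix f g :: "'a measure \<times> 'a \<Rightarrow> complex"
  have "(\<i> * f p) \<bullet> (\<i> * g p) = f p \<bullet> g p" for p by (simp add: inner_complex_def)
  then show "(LINT p|direct_sum. (\<i> * f p) \<bullet> (\<i> * g p)) = (LINT p|direct_sum. f p \<bullet> g p)" by simp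
qed

lemma norm_imul: "norm (imul u) = norm u"
  by (simp add: norm_eq_sqrt_inner imul_inner)

lemma bounded_linear_imul: "bounded_linear imul"
proof (rule bounded_linear_intro[where K = 1])
  show "imul (u + v) = imul u + imul v" for u v :: "'a hil"
    by transfer (rule hil_relI, intro L2_scale L2_add hil_rel_L2; (assumption | simp add: fun_eq_iff algebra_simps))
  show "imul (c *\<^sub>R u) = c *\<^sub>R imul u" for c and u :: "'a hil"
    by transfer (rule hil_relI, intro L2_scale hil_rel_L2; (assumption | simp add: fun_eq_iff algebra_simps))
qed (simp add: norm_imul)

lift_definition imul_op :: "'a hil \<Rightarrow>\<^sub>L 'a hil" is imul
  by (rule bounded_linear_imul)

lemma sec_linear_AE:
  "AE x in M. sec M (u + v) x = sec M u x + sec M v x"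
  "AE x in M. sec M (c *\<^sub>R u) x = complex_of_real c * sec M u x"
  "AE x in M. sec M (imul u) x = \<i> * sec M u x"
proof -
  have "u + v = abs_hil (\<lambda>p. rep_hil u p + rep_hil v p)"
    using plus_hil.abs_eq[OF hil_rel_refl[OF rep_hil_L2] hil_rel_refl[OF rep_hil_L2], of u v] by (simp add: abs_rep_hil)
  then show "AE x in M. sec M (u + v) x = sec M u x + sec M v x"
    using AE_sec_abs_hil[OF L2_add[OF rep_hil_L2 rep_hil_L2], of M u v] by (simp add: sec_def)
  have "c *\<^sub>R u = abs_hil (\<lambda>p. complex_of_real c * rep_hil u p)"
    using scaleR_hil.abs_eq[OF hil_rel_refl[OF rep_hil_L2], of c u] by (simp add: abs_rep_hil)
  then show "AE x in M. sec M (c *\<^sub>R u) x = complex_of_real c * sec M u x"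
    using AE_sec_abs_hil[OF L2_scale[OF rep_hil_L2], of M "complex_of_real c" u] by (simp add: sec_def)
  have "imul u = abs_hil (\<lambda>p. \<i> * rep_hil u p)"
    using imul.abs_eq[OF hil_rel_refl[OF rep_hil_L2], of u] by (simp add: abs_rep_hil)
  then show "AE x in M. sec M (imul u) x = \<i> * sec M u x"
    using AE_sec_abs_hil[OF L2_scale[OF rep_hil_L2], of M "\<i>" u] by (simp add: sec_def)
qed

lemma emb_sec_add: "emb M (sec M (u + v)) = emb M (sec M u) + emb M (sec M v)"
  using emb_cong[OF sec_L2 L2_add[OF sec_L2 sec_L2] sec_linear_AE(1)] by (simp add: emb_add)

lemma emb_sec_scaleR: "emb M (sec M (c *\<^sub>R u)) = c *\<^sub>R emb M (sec M u)"
  using emb_cong[OF sec_L2 L2_scale[OF sec_L2] sec_linear_AE(2)] by (simp add: emb_scaleR)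

lemma emb_sec_imul: "emb M (sec M (imul u)) = imul (emb M (sec M u))"
  using emb_cong[OF sec_L2 L2_scale[OF sec_L2] sec_linear_AE(3)] by (simp add: emb_imul)

lemma emb_sec_inner: "emb M (sec M u) \<bullet> v = emb M (sec M u) \<bullet> emb M (sec M v)"
proof -
  have "v \<bullet> emb M (sec M u) = (LINT x|M. sec M v x \<bullet> sec M u x)" by (rule inner_emb) simp
  also have "\<dots> = emb M (sec M v) \<bullet> emb M (sec M u)" by (simp add: inner_emb_emb Re_L2_inner)
  finally show ?thesis by (simp add: inner_commute)
qed

lemma norm_emb_sec_le: "norm (emb M (sec M u)) \<le> norm u"
proof (cases "emb M (sec M u) = 0")
  case False
  have "norm (emb M (sec M u)) * norm (emb M (sec M u)) = emb M (sec M u) \<bullet> u"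
    by (simp add: emb_sec_inner[of M u u] dot_square_norm power2_eq_square)
  also have "\<dots> \<le> norm (emb M (sec M u)) * norm u" by (rule norm_cauchy_schwarz)
  finally show ?thesis using False by simp
qed simp

text \<open>The orthogonal projection onto the copy of L2 over M.\<close>

lift_definition fproj :: "'a measure \<Rightarrow> 'a hil \<Rightarrow>\<^sub>L 'a hil" is "\<lambda>M u. emb M (sec M u)"
  by (rule bounded_linear_intro[where K = 1]) (auto simp: emb_sec_add emb_sec_scaleR norm_emb_sec_le)

lemma fproj_apply: "fproj M u = emb M (sec M u)"
  by (simp add: fproj.rep_eq)

lemma fproj_emb [simp]: "f \<in> L2 M \<Longrightarrow> fproj M (emb M f) = emb M f"
  by (simp add: fproj_apply emb_sec_emb)

lemma fproj_fproj [simp]: "fproj M (fproj M u) = fproj M u"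
  by (simp add: fproj_apply emb_sec_emb)

lemma fproj_sym: "fproj M u \<bullet> v = u \<bullet> fproj M v"
proof -
  have "fproj M u \<bullet> v = fproj M u \<bullet> fproj M v" unfolding fproj_apply by (rule emb_sec_inner)
  also have "\<dots> = fproj M v \<bullet> fproj M u" by (rule inner_commute)
  also have "\<dots> = fproj M v \<bullet> u" unfolding fproj_apply by (rule emb_sec_inner[symmetric])
  also have "\<dots> = u \<bullet> fproj M v" by (rule inner_commute)
  finally show ?thesis .
qed

lemma fproj_inner_emb: "f \<in> L2 M \<Longrightarrow> fproj M u \<bullet> emb M f = u \<bullet> emb M f"
  by (simp add: fproj_sym)

lemma fproj_imul: "fproj M (imul u) = imul (fproj M u)"
  by (simp add: fproj_apply emb_sec_imul)

lemma norm_fproj_le: "norm (fproj M u) \<le> norm u"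
  by (simp add: fproj_apply norm_emb_sec_le)

lemma norm_fproj_compl_le: "norm (u - fproj M u) \<le> norm u"
proof -
  have "(norm u)\<^sup>2 = (norm (fproj M u))\<^sup>2 + (norm (u - fproj M u))\<^sup>2"
    using fproj_sym[of M u u] fproj_sym[of M u "fproj M u"]
    by (simp add: power2_norm_eq_inner inner_diff_left inner_diff_right inner_commute)
  then have "(norm (u - fproj M u))\<^sup>2 \<le> (norm u)\<^sup>2" by simp
  then show ?thesis by (rule power2_le_imp_le) simp
qed

lemma emb_scaleC:
  assumes "f \<in> L2 M"
  shows "emb M (\<lambda>x. c * f x) = Re c *\<^sub>R emb M f + Im c *\<^sub>R imul (emb M f)"
proof -
  have "(\<lambda>x. c * f x) = (\<lambda>x. complex_of_real (Re c) * f x + complex_of_real (Im c) * (\<i> * f x))"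
    by (subst complex_eq[of c]) (simp add: algebra_simps)
  then show ?thesis using assms by (simp add: emb_add L2_scale emb_scaleR emb_imul)
qed

lemma L2_inner_scale_left: "L2_inner M (\<lambda>x. c * f x) g = c * L2_inner M f g"
  by (simp add: L2_inner_def mult.assoc)

lemma Im_L2_inner:
  assumes "f \<in> L2 M" "g \<in> L2 M"
  shows "Im (L2_inner M f g) = - (imul (emb M f) \<bullet> emb M g)"
proof -
  have "imul (emb M f) \<bullet> emb M g = Re (L2_inner M (\<lambda>x. \<i> * f x) g)"
    using assms by (simp add: emb_imul[symmetric] inner_emb_emb L2_scale)
  then show ?thesis by (simp add: L2_inner_scale_left)
qed

text \<open>A complex identity amounts to two real ones, the second with i times the first
  argument.\<close>

lemma L2_inner_eq_iff:
  assumes "f \<in> L2 M" "g \<in> L2 M" "f' \<in> L2 M" "g' \<in> L2 M"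
  shows "L2_inner M f g = L2_inner M f' g' \<longleftrightarrow>
    emb M f \<bullet> emb M g = emb M f' \<bullet> emb M g' \<and> imul (emb M f) \<bullet> emb M g = imul (emb M f') \<bullet> emb M g'"
  using assms by (simp add: complex_eq_iff Im_L2_inner inner_emb_emb)

section \<open>Transfer of operators\<close>

text \<open>The extension of A by 0 on the orthogonal complement of the copy of L2 over M: only the
  projection of u is constrained, and the value stays in the copy. Positive self-adjointness is
  preserved, now on a whole type, where the abstract theory applies.\<close>

definition lift_op :: "'a measure \<Rightarrow> 'a oper \<Rightarrow> ('a hil \<times> 'a hil) set" where
  "lift_op M A = {(u, v). \<exists>f g. (f, g) \<in> A \<and> fproj M u = emb M f \<and> v = emb M g}"

definition low_op :: "'a measure \<Rightarrow> ('a hil \<times> 'a hil) set \<Rightarrow> 'a oper" where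
  "low_op M B = {(f, g). f \<in> L2 M \<and> g \<in> L2 M \<and> (emb M f, emb M g) \<in> B}"

lemma lin_operator_L2: "lin_operator M A \<Longrightarrow> (f, g) \<in> A \<Longrightarrow> f \<in> L2 M \<and> g \<in> L2 M"
  unfolding lin_operator_def by (elim conjE) (drule (1) subsetD, simp)

lemma lin_operator_zero: "lin_operator M A \<Longrightarrow> ((\<lambda>_. 0), (\<lambda>_. 0)) \<in> A"
  unfolding lin_operator_def by (elim conjE)

lemma lin_operator_add:
  "lin_operator M A \<Longrightarrow> (f, g) \<in> A \<Longrightarrow> (f', g') \<in> A \<Longrightarrow> ((\<lambda>x. f x + f' x), (\<lambda>x. g x + g' x)) \<in> A"
  by (simp add: lin_operator_def)

lemma lin_operator_scale: "lin_operator M A \<Longrightarrow> (f, g) \<in> A \<Longrightarrow> ((\<lambda>x. c * f x), (\<lambda>x. c * g x)) \<in> A"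
  by (simp add: lin_operator_def)

lemma lin_operator_cong:
  assumes "lin_operator M A" "(f, g) \<in> A" "f' \<in> L2 M" "g' \<in> L2 M" "emb M f = emb M f'" "emb M g = emb M g'"
  shows "(f', g') \<in> A"
proof -
  have "f \<in> L2 M" "g \<in> L2 M" using lin_operator_L2[OF assms(1,2)] by auto
  then have "AE x in M. f x = f' x" "AE x in M. g x = g' x"
    using assms(3-6) by (simp_all add: emb_eq_iff)
  moreover have "\<forall>f g f' g'. (f, g) \<in> A \<longrightarrow> f' \<in> L2 M \<longrightarrow> g' \<in> L2 M \<longrightarrow>
      (AE x in M. f x = f' x) \<longrightarrow> (AE x in M. g x = g' x) \<longrightarrow> (f', g') \<in> A"
    using assms(1) unfolding lin_operator_def by (elim conjE)
  ultimately show ?thesis using assms(2-4) by simp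
qed

lemma lin_operator_unique:
  assumes "lin_operator M A" "(f, g) \<in> A" "(f', g') \<in> A" "emb M f = emb M f'"
  shows "emb M g = emb M g'"
proof -
  have L: "f \<in> L2 M" "g \<in> L2 M" "g' \<in> L2 M"
    using lin_operator_L2[OF assms(1,2)] lin_operator_L2[OF assms(1,3)] by auto
  then have "(f, g') \<in> A" using lin_operator_cong[OF assms(1,3)] assms(4) by simp
  moreover have "\<forall>f g g'. (f, g) \<in> A \<longrightarrow> (f, g') \<in> A \<longrightarrow> (AE x in M. g x = g' x)"
    using assms(1) unfolding lin_operator_def by (elim conjE)
  ultimately have "AE x in M. g x = g' x" using assms(2) by simp
  then show ?thesis using L by (intro emb_cong)
qed

lemma low_lift_op:
  assumes "lin_operator M A"
  shows "low_op M (lift_op M A) = A"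
proof (intro equalityI subrelI)
  fix f g assume "(f, g) \<in> low_op M (lift_op M A)"
  then obtain f' g' where *: "f \<in> L2 M" "g \<in> L2 M" "(f', g') \<in> A" "emb M f = emb M f'" "emb M g = emb M g'"
    by (auto simp: low_op_def lift_op_def)
  show "(f, g) \<in> A"
    by (rule lin_operator_cong[OF assms *(3) *(1,2) *(4,5)[symmetric]])
next
  fix f g assume fg: "(f, g) \<in> A"
  then have "f \<in> L2 M \<and> g \<in> L2 M" by (rule lin_operator_L2[OF assms])
  then show "(f, g) \<in> low_op M (lift_op M A)"
    using fg by (auto simp: low_op_def lift_op_def)
qed

lemma emb_mem_lift_op:
  assumes "lin_operator M A" "f \<in> L2 M" "g \<in> L2 M"
  shows "(emb M f, emb M g) \<in> lift_op M A \<longleftrightarrow> (f, g) \<in> A"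
proof -
  have "(f, g) \<in> low_op M (lift_op M A) \<longleftrightarrow> (f, g) \<in> A" by (simp only: low_lift_op[OF assms(1)])
  then show ?thesis using assms(2,3) by (simp add: low_op_def)
qed

text \<open>Zero extensions compose to a zero extension, so a square root of A lifts to a square
  root of the lift.\<close>

lemma lift_op_comp:
  assumes "lin_operator M S" "lin_operator M R"
  shows "lift_op M (R O S) = lift_op M R O lift_op M S"
proof (intro equalityI subrelI)
  fix u w assume "(u, w) \<in> lift_op M (R O S)"
  then obtain f g h where *: "(f, g) \<in> R" "(g, h) \<in> S" "fproj M u = emb M f" "w = emb M h"
    by (auto simp: lift_op_def)
  have "g \<in> L2 M" using lin_operator_L2[OF assms(2) *(1)] by simp
  then have "(u, emb M g) \<in> lift_op M R" "(emb M g, w) \<in> lift_op M S"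
    using * by (auto simp: lift_op_def)
  then show "(u, w) \<in> lift_op M R O lift_op M S" by blast
next
  fix u w assume "(u, w) \<in> lift_op M R O lift_op M S"
  then obtain f g g' h where *: "(f, g) \<in> R" "fproj M u = emb M f" "(g', h) \<in> S"
    "fproj M (emb M g) = emb M g'" "w = emb M h"
    by (auto simp: lift_op_def)
  have L: "g \<in> L2 M" "h \<in> L2 M"
    using lin_operator_L2[OF assms(2) *(1)] lin_operator_L2[OF assms(1) *(3)] by auto
  have "(g, h) \<in> S" by (rule lin_operator_cong[OF assms(1) *(3)]) (use L * in auto)
  then have "(f, h) \<in> R O S" using *(1) by blast
  then show "(u, w) \<in> lift_op M (R O S)" using * unfolding lift_op_def by blast
qed

lemma psa_lift_op:
  assumes "positive_self_adjoint M A"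
  shows "psa (lift_op M A)"
proof -
  have lin: "lin_operator M A" and dense: "densely_defined M A" and adj: "adjoint_op M A = A"
    and pos: "\<And>f g. (f, g) \<in> A \<Longrightarrow> 0 \<le> Re (L2_inner M g f)"
    using assms by (auto simp: positive_self_adjoint_def self_adjoint_def)
  note L = lin_operator_L2[OF lin]
  show ?thesis
    unfolding psa_def
  proof (intro conjI)
    show "subspace (lift_op M A)"
    proof (rule subspaceI)
      show "0 \<in> lift_op M A"
        unfolding lift_op_def zero_prod_def using lin_operator_zero[OF lin]
        by (auto intro!: exI[of _ "\<lambda>_. 0"] simp: blinfun.zero_right)
    next
      fix p q assume "p \<in> lift_op M A" "q \<in> lift_op M A"
      then obtain f g f' g' where *: "(f, g) \<in> A" "fproj M (fst p) = emb M f" "snd p = emb M g"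
        "(f', g') \<in> A" "fproj M (fst q) = emb M f'" "snd q = emb M g'"
        by (auto simp: lift_op_def)
      have "fproj M (fst p + fst q) = emb M (\<lambda>x. f x + f' x)" "snd p + snd q = emb M (\<lambda>x. g x + g' x)"
        using * L by (simp_all add: blinfun.add_right emb_add)
      then show "p + q \<in> lift_op M A"
        using lin_operator_add[OF lin *(1,4)] unfolding lift_op_def plus_prod_def by blast
    next
      fix c :: real and p assume "p \<in> lift_op M A"
      then obtain f g where *: "(f, g) \<in> A" "fproj M (fst p) = emb M f" "snd p = emb M g"
        by (auto simp: lift_op_def)
      have "fproj M (c *\<^sub>R fst p) = emb M (\<lambda>x. complex_of_real c * f x)"
        "c *\<^sub>R snd p = emb M (\<lambda>x. complex_of_real c * g x)"
        using * L by (simp_all add: blinfun.scaleR_right emb_scaleR)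
      then show "c *\<^sub>R p \<in> lift_op M A"
        using lin_operator_scale[OF lin *(1)] unfolding lift_op_def scaleR_prod_def by blast
    qed
    show "closure (Domain (lift_op M A)) = UNIV"
    proof (intro equalityI subset_UNIV subsetI)
      fix u :: "'a hil"
      show "u \<in> closure (Domain (lift_op M A))"
        unfolding closure_approachable
      proof (intro allI impI)
        fix e :: real assume "0 < e"
        then obtain f g where f: "(f, g) \<in> A" "L2_norm M (\<lambda>x. sec M u x - f x) < e"
          using dense unfolding densely_defined_def by (meson DomainE sec_L2)
        \<comment> \<open>Only the component over M is approximated; the component in the complement
          is kept, as it lies in the domain.\<close>
        define u' where "u' = emb M f + (u - fproj M u)"
        have "fproj M u' = emb M f" using L[OF f(1)] by (simp add: u'_def blinfun.add_right blinfun.diff_right)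
        then have "u' \<in> Domain (lift_op M A)" using f(1) by (auto simp: lift_op_def)
        moreover have "u - u' = emb M (\<lambda>x. sec M u x - f x)"
          using L[OF f(1)] by (simp add: u'_def fproj_apply emb_diff)
        then have "dist u' u < e"
          using f(2) L[OF f(1)] by (simp add: dist_norm norm_minus_commute[of u'] norm_emb L2_diff)
        ultimately show "\<exists>y\<in>Domain (lift_op M A). dist y u < e" by blast
      qed
    qed
    have sym: "v \<bullet> u' = u \<bullet> v'" if uv: "(u, v) \<in> lift_op M A" and uv': "(u', v') \<in> lift_op M A" for u v u' v'
    proof -
      obtain f g f' g' where *: "(f, g) \<in> A" "fproj M u = emb M f" "v = emb M g"
        "(f', g') \<in> A" "fproj M u' = emb M f'" "v' = emb M g'"
        using uv uv' by (auto simp: lift_op_def)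
      have "(f', g') \<in> adjoint_op M A" using *(4) adj by simp
      then have "L2_inner M g f' = L2_inner M f g'" using *(1) by (auto simp: adjoint_op_def)
      then have "emb M g \<bullet> emb M f' = emb M f \<bullet> emb M g'" using L[OF *(1)] L[OF *(4)] by (simp add: inner_emb_emb)
      then have "emb M g \<bullet> fproj M u' = fproj M u \<bullet> emb M g'" using * by simp
      then show ?thesis
        using * L[OF *(1)] L[OF *(4)] fproj_sym[of M "emb M g" u'] fproj_sym[of M u "emb M g'"] by simp
    qed
    show "{(f, h). \<forall>(u, v)\<in>lift_op M A. v \<bullet> f = u \<bullet> h} = lift_op M A"
    proof (intro equalityI subrelI)
      fix p q assume "(p, q) \<in> {(f, h). \<forall>(u, v)\<in>lift_op M A. v \<bullet> f = u \<bullet> h}"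
      then have pq: "v \<bullet> p = u \<bullet> q" if "(u, v) \<in> lift_op M A" for u v using that by auto
      \<comment> \<open>The pairs (w - P w, 0) of the lifted graph, with P the projection, force q
        into the copy of L2 over M.\<close>
      have "w \<bullet> (q - fproj M q) = 0" for w
      proof -
        have "fproj M (w - fproj M w) = emb M (\<lambda>_. 0)" by (simp add: blinfun.diff_right)
        then have "(w - fproj M w, emb M (\<lambda>_. 0)) \<in> lift_op M A"
          using lin_operator_zero[OF lin] unfolding lift_op_def by blast
        from pq[OF this] have "(w - fproj M w) \<bullet> q = 0" by simp
        then show ?thesis by (simp add: inner_diff_left inner_diff_right fproj_sym)
      qed
      from this[of "q - fproj M q"] have q: "q = fproj M q" by simp
      have "(sec M p, sec M q) \<in> adjoint_op M A"
        unfolding adjoint_op_def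
      proof (clarsimp)
        fix u v assume uv: "(u, v) \<in> A"
        have eq: "emb M g \<bullet> fproj M p = emb M f \<bullet> fproj M q" if "(f, g) \<in> A" for f g
        proof -
          have "(emb M f, emb M g) \<in> lift_op M A" using that L emb_mem_lift_op[OF lin] by blast
          from pq[OF this] show ?thesis
            using L[OF that] fproj_sym[of M "emb M g" p] fproj_sym[of M "emb M f" q] by simp
        qed
        \<comment> \<open>Testing against i times the pair (u, v) as well supplies the imaginary
          part of the complex adjoint relation.\<close>
        from eq[OF lin_operator_scale[OF lin uv, of \<i>]]
        have "imul (emb M v) \<bullet> fproj M p = imul (emb M u) \<bullet> fproj M q"
          using L[OF uv] by (simp add: emb_imul)
        with eq[OF uv] show "L2_inner M v (sec M p) = L2_inner M u (sec M q)"
          using L[OF uv] by (simp add: L2_inner_eq_iff fproj_apply)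
      qed
      then have "(sec M p, sec M q) \<in> A" by (simp add: adj)
      then show "(p, q) \<in> lift_op M A"
        using q unfolding lift_op_def fproj_apply by blast
    next
      fix p q assume "(p, q) \<in> lift_op M A"
      then show "(p, q) \<in> {(f, h). \<forall>(u, v)\<in>lift_op M A. v \<bullet> f = u \<bullet> h}" using sym by auto
    qed
    show "\<forall>(u, v)\<in>lift_op M A. 0 \<le> v \<bullet> u"
    proof (clarify)
      fix u v assume "(u, v) \<in> lift_op M A"
      then obtain f g where *: "(f, g) \<in> A" "fproj M u = emb M f" "v = emb M g" by (auto simp: lift_op_def)
      have "v \<bullet> u = emb M g \<bullet> emb M f"
        using * L[OF *(1)] fproj_sym[of M "emb M g" u] by simp
      then show "0 \<le> v \<bullet> u" using pos[OF *(1)] L[OF *(1)] by (simp add: inner_emb_emb)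
    qed
  qed
qed

lemma psa_single: "psa A \<Longrightarrow> (0, v) \<in> A \<Longrightarrow> v = 0"
proof -
  assume A: "psa A" and v: "(0, v) \<in> A"
  have "u \<bullet> v = 0" if "u \<in> Domain A" for u
    using that psa_sym[OF A v] by force
  with A show "v = 0" by (intro orth_dense_eq_0[of "Domain A"]) (auto simp: psa_def)
qed

text \<open>Invariance under i makes the restriction complex linear; invariance under the projection
  keeps enough pairs in it, both for density and for testing the adjoint.\<close>

lemma positive_self_adjoint_low_op:
  assumes B: "psa B" and im: "\<And>u v. (u, v) \<in> B \<Longrightarrow> (imul u, imul v) \<in> B"
    and P: "\<And>u v. (u, v) \<in> B \<Longrightarrow> (fproj M u, fproj M v) \<in> B"
  shows "positive_self_adjoint M (low_op M B)"
proof -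
  have sub: "subspace B" using B by (simp add: psa_def)
  have add: "(u + u', v + v') \<in> B" if "(u, v) \<in> B" "(u', v') \<in> B" for u v u' v'
    using subspace_add[OF sub that] by simp
  have scale: "(c *\<^sub>R u, c *\<^sub>R v) \<in> B" if "(u, v) \<in> B" for c u v
    using subspace_scale[OF sub that] by simp
  have sec: "(sec M u, sec M v) \<in> low_op M B" if "(u, v) \<in> B" for u v
    using P[OF that] by (simp add: low_op_def fproj_apply)
  have lin: "lin_operator M (low_op M B)"
    unfolding lin_operator_def
  proof (intro conjI allI impI)
    show "low_op M B \<subseteq> L2 M \<times> L2 M" by (auto simp: low_op_def)
    show "(\<lambda>_. 0, \<lambda>_. 0) \<in> low_op M B"
      using subspace_0[OF sub] by (simp add: low_op_def zero_prod_def)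
    show "(\<lambda>x. f x + f' x, \<lambda>x. g x + g' x) \<in> low_op M B"
      if "(f, g) \<in> low_op M B" "(f', g') \<in> low_op M B" for f g f' g'
      using that by (simp add: low_op_def L2_add emb_add add)
    show "(\<lambda>x. c * f x, \<lambda>x. c * g x) \<in> low_op M B" if "(f, g) \<in> low_op M B" for c f g
      using that by (simp add: low_op_def L2_scale emb_scaleC add scale im)
    show "(f', g') \<in> low_op M B"
      if "(f, g) \<in> low_op M B" "f' \<in> L2 M" "g' \<in> L2 M" "AE x in M. f x = f' x" "AE x in M. g x = g' x"
      for f g f' g'
      using that emb_cong[of f M f'] emb_cong[of g M g'] by (simp add: low_op_def)
    show "AE x in M. g x = g' x" if "(f, g) \<in> low_op M B" "(f, g') \<in> low_op M B" for f g g'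
    proof -
      have "(emb M f - emb M f, emb M g - emb M g') \<in> B"
        using that subspace_diff[OF sub, of "(emb M f, emb M g)" "(emb M f, emb M g')"] by (simp add: low_op_def)
      then have "emb M g - emb M g' = 0" by (intro psa_single[OF B]) simp
      then have "emb M g = emb M g'" by simp
      then show ?thesis using that by (simp add: low_op_def emb_eq_iff)
    qed
  qed
  have "densely_defined M (low_op M B)"
    unfolding densely_defined_def
  proof (intro ballI allI impI)
    fix h and e :: real assume h: "h \<in> L2 M" and e: "0 < e"
    have "emb M h \<in> closure (Domain B)" using B by (simp add: psa_def)
    then obtain u v where uv: "(u, v) \<in> B" "dist u (emb M h) < e"
      using e unfolding closure_approachable by blast
    have "L2_norm M (\<lambda>x. h x - sec M u x) = norm (fproj M (emb M h - u))"
      using h by (simp add: norm_emb[symmetric] L2_diff emb_diff fproj_apply[symmetric] blinfun.diff_right)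
    also have "\<dots> \<le> norm (emb M h - u)" by (rule norm_fproj_le)
    also have "\<dots> < e" using uv(2) by (simp add: dist_norm norm_minus_commute)
    finally show "\<exists>f\<in>Domain (low_op M B). L2_norm M (\<lambda>x. h x - f x) < e" using sec[OF uv(1)] by blast
  qed
  moreover have "adjoint_op M (low_op M B) = low_op M B"
  proof (intro equalityI subrelI)
    fix f h assume "(f, h) \<in> adjoint_op M (low_op M B)"
    then have L: "f \<in> L2 M" "h \<in> L2 M"
      and adj: "\<And>u v. (u, v) \<in> low_op M B \<Longrightarrow> L2_inner M v f = L2_inner M u h"
      by (auto simp: adjoint_op_def)
    have "q \<bullet> emb M f = p \<bullet> emb M h" if "(p, q) \<in> B" for p q
    proof -
      have "L2_inner M (sec M q) f = L2_inner M (sec M p) h" by (rule adj[OF sec[OF that]])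
      then have "fproj M q \<bullet> emb M f = fproj M p \<bullet> emb M h"
        using L by (simp add: L2_inner_eq_iff fproj_apply)
      then show ?thesis using L by (simp add: fproj_inner_emb)
    qed
    then have "(emb M f, emb M h) \<in> B" using psa_iff[OF B] by blast
    then show "(f, h) \<in> low_op M B" using L by (simp add: low_op_def)
  next
    fix f h assume fh: "(f, h) \<in> low_op M B"
    then have L: "f \<in> L2 M" "h \<in> L2 M" "(emb M f, emb M h) \<in> B" by (auto simp: low_op_def)
    have "L2_inner M v f = L2_inner M u h" if "(u, v) \<in> low_op M B" for u v
      using that L psa_sym[OF B L(3)] im by (simp add: low_op_def L2_inner_eq_iff)
    then show "(f, h) \<in> adjoint_op M (low_op M B)" using L by (auto simp: adjoint_op_def)
  qed
  moreover have "0 \<le> Re (L2_inner M g f)" if "(f, g) \<in> low_op M B" for f g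
    using that B by (auto simp: low_op_def inner_emb_emb[symmetric] psa_def)
  ultimately show ?thesis using lin by (auto simp: positive_self_adjoint_def self_adjoint_def)
qed

text \<open>R x is the first component of the pair in A whose components add up to x. X maps this
  pair to one in A whose components add up to X x.\<close>

lemma resolvent_commute:
  fixes R X :: "'h::real_normed_vector \<Rightarrow>\<^sub>L 'h"
  assumes A: "A = range (\<lambda>x. (R x, x - R x))" and X: "\<And>u v. (u, v) \<in> A \<Longrightarrow> (X u, X v) \<in> A"
  shows "X o\<^sub>L R = R o\<^sub>L X"
proof (rule blinfun_eqI)
  fix x
  have "(R x, x - R x) \<in> A" unfolding A by (rule rangeI)
  then have "(X (R x), X (x - R x)) \<in> A" by (rule X)
  then obtain y where y: "X (R x) = R y" "X (x - R x) = y - R y" unfolding A by auto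
  then have "X x = y" by (simp add: blinfun.diff_right)
  with y(1) show "(X o\<^sub>L R) x = (R o\<^sub>L X) x" by simp
qed

lemma lift_op_imul: "lin_operator M A \<Longrightarrow> (u, v) \<in> lift_op M A \<Longrightarrow> (imul u, imul v) \<in> lift_op M A"
proof -
  assume lin: "lin_operator M A" and "(u, v) \<in> lift_op M A"
  then obtain f g where *: "(f, g) \<in> A" "fproj M u = emb M f" "v = emb M g" by (auto simp: lift_op_def)
  have "fproj M (imul u) = emb M (\<lambda>x. \<i> * f x)" "imul v = emb M (\<lambda>x. \<i> * g x)"
    using * lin_operator_L2[OF lin *(1)] by (simp_all add: fproj_imul emb_imul)
  then show ?thesis using lin_operator_scale[OF lin *(1)] unfolding lift_op_def by blast
qed

lemma lift_op_fproj: "lin_operator M A \<Longrightarrow> (u, v) \<in> lift_op M A \<Longrightarrow> (fproj M u, fproj M v) \<in> lift_op M A"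
  using lin_operator_L2[of M A] by (fastforce simp: lift_op_def)

lemma lift_op_compl: "lin_operator M A \<Longrightarrow> (u - fproj M u, 0) \<in> lift_op M A"
  using lin_operator_zero[of M A] unfolding lift_op_def
  by (auto intro!: exI[of _ "\<lambda>_. 0"] simp: blinfun.diff_right)

section \<open>Square root and heat semigroup of the given operator\<close>

locale psa_operator =
  fixes M :: "'a measure" and A :: "'a oper"
  assumes psa_M: "positive_self_adjoint M A"
begin

lemma lin: "lin_operator M A"
  using psa_M by (simp add: positive_self_adjoint_def self_adjoint_def)

lemma psa_lift: "psa (lift_op M A)"
  by (rule psa_lift_op[OF psa_M])

definition Res :: "'a hil \<Rightarrow>\<^sub>L 'a hil" where
  "Res = (SOME R. unit_op R \<and> lift_op M A = range (\<lambda>x. (blinfun_apply R x, x - R x)))"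

lemma Res: "unit_op Res" "lift_op M A = range (\<lambda>x. (Res x, x - Res x))"
proof -
  have "\<exists>R. unit_op R \<and> lift_op M A = range (\<lambda>x. (blinfun_apply R x, x - R x))"
    by (rule psa_resolvent[OF psa_lift]) (rule exI, rule conjI)
  then have "unit_op Res \<and> lift_op M A = range (\<lambda>x. (Res x, x - Res x))"
    unfolding Res_def by (rule someI_ex)
  then show "unit_op Res" "lift_op M A = range (\<lambda>x. (Res x, x - Res x))" by auto
qed

sublocale unit_op Res
  by (rule Res(1))

lemma Res_inj: "Res x = 0 \<Longrightarrow> x = 0"
proof -
  assume "Res x = 0"
  then have "(0, x) = (Res x, x - Res x)" by simp
  then have "(0, x) \<in> lift_op M A" unfolding Res(2) by (rule range_eqI)
  then show "x = 0" by (rule psa_single[OF psa_lift])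
qed

lemma psa_sqrt: "psa sqrt_graph"
  by (rule psa_sqrt_graph[OF Res_inj])

lemma fproj_Res: "fproj M o\<^sub>L Res = Res o\<^sub>L fproj M"
  by (rule resolvent_commute[OF Res(2)]) (rule lift_op_fproj[OF lin])

lemma imul_Res: "imul_op o\<^sub>L Res = Res o\<^sub>L imul_op"
  by (rule resolvent_commute[OF Res(2)]) (simp add: imul_op.rep_eq lift_op_imul[OF lin])

lemma sqrt_graph_fproj: "(u, v) \<in> sqrt_graph \<Longrightarrow> (fproj M u, fproj M v) \<in> sqrt_graph"
  unfolding sqrt_graph_def
  by (auto simp: fcalc_commute[OF fproj_Res] continuous_intros)

lemma sqrt_graph_imul: "(u, v) \<in> sqrt_graph \<Longrightarrow> (imul u, imul v) \<in> sqrt_graph"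
  using fcalc_commute[OF imul_Res] unfolding sqrt_graph_def
  by (auto simp: imul_op.rep_eq continuous_intros)

lemma positive_self_adjoint_sqrt: "positive_self_adjoint M (low_op M sqrt_graph)"
  by (rule positive_self_adjoint_low_op[OF psa_sqrt sqrt_graph_imul sqrt_graph_fproj])

lemma low_sqrt_comp: "low_op M sqrt_graph O low_op M sqrt_graph = A"
proof (intro equalityI subrelI)
  fix f h assume "(f, h) \<in> low_op M sqrt_graph O low_op M sqrt_graph"
  then obtain g where *: "f \<in> L2 M" "h \<in> L2 M" "(emb M f, emb M g) \<in> sqrt_graph" "(emb M g, emb M h) \<in> sqrt_graph"
    by (auto simp: low_op_def)
  then have "(emb M f, emb M h) \<in> sqrt_graph O sqrt_graph" by blast
  then have "(emb M f, emb M h) \<in> lift_op M A" by (simp add: sqrt_graph_comp Res(2))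
  then show "(f, h) \<in> A" using emb_mem_lift_op[OF lin *(1,2)] by blast
next
  fix f h assume fh: "(f, h) \<in> A"
  have L: "f \<in> L2 M" "h \<in> L2 M" using lin_operator_L2[OF lin fh] by auto
  have "(emb M f, emb M h) \<in> sqrt_graph O sqrt_graph"
    using fh emb_mem_lift_op[OF lin L] by (simp add: sqrt_graph_comp Res(2))
  then obtain v where "(emb M f, v) \<in> sqrt_graph" "(v, emb M h) \<in> sqrt_graph" by blast
  then have "(fproj M (emb M f), fproj M v) \<in> sqrt_graph" "(fproj M v, fproj M (emb M h)) \<in> sqrt_graph"
    by (auto intro: sqrt_graph_fproj)
  then have "(f, sec M v) \<in> low_op M sqrt_graph" "(sec M v, h) \<in> low_op M sqrt_graph"
    unfolding low_op_def using L by (simp_all add: fproj_apply emb_sec_emb)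
  then show "(f, h) \<in> low_op M sqrt_graph O low_op M sqrt_graph" by blast
qed

text \<open>A competitor B with B^2 = A is lifted, identified there by
  \<open>psa_sqrt_unique\<close>, and recovered from its lift.\<close>

lemma sqrt_op_eq: "sqrt_op M A = low_op M sqrt_graph"
  unfolding sqrt_op_def
proof (rule the_equality)
  show "positive_self_adjoint M (low_op M sqrt_graph) \<and> low_op M sqrt_graph O low_op M sqrt_graph = A"
    using positive_self_adjoint_sqrt low_sqrt_comp by simp
  fix B assume B: "positive_self_adjoint M B \<and> B O B = A"
  then have linB: "lin_operator M B" by (simp add: positive_self_adjoint_def self_adjoint_def)
  have "lift_op M B O lift_op M B = lift_op M A"
    using lift_op_comp[OF linB linB] B by simp
  then have "lift_op M B = sqrt_graph"
    using B by (intro psa_sqrt_unique Res(1) psa_lift_op) (simp_all add: Res(2))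
  then show "B = low_op M sqrt_graph" using low_lift_op[OF linB] by simp
qed

text \<open>All representatives of the square root at f have the same norm, so the infimum is over a
  constant; finiteness of the energy makes the index set nonempty.\<close>

lemma energy_finite:
  assumes f: "f \<in> L2 M" and fin: "energy M A f < \<infinity>"
  obtains g where "(emb M f, g) \<in> sqrt_graph" "energy M A f = ennreal (g \<bullet> g)" "fproj M g = g"
proof -
  have en: "energy M A f = (INF g\<in>low_op M sqrt_graph `` {f}. ennreal ((L2_norm M g)\<^sup>2))"
    by (simp add: energy_def sqrt_op_eq)
  have "low_op M sqrt_graph `` {f} \<noteq> {}"
  proof
    assume "low_op M sqrt_graph `` {f} = {}"
    then have "energy M A f = \<infinity>" by (simp add: en)
    with fin show False by simp
  qed
  then obtain g where g: "(f, g) \<in> low_op M sqrt_graph" by blast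
  then have gL: "g \<in> L2 M" "(emb M f, emb M g) \<in> sqrt_graph" by (auto simp: low_op_def)
  have linB: "lin_operator M (low_op M sqrt_graph)"
    using positive_self_adjoint_sqrt by (simp add: positive_self_adjoint_def self_adjoint_def)
  have "ennreal ((L2_norm M g')\<^sup>2) = ennreal (emb M g \<bullet> emb M g)" if "g' \<in> low_op M sqrt_graph `` {f}" for g'
  proof -
    have g': "(f, g') \<in> low_op M sqrt_graph" using that by blast
    then have "emb M g' = emb M g" by (rule lin_operator_unique[OF linB _ g]) simp
    moreover have "g' \<in> L2 M" using g' by (simp add: low_op_def)
    ultimately show ?thesis by (simp add: norm_emb[symmetric] power2_norm_eq_inner)
  qed
  then have "energy M A f = (INF g'\<in>low_op M sqrt_graph `` {f}. ennreal (emb M g \<bullet> emb M g))"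
    unfolding en by (intro INF_cong refl)
  also have "\<dots> = ennreal (emb M g \<bullet> emb M g)" using g by (intro cINF_const) blast
  finally show thesis using that[of "emb M g"] gL by simp
qed

definition heat_op :: "real \<Rightarrow> 'a oper" where
  "heat_op t = {(f, g). f \<in> L2 M \<and> g \<in> L2 M \<and> emb M g = sgr t (emb M f)}"

lemma c0_gen_lift: "c0_gen sgr (lift_op M A)"
  by (rule c0_gen_sgr[OF psa_lift Res(2)])

lemma fproj_sgr: "0 \<le> t \<Longrightarrow> fproj M (sgr t u) = sgr t (fproj M u)"
  unfolding sgr_def by (rule fcalc_commute[OF fproj_Res continuous_on_heat])

lemma imul_sgr: "0 \<le> t \<Longrightarrow> imul (sgr t u) = sgr t (imul u)"
  unfolding sgr_def using fcalc_commute[OF imul_Res continuous_on_heat, of t u] by (simp add: imul_op.rep_eq)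

lemma heat_op_sec:
  assumes "0 \<le> t" "f \<in> L2 M"
  shows "(f, sec M (sgr t (emb M f))) \<in> heat_op t"
  using assms fproj_sgr[of t "emb M f"] by (simp add: heat_op_def fproj_apply emb_sec_emb)

lemma emb_op_apply_heat_op:
  assumes "0 \<le> t" "f \<in> L2 M"
  shows "op_apply (heat_op t) f \<in> L2 M" "emb M (op_apply (heat_op t) f) = sgr t (emb M f)"
proof -
  have "(f, op_apply (heat_op t) f) \<in> heat_op t"
    unfolding op_apply_def using heat_op_sec[OF assms]
    by (rule someI[of "\<lambda>g. (f, g) \<in> heat_op t"])
  then show "op_apply (heat_op t) f \<in> L2 M" "emb M (op_apply (heat_op t) f) = sgr t (emb M f)"
    by (auto simp: heat_op_def)
qed

lemma lin_operator_heat_op: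
  assumes "0 \<le> t"
  shows "lin_operator M (heat_op t)"
  unfolding lin_operator_def
proof (intro conjI allI impI)
  show "heat_op t \<subseteq> L2 M \<times> L2 M" by (auto simp: heat_op_def)
  show "(\<lambda>_. 0, \<lambda>_. 0) \<in> heat_op t" by (simp add: heat_op_def blinfun.zero_right)
  show "(\<lambda>x. f x + f' x, \<lambda>x. g x + g' x) \<in> heat_op t"
    if "(f, g) \<in> heat_op t" "(f', g') \<in> heat_op t" for f g f' g'
    using that by (simp add: heat_op_def L2_add emb_add blinfun.add_right)
  show "(\<lambda>x. c * f x, \<lambda>x. c * g x) \<in> heat_op t" if "(f, g) \<in> heat_op t" for c f g
    using that assms
    by (simp add: heat_op_def L2_scale emb_scaleC blinfun.add_right blinfun.scaleR_right imul_sgr)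
  show "(f', g') \<in> heat_op t"
    if "(f, g) \<in> heat_op t" "f' \<in> L2 M" "g' \<in> L2 M" "AE x in M. f x = f' x" "AE x in M. g x = g' x"
    for f g f' g'
    using that emb_cong[of f M f'] emb_cong[of g M g'] by (simp add: heat_op_def)
  show "AE x in M. g x = g' x" if "(f, g) \<in> heat_op t" "(f, g') \<in> heat_op t" for f g g'
    using that by (simp add: heat_op_def emb_eq_iff[symmetric])
qed

lemma at_right_0_pos: "\<forall>\<^sub>F t in at_right 0. (0::real) < t"
  by (rule eventually_at_right_less)

lemma C0_semigroup_heat_op: "C0_semigroup M heat_op"
  unfolding C0_semigroup_def
proof (intro conjI allI impI ballI)
  fix t :: real assume t: "0 \<le> t"
  have "Domain (heat_op t) = L2 M"
  proof
    show "L2 M \<subseteq> Domain (heat_op t)" using heat_op_sec[OF t] by blast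
  qed (auto simp: heat_op_def)
  moreover have "L2_norm M g \<le> 1 * L2_norm M f" if fg: "(f, g) \<in> heat_op t" for f g
  proof -
    have "norm (sgr t (emb M f)) \<le> 1 * norm (emb M f)" by (rule norm_blinfun_le[OF norm_sgr_le[OF t]])
    then show ?thesis using fg by (simp add: heat_op_def norm_emb[symmetric])
  qed
  ultimately show "bounded_operator M (heat_op t)"
    using lin_operator_heat_op[OF t] unfolding bounded_operator_def by blast
next
  fix f assume "f \<in> L2 M"
  then show "(f, f) \<in> heat_op 0" by (simp add: heat_op_def)
next
  fix s t :: real assume st: "0 \<le> s" "0 \<le> t"
  have add: "sgr (s + t) u = sgr t (sgr s u)" for u
    using sgr_add[OF st(2,1)] by (simp add: add.commute)
  show "heat_op (s + t) = heat_op s O heat_op t"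
  proof (intro equalityI subrelI)
    fix f h assume fh: "(f, h) \<in> heat_op (s + t)"
    then have f: "f \<in> L2 M" by (simp add: heat_op_def)
    have "(f, sec M (sgr s (emb M f))) \<in> heat_op s" by (rule heat_op_sec[OF st(1) f])
    moreover from this have "(sec M (sgr s (emb M f)), h) \<in> heat_op t"
      using fh by (simp add: heat_op_def add)
    ultimately show "(f, h) \<in> heat_op s O heat_op t" by blast
  qed (auto simp: heat_op_def add)
next
  fix f assume f: "f \<in> L2 M"
  have "((\<lambda>t. sgr t (emb M f)) \<longlongrightarrow> emb M f) (at_right 0)"
    using c0_gen_lift by (simp add: c0_gen_def)
  then have "((\<lambda>t. sgr t (emb M f) - emb M f) \<longlongrightarrow> 0) (at_right 0)" by (rule LIM_zero)
  then have lim: "((\<lambda>t. norm (sgr t (emb M f) - emb M f)) \<longlongrightarrow> 0) (at_right 0)"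
    by (rule tendsto_norm_zero)
  have ev: "\<forall>\<^sub>F t in at_right 0. norm (sgr t (emb M f) - emb M f) = L2_norm M (\<lambda>x. op_apply (heat_op t) f x - f x)"
    using at_right_0_pos
  proof eventually_elim
    fix t :: real assume "0 < t"
    then show "norm (sgr t (emb M f) - emb M f) = L2_norm M (\<lambda>x. op_apply (heat_op t) f x - f x)"
      using emb_op_apply_heat_op[of t f] f by (simp add: norm_emb[symmetric] L2_diff emb_diff)
  qed
  show "((\<lambda>t. L2_norm M (\<lambda>x. op_apply (heat_op t) f x - f x)) \<longlongrightarrow> 0) (at_right 0)"
    by (rule Lim_transform_eventually[OF lim ev])
qed

text \<open>F and U are left open because the lemma serves twice: for the constructed semigroup, and
  for the unknown one in the uniqueness proof.\<close>

lemma generator_iff: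
  assumes f: "f \<in> L2 M" and g: "g \<in> L2 M"
    and F: "\<And>t. 0 < t \<Longrightarrow> F t \<in> L2 M" and U: "\<And>t. 0 < t \<Longrightarrow> emb M (F t) = U t"
  shows "((\<lambda>t. L2_norm M (\<lambda>x. (F t x - f x) / complex_of_real t - g x)) \<longlongrightarrow> 0) (at_right 0)
    \<longleftrightarrow> ((\<lambda>t. (1 / t) *\<^sub>R (U t - emb M f)) \<longlongrightarrow> emb M g) (at_right 0)"
proof -
  have ev: "\<forall>\<^sub>F t in at_right 0. L2_norm M (\<lambda>x. (F t x - f x) / complex_of_real t - g x)
      = norm ((1 / t) *\<^sub>R (U t - emb M f) - emb M g)"
    using at_right_0_pos
  proof eventually_elim
    fix t :: real assume t: "0 < t"
    have L: "(\<lambda>x. F t x - f x) \<in> L2 M" using F[OF t] f by (rule L2_diff)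
    have "(\<lambda>x. (F t x - f x) / complex_of_real t - g x)
        = (\<lambda>x. complex_of_real (1 / t) * (F t x - f x) - g x)" by simp
    then have "L2_norm M (\<lambda>x. (F t x - f x) / complex_of_real t - g x)
        = norm (emb M (\<lambda>x. complex_of_real (1 / t) * (F t x - f x) - g x))"
      using L2_diff[OF L2_scale[OF L] g, of "complex_of_real (1 / t)"] by (simp only: norm_emb)
    also have "emb M (\<lambda>x. complex_of_real (1 / t) * (F t x - f x) - g x)
        = (1 / t) *\<^sub>R (U t - emb M f) - emb M g"
      using F[OF t] f g L by (simp only: emb_diff emb_scaleR L2_scale U[OF t])
    finally show "L2_norm M (\<lambda>x. (F t x - f x) / complex_of_real t - g x)
        = norm ((1 / t) *\<^sub>R (U t - emb M f) - emb M g)" .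
  qed
  have "((\<lambda>t. L2_norm M (\<lambda>x. (F t x - f x) / complex_of_real t - g x)) \<longlongrightarrow> 0) (at_right 0)
    \<longleftrightarrow> ((\<lambda>t. norm ((1 / t) *\<^sub>R (U t - emb M f) - emb M g)) \<longlongrightarrow> 0) (at_right 0)"
    by (rule tendsto_cong[OF ev])
  also have "\<dots> \<longleftrightarrow> ((\<lambda>t. (1 / t) *\<^sub>R (U t - emb M f)) \<longlongrightarrow> emb M g) (at_right 0)"
    by (simp only: tendsto_norm_zero_iff LIM_zero_iff)
  finally show ?thesis .
qed

lemma neg_op_iff: "(f, g) \<in> neg_op A \<longleftrightarrow> (f, (\<lambda>x. - g x)) \<in> A"
proof
  assume "(f, \<lambda>x. - g x) \<in> A"
  then show "(f, g) \<in> neg_op A" unfolding neg_op_def by (auto intro!: exI[of _ "\<lambda>x. - g x"])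
qed (auto simp: neg_op_def)

lemma generator_heat_op: "generator M heat_op = neg_op A"
proof -
  have "(f, g) \<in> generator M heat_op \<longleftrightarrow> (f, g) \<in> neg_op A" for f g
  proof (cases "f \<in> L2 M \<and> g \<in> L2 M")
    case True
    then have L: "f \<in> L2 M" "g \<in> L2 M" by auto
    have "(f, g) \<in> generator M heat_op \<longleftrightarrow>
        ((\<lambda>t. (1 / t) *\<^sub>R (sgr t (emb M f) - emb M f)) \<longlongrightarrow> emb M g) (at_right 0)"
      using generator_iff[OF L, of "\<lambda>t. op_apply (heat_op t) f" "\<lambda>t. sgr t (emb M f)"]
        emb_op_apply_heat_op[OF _ L(1)] L by (simp add: generator_def)
    also have "\<dots> \<longleftrightarrow> (emb M f, - emb M g) \<in> lift_op M A"
      using c0_gen_lift unfolding c0_gen_def by blast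
    also have "\<dots> \<longleftrightarrow> (f, (\<lambda>x. - g x)) \<in> A"
      using emb_mem_lift_op[OF lin L(1) L2_uminus[OF L(2)]] L by (simp add: emb_uminus)
    finally show ?thesis by (simp add: neg_op_iff)
  next
    case False
    have "(f, g) \<notin> neg_op A"
    proof
      assume "(f, g) \<in> neg_op A"
      then have "(f, (\<lambda>x. - g x)) \<in> A" by (simp add: neg_op_iff)
      then have "f \<in> L2 M" "(\<lambda>x. - g x) \<in> L2 M" using lin_operator_L2[OF lin] by blast+
      then show False using False L2_uminus[of "\<lambda>x. - g x" M] by simp
    qed
    then show ?thesis using False by (auto simp: generator_def)
  qed
  then show ?thesis by auto
qed

text \<open>The unknown semigroup is extended by the identity on the complement of the copy of L2
  over M, which matches the extension of A by 0. The extended family has minus the lift of A as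
  generator, so \<open>c0_gen_unique\<close> applies.\<close>

lemma C0_semigroup_unique:
  assumes T: "C0_semigroup M T" and gen: "generator M T = neg_op A" and t: "0 \<le> t"
  shows "T t = heat_op t"
proof -
  have bop: "bounded_operator M (T t)" if "0 \<le> t" for t using T that by (auto simp: C0_semigroup_def)
  have linT: "lin_operator M (T t)" if "0 \<le> t" for t using bop[OF that] by (simp add: bounded_operator_def)
  define F where "F t f = op_apply (T t) f" for t f
  have F: "(f, F t f) \<in> T t" if "0 \<le> t" "f \<in> L2 M" for t f
  proof -
    have "f \<in> Domain (T t)" using bop[OF that(1)] that(2) by (simp add: bounded_operator_def)
    then have "\<exists>g. (f, g) \<in> T t" by blast
    then show ?thesis unfolding F_def op_apply_def by (rule someI_ex[of "\<lambda>g. (f, g) \<in> T t"])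
  qed
  have FL: "F t f \<in> L2 M" if "0 \<le> t" "f \<in> L2 M" for t f
    using lin_operator_L2[OF linT[OF that(1)] F[OF that]] by simp
  have Feq: "emb M (F t f) = emb M g" if "0 \<le> t" "(f', g) \<in> T t" "f \<in> L2 M" "emb M f = emb M f'" for t f f' g
    by (rule lin_operator_unique[OF linT[OF that(1)] F[OF that(1,3)] that(2,4)])
  define U0 where "U0 t u = emb M (F t (sec M u)) + (u - fproj M u)" for t u
  have bl: "bounded_linear (U0 t)" if t: "0 \<le> t" for t
  proof -
    obtain C where C: "\<And>f g. (f, g) \<in> T t \<Longrightarrow> L2_norm M g \<le> C * L2_norm M f"
      using bop[OF t] unfolding bounded_operator_def by blast
    show ?thesis
    proof (rule bounded_linear_intro[where K = "\<bar>C\<bar> + 1"])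
      fix u v :: "'a hil" and c :: real
      have "(\<lambda>x. sec M u x + sec M v x, \<lambda>x. F t (sec M u) x + F t (sec M v) x) \<in> T t"
        by (intro lin_operator_add[OF linT] t F sec_L2)
      from Feq[OF t this sec_L2, of "u + v"]
      have "emb M (F t (sec M (u + v))) = emb M (F t (sec M u)) + emb M (F t (sec M v))"
        by (simp add: emb_sec_add emb_add FL t)
      then show "U0 t (u + v) = U0 t u + U0 t v" by (simp add: U0_def blinfun.add_right)
      have "(\<lambda>x. complex_of_real c * sec M u x, \<lambda>x. complex_of_real c * F t (sec M u) x) \<in> T t"
        by (intro lin_operator_scale[OF linT] t F sec_L2)
      from Feq[OF t this sec_L2, of "c *\<^sub>R u"]
      have "emb M (F t (sec M (c *\<^sub>R u))) = c *\<^sub>R emb M (F t (sec M u))"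
        by (simp add: emb_sec_scaleR emb_scaleR FL t)
      then show "U0 t (c *\<^sub>R u) = c *\<^sub>R U0 t u"
        by (simp add: U0_def blinfun.scaleR_right scaleR_add_right scaleR_diff_right)
      have "norm (emb M (F t (sec M u))) \<le> C * norm (fproj M u)"
        using C[OF F[OF t sec_L2[of M u]]] FL[OF t sec_L2[of M u]] by (simp add: norm_emb fproj_apply)
      also have "\<dots> \<le> \<bar>C\<bar> * norm u" by (intro mult_mono norm_fproj_le) auto
      finally have "norm (U0 t u) \<le> \<bar>C\<bar> * norm u + norm u"
        unfolding U0_def using norm_fproj_compl_le[of u M]
        by (intro order_trans[OF norm_triangle_ineq] add_mono)
      then show "norm (U0 t u) \<le> norm u * (\<bar>C\<bar> + 1)" by (simp add: algebra_simps)
    qed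
  qed
  define U where "U t = Blinfun (U0 t)" for t
  have U: "U t u = emb M (F t (sec M u)) + (u - fproj M u)" if "0 \<le> t" for t u
    unfolding U_def using bl[OF that] by (simp add: bounded_linear_Blinfun_apply U0_def)
  have U_emb: "U t (emb M f) = emb M (F t f)" if "0 \<le> t" "f \<in> L2 M" for t f
  proof -
    have "emb M (F t (sec M (emb M f))) = emb M (F t f)"
      by (rule Feq[OF that(1) F[OF that] sec_L2]) (simp add: emb_sec_emb that)
    then show ?thesis using that by (simp add: U)
  qed
  have "c0_gen U (lift_op M A)"
    unfolding c0_gen_def
  proof (intro conjI allI impI)
    show "U 0 = id_blinfun"
    proof (rule blinfun_eqI)
      fix u
      have "(sec M u, sec M u) \<in> T 0" using T by (simp add: C0_semigroup_def)
      from Feq[OF _ this sec_L2, of u] have "emb M (F 0 (sec M u)) = fproj M u" by (simp add: fproj_apply)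
      then show "U 0 u = id_blinfun u" by (simp add: U)
    qed
  next
    fix s t :: real assume st: "0 \<le> s" "0 \<le> t"
    show "U (s + t) = U s o\<^sub>L U t"
    proof (rule blinfun_eqI)
      fix u
      have "T (t + s) = T t O T s" using T st by (simp add: C0_semigroup_def)
      then have "(sec M u, F s (F t (sec M u))) \<in> T (s + t)"
        using F[OF st(2) sec_L2] F[OF st(1) FL[OF st(2) sec_L2]] by (auto simp: add.commute)
      from Feq[OF _ this sec_L2, of u]
      have 1: "emb M (F (s + t) (sec M u)) = emb M (F s (F t (sec M u)))" using st by simp
      have L: "F t (sec M u) \<in> L2 M" by (intro FL st sec_L2)
      have c: "fproj M (u - fproj M u) = 0" by (simp add: blinfun.diff_right)
      have 2: "U s (u - fproj M u) = u - fproj M u"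
      proof -
        have "(\<lambda>_. 0, \<lambda>_. 0) \<in> T s" by (rule lin_operator_zero[OF linT[OF st(1)]])
        from Feq[OF st(1) this sec_L2, of "u - fproj M u"]
        have "emb M (F s (sec M (u - fproj M u))) = 0" using c by (simp add: fproj_apply)
        then show ?thesis by (simp only: U[OF st(1)] c) simp
      qed
      have "U s (U t u) = U s (emb M (F t (sec M u))) + U s (u - fproj M u)"
        unfolding U[OF st(2)] by (rule blinfun.add_right)
      also have "\<dots> = U (s + t) u"
        using st by (simp only: U_emb[OF st(1) L] 2 U[of "s + t"] 1 add_nonneg_nonneg)
      finally show "U (s + t) u = (U s o\<^sub>L U t) u" by simp
    qed
  next
    fix u
    have "((\<lambda>t. L2_norm M (\<lambda>x. F t (sec M u) x - sec M u x)) \<longlongrightarrow> 0) (at_right 0)"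
      using T by (simp add: C0_semigroup_def F_def)
    moreover have "\<forall>\<^sub>F t in at_right 0. L2_norm M (\<lambda>x. F t (sec M u) x - sec M u x) = norm (U t u - u)"
      using at_right_0_pos
    proof eventually_elim
      fix t :: real assume "0 < t"
      then have t: "0 \<le> t" by simp
      have "emb M (\<lambda>x. F t (sec M u) x - sec M u x) = U t u - u"
        using t by (simp add: U emb_diff FL fproj_apply)
      moreover have "(\<lambda>x. F t (sec M u) x - sec M u x) \<in> L2 M" by (intro L2_diff FL t sec_L2)
      ultimately show "L2_norm M (\<lambda>x. F t (sec M u) x - sec M u x) = norm (U t u - u)"
        by (metis norm_emb)
    qed
    ultimately have "((\<lambda>t. norm (U t u - u)) \<longlongrightarrow> 0) (at_right 0)"
      by (rule Lim_transform_eventually)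
    then show "((\<lambda>t. U t u) \<longlongrightarrow> u) (at_right 0)"
      by (simp only: tendsto_norm_zero_iff LIM_zero_iff)
  next
    fix u v
    have eq: "(1 / t) *\<^sub>R (U t u - u) = (1 / t) *\<^sub>R (emb M (F t (sec M u)) - emb M (sec M u))" if "0 < t" for t
      using that by (simp add: U fproj_apply)
    have key: "((\<lambda>t. (1 / t) *\<^sub>R (U t u - u)) \<longlongrightarrow> emb M g) (at_right 0) \<longleftrightarrow> (u, - emb M g) \<in> lift_op M A"
      if g: "g \<in> L2 M" for g
    proof -
      have ev: "\<forall>\<^sub>F t in at_right 0. (1 / t) *\<^sub>R (U t u - u) = (1 / t) *\<^sub>R (emb M (F t (sec M u)) - emb M (sec M u))"
        using at_right_0_pos by eventually_elim (rule eq)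
      have "((\<lambda>t. (1 / t) *\<^sub>R (U t u - u)) \<longlongrightarrow> emb M g) (at_right 0) \<longleftrightarrow>
          ((\<lambda>t. (1 / t) *\<^sub>R (emb M (F t (sec M u)) - emb M (sec M u))) \<longlongrightarrow> emb M g) (at_right 0)"
        by (rule tendsto_cong[OF ev])
      also have "\<dots> \<longleftrightarrow> (sec M u, g) \<in> generator M T"
        using generator_iff[OF sec_L2 g, of "\<lambda>t. F t (sec M u)" "\<lambda>t. emb M (F t (sec M u))" u] FL g
        by (simp add: generator_def F_def)
      also have "\<dots> \<longleftrightarrow> (sec M u, (\<lambda>x. - g x)) \<in> A" by (simp add: gen neg_op_iff)
      also have "\<dots> \<longleftrightarrow> (u, - emb M g) \<in> lift_op M A"
      proof
        assume "(sec M u, \<lambda>x. - g x) \<in> A"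
        moreover have "- emb M g = emb M (\<lambda>x. - g x)" by (simp add: emb_uminus g)
        ultimately show "(u, - emb M g) \<in> lift_op M A" unfolding lift_op_def fproj_apply by blast
      next
        assume "(u, - emb M g) \<in> lift_op M A"
        from lift_op_fproj[OF lin this] have "(emb M (sec M u), emb M (\<lambda>x. - g x)) \<in> lift_op M A"
          using g by (simp add: fproj_apply[of M u] emb_uminus blinfun.minus_right)
        then show "(sec M u, \<lambda>x. - g x) \<in> A" using emb_mem_lift_op[OF lin sec_L2 L2_uminus[OF g]] by blast
      qed
      finally show ?thesis .
    qed
    show "((\<lambda>t. (1 / t) *\<^sub>R (U t u - u)) \<longlongrightarrow> v) (at_right 0) \<longleftrightarrow> (u, - v) \<in> lift_op M A"
    proof (cases "fproj M v = v")
      case True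
      then show ?thesis using key[OF sec_L2, of v] by (simp add: fproj_apply)
    next
      case False
      \<comment> \<open>The difference quotients of U lie in the copy of L2 over M, which is closed,
        so no limit lies outside it; nor does any value of the lifted graph.\<close>
      have "\<not> ((\<lambda>t. (1 / t) *\<^sub>R (U t u - u)) \<longlongrightarrow> v) (at_right 0)"
      proof
        assume lim: "((\<lambda>t. (1 / t) *\<^sub>R (U t u - u)) \<longlongrightarrow> v) (at_right 0)"
        then have lim2: "((\<lambda>t. fproj M ((1 / t) *\<^sub>R (U t u - u))) \<longlongrightarrow> fproj M v) (at_right 0)"
          by (intro tendsto_intros)
        have "\<forall>\<^sub>F t in at_right 0. fproj M ((1 / t) *\<^sub>R (U t u - u)) = (1 / t) *\<^sub>R (U t u - u)"
          using at_right_0_pos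
        proof eventually_elim
          fix t :: real assume t: "0 < t"
          then have "F t (sec M u) \<in> L2 M" by (intro FL sec_L2) simp
          then show "fproj M ((1 / t) *\<^sub>R (U t u - u)) = (1 / t) *\<^sub>R (U t u - u)"
            unfolding eq[OF t] by (simp add: blinfun.scaleR_right blinfun.diff_right)
        qed
        from Lim_transform_eventually[OF lim2 this] have "fproj M v = v"
          using lim by (intro tendsto_unique[of "at_right (0::real)"]) auto
        with False show False by simp
      qed
      moreover have "(u, - v) \<notin> lift_op M A"
      proof
        assume "(u, - v) \<in> lift_op M A"
        then obtain f g where fg: "(f, g) \<in> A" "- v = emb M g" by (auto simp: lift_op_def)
        then have "fproj M (- v) = - v" using lin_operator_L2[OF lin fg(1)] by simp
        then show False using False by (simp add: blinfun.minus_right)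
      qed
      ultimately show ?thesis by simp
    qed
  qed
  then have Us: "U t = sgr t"
    using c0_gen_unique[OF psa_lift _ c0_gen_lift sgr_sym t] by blast
  show ?thesis
  proof (intro equalityI subrelI)
    fix f g assume fg: "(f, g) \<in> T t"
    then have L: "f \<in> L2 M" "g \<in> L2 M" using lin_operator_L2[OF linT[OF t]] by blast+
    have "emb M (F t f) = emb M g" by (rule Feq[OF t fg L(1) refl])
    then show "(f, g) \<in> heat_op t" using L U_emb[OF t L(1)] Us by (simp add: heat_op_def)
  next
    fix f g assume "(f, g) \<in> heat_op t"
    then have L: "f \<in> L2 M" "g \<in> L2 M" "emb M g = sgr t (emb M f)" by (auto simp: heat_op_def)
    have "emb M (F t f) = emb M g" using L U_emb[OF t L(1)] Us by simp
    then show "(f, g) \<in> T t"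
      using L by (intro lin_operator_cong[OF linT[OF t] F[OF t L(1)]]) auto
  qed
qed

lemma exp_neg_op_eq:
  assumes t: "0 \<le> t"
  shows "exp_neg_op M t A = heat_op t"
  unfolding exp_neg_op_def
proof (rule the_equality)
  show "\<exists>T. C0_semigroup M T \<and> generator M T = neg_op A \<and> heat_op t = T t"
    using C0_semigroup_heat_op generator_heat_op by blast
qed (use C0_semigroup_unique[OF _ _ t] in blast)

end

section \<open>Integral estimates\<close>

lemma borel_measurable_antimono_ennreal:
  fixes f :: "real \<Rightarrow> ennreal"
  assumes "\<And>s t. s \<le> t \<Longrightarrow> f t \<le> f s"
  shows "f \<in> borel_measurable borel"
proof (rule borel_measurableI_greater)
  fix y
  have "is_interval {x. y < f x}"
    unfolding is_interval_1 using assms by (auto intro: less_le_trans)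
  then show "{x \<in> space borel. y < f x} \<in> sets borel"
    by (simp add: real_interval_borel_measurable)
qed

text \<open>With c = y and a the inverse of M at y, the right-hand side is N(y).\<close>

lemma nn_integral_inverse_square:
  assumes "0 < a" "0 \<le> c"
  shows "(\<integral>\<^sup>+s. ennreal (c / s\<^sup>2) * indicator {a..} s \<partial>lborel) = ennreal (c / a)"
proof -
  have "(\<integral>\<^sup>+s. ennreal (c / s\<^sup>2) * indicator {a..} s \<partial>lborel) = ennreal (0 - (- c / a))"
  proof (rule nn_integral_FTC_atLeast)
    show "((\<lambda>s. - c / s) has_real_derivative c / s\<^sup>2) (at s)" if "a \<le> s" for s
      using that assms by (auto intro!: derivative_eq_intros simp: power2_eq_square)
    show "((\<lambda>s. - c / s) \<longlongrightarrow> 0) at_top" by real_asymp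
  qed (use assms in auto)
  then show ?thesis by simp
qed

text \<open>
  Telescoping: with \<open>p(s) = \<eta>(s) / s\<^sup>2\<close> the integrand is \<open>p(s/2)/2 - p(s)\<close>, and the integral of
  \<open>p(s/2)/2\<close> over \<open>[\<epsilon>, \<infinity>)\<close> is that of \<open>p\<close> over \<open>[\<epsilon>/2, \<infinity>)\<close>.
\<close>

lemma nn_integral_dilation_difference:
  fixes \<eta> :: "real \<Rightarrow> real"
  assumes mono: "mono \<eta>" and nonneg: "\<And>s. 0 \<le> \<eta> s" and lin: "\<And>s. 0 \<le> s \<Longrightarrow> \<eta> s \<le> s"
    and bdd: "\<And>s. \<eta> s \<le> K" and pos: "\<And>s. 0 < s \<Longrightarrow> \<eta> s \<le> 2 * \<eta> (s / 2)"
  shows "(\<integral>\<^sup>+s. ennreal ((2 * \<eta> (s / 2) - \<eta> s) / s\<^sup>2) * indicator {0<..} s \<partial>lborel) \<le> ennreal (ln 2)"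
proof -
  have [measurable]: "\<eta> \<in> borel_measurable borel" using mono by (rule borel_measurable_mono)
  define p where "p s = \<eta> s / s\<^sup>2" for s
  define q where "q s = (2 * \<eta> (s / 2) - \<eta> s) / s\<^sup>2" for s
  have [measurable]: "p \<in> borel_measurable borel" "q \<in> borel_measurable borel"
    unfolding p_def q_def by measurable
  have p0: "0 \<le> p s" for s using nonneg by (simp add: p_def)
  have q0: "0 \<le> q s" if "0 < s" for s using pos[OF that] by (simp add: q_def)
  have qp: "q s + p s = (1 / 2) * p (s / 2)" for s
    by (simp add: p_def q_def power2_eq_square add_divide_distrib[symmetric])
  have h0: "0 \<le> (1 / 2 :: real)" by simp
  have K: "0 \<le> K" using nonneg[of 0] bdd[of 0] by linarith
  have eps: "(\<integral>\<^sup>+s. ennreal (q s) * indicator {e..} s \<partial>lborel) \<le> ennreal (ln 2)" if e: "0 < e" for e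
  proof -
    let ?P = "\<integral>\<^sup>+s. ennreal (p s) * indicator {e..} s \<partial>lborel"
    let ?Q = "\<integral>\<^sup>+s. ennreal (q s) * indicator {e..} s \<partial>lborel"
    let ?D = "\<integral>\<^sup>+s. ennreal (p s) * indicator {e/2..<e} s \<partial>lborel"
    have "?P \<le> (\<integral>\<^sup>+s. ennreal (K / s\<^sup>2) * indicator {e..} s \<partial>lborel)"
      using bdd by (intro nn_integral_mono mult_right_mono ennreal_leI) (auto simp: p_def divide_right_mono)
    also have "\<dots> = ennreal (K / e)" by (rule nn_integral_inverse_square[OF e K])
    finally have Pfin: "?P < \<top>" by (simp add: le_less_trans)
    \<comment> \<open>Adding \<open>?P\<close> makes the telescoping an identity between integrals
      of nonnegative functions; its finiteness allows the cancellation afterwards.\<close>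
    have "?Q + ?P = (\<integral>\<^sup>+s. ennreal (q s) * indicator {e..} s + ennreal (p s) * indicator {e..} s \<partial>lborel)"
      by (rule nn_integral_add[symmetric]) measurable
    also have "\<dots> = (\<integral>\<^sup>+s. ennreal (1 / 2) * (ennreal (p (s / 2)) * indicator {e / 2..} (s / 2)) \<partial>lborel)"
    proof (rule nn_integral_cong)
      fix s :: real
      show "ennreal (q s) * indicator {e..} s + ennreal (p s) * indicator {e..} s
          = ennreal (1 / 2) * (ennreal (p (s / 2)) * indicator {e / 2..} (s / 2))"
      proof (cases "e \<le> s")
        case True
        then have "0 < s" using e by simp
        then have "ennreal (q s) + ennreal (p s) = ennreal (1 / 2) * ennreal (p (s / 2))"
          by (metis (full_types) ennreal_mult ennreal_plus h0 p0 q0 qp)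
        then show ?thesis using True by simp
      qed simp
    qed
    also have "\<dots> = ennreal (1 / 2) * (\<integral>\<^sup>+s. ennreal (p (0 + (1 / 2) * s)) * indicator {e / 2..} (0 + (1 / 2) * s) \<partial>lborel)"
      by (subst nn_integral_cmult) auto
    also have "\<dots> = (\<integral>\<^sup>+s. ennreal (p s) * indicator {e / 2..} s \<partial>lborel)"
      using nn_integral_real_affine[of "\<lambda>s. ennreal (p s) * indicator {e / 2..} s" "1 / 2" 0] by simp
    also have "\<dots> = (\<integral>\<^sup>+s. ennreal (p s) * indicator {e/2..<e} s + ennreal (p s) * indicator {e..} s \<partial>lborel)"
      using e by (intro nn_integral_cong) (auto simp: indicator_def)
    also have "\<dots> = ?D + ?P"
      by (rule nn_integral_add) measurable
    finally have "?Q = ?D" using Pfin by (auto simp: ennreal_add_left_cancel add.commute)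
    \<comment> \<open>On the remaining window [e/2, e) the bound \<eta>(s) \<le> s leaves the
      integrand 1/s, and ln e - ln (e/2) is independent of e.\<close>
    also have "\<dots> \<le> (\<integral>\<^sup>+s. ennreal (1 / s) * indicator {e/2..e} s \<partial>lborel)"
    proof (rule nn_integral_mono)
      fix s :: real
      show "ennreal (p s) * indicator {e/2..<e} s \<le> ennreal (1 / s) * indicator {e/2..e} s"
      proof (cases "s \<in> {e/2..<e}")
        case True
        then have s: "0 < s" using e by simp
        have "p s \<le> s / s\<^sup>2" unfolding p_def using lin[of s] s by (intro divide_right_mono) auto
        also have "\<dots> = 1 / s" using s by (simp add: power2_eq_square)
        finally show ?thesis using True by (simp add: ennreal_leI)
      qed simp
    qed
    also have "\<dots> = ennreal (ln e - ln (e / 2))"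
      by (rule nn_integral_FTC_Icc) (use e in \<open>auto intro!: derivative_eq_intros simp: divide_simps\<close>)
    also have "ln e - ln (e / 2) = ln 2" using e by (simp add: ln_div)
    finally show ?thesis .
  qed
  have "(\<integral>\<^sup>+s. ennreal (q s) * indicator {0<..} s \<partial>lborel)
      = (\<integral>\<^sup>+s. (SUP n. ennreal (q s) * indicator {1 / real (Suc n)..} s) \<partial>lborel)"
  proof (rule nn_integral_cong)
    fix s :: real
    show "ennreal (q s) * indicator {0<..} s = (SUP n. ennreal (q s) * indicator {1 / real (Suc n)..} s)"
    proof (cases "0 < s")
      case True
      then obtain n where n: "1 / real (Suc n) < s" using nat_approx_posE by blast
      show ?thesis
      proof (rule antisym)
        show "ennreal (q s) * indicator {0<..} s \<le> (SUP n. ennreal (q s) * indicator {1 / real (Suc n)..} s)"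
          using n True by (intro SUP_upper2[of n]) auto
      qed (use True in \<open>auto intro!: SUP_least simp: indicator_def\<close>)
    next
      case False
      have "s \<notin> {1 / real (Suc n)..}" for n
      proof -
        have "0 < 1 / real (Suc n)" by simp
        then show ?thesis using False by (simp only: atLeast_iff)
      qed
      then show ?thesis using False by simp
    qed
  qed
  also have "\<dots> = (SUP n. \<integral>\<^sup>+s. ennreal (q s) * indicator {1 / real (Suc n)..} s \<partial>lborel)"
  proof (rule nn_integral_monotone_convergence_SUP)
    show "incseq (\<lambda>n s. ennreal (q s) * indicator {1 / real (Suc n)..} s)"
    proof (rule incseq_SucI, rule le_funI)
      fix n and s :: real
      have "1 / real (Suc (Suc n)) \<le> 1 / real (Suc n)" by (intro frac_le) auto
      then show "ennreal (q s) * indicator {1 / real (Suc n)..} s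
          \<le> ennreal (q s) * indicator {1 / real (Suc (Suc n))..} s"
        by (auto simp: indicator_def)
    qed
  qed measurable
  also have "\<dots> \<le> ennreal (ln 2)" by (intro SUP_least eps) simp
  finally show ?thesis by (simp add: q_def)
qed

text \<open>Right endpoints give a lower sum for a decreasing function. \<open>L\<close> stands for
  \<open>heat_L\<close>, about whose measurability nothing has been established: additivity is
  applied to the monotone minorant f, and \<open>L\<close> enters only through monotonicity of the
  integral.\<close>

lemma antimono_sum_le_nn_integral:
  fixes \<phi> :: "real \<Rightarrow> real"
  assumes anti: "\<And>s t. 0 \<le> s \<Longrightarrow> s \<le> t \<Longrightarrow> \<phi> t \<le> \<phi> s" and nonneg: "\<And>s. 0 \<le> s \<Longrightarrow> 0 \<le> \<phi> s"
    and a: "0 \<le> a" and d: "0 \<le> d"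
    and L: "\<And>s. a < s \<Longrightarrow> ennreal (\<phi> s) \<le> L s"
  shows "ennreal (d * (\<Sum>i<n. \<phi> (a + real (Suc i) * d))) \<le> (\<integral>\<^sup>+s. L s * indicator {a<..} s \<partial>lborel)"
proof -
  \<comment> \<open>The maximum with 0 extends the monotonicity to the whole line, from which
    measurability follows.\<close>
  define f where "f s = ennreal (\<phi> (max 0 s))" for s
  have [measurable]: "f \<in> borel_measurable borel"
    unfolding f_def by (rule borel_measurable_antimono_ennreal) (auto intro!: ennreal_leI anti)
  have "ennreal (d * (\<Sum>i<n. \<phi> (a + real (Suc i) * d)))
      \<le> (\<integral>\<^sup>+s. f s * indicator {a<..a + real n * d} s \<partial>lborel)"
  proof (induction n)
    case (Suc n)
    define b c where "b = a + real n * d" and "c = a + real (Suc n) * d"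
    have abc: "a \<le> b" "b \<le> c" "c - b = d" using d by (auto simp: b_def c_def algebra_simps)
    have c0: "0 \<le> c" using a abc by simp
    have "ennreal (d * \<phi> c) = (\<integral>\<^sup>+s. ennreal (\<phi> c) * indicator {b<..c} s \<partial>lborel)"
      using abc nonneg[OF c0] d by (subst nn_integral_cmult_indicator) (auto simp: ennreal_mult mult.commute)
    also have "\<dots> \<le> (\<integral>\<^sup>+s. f s * indicator {b<..c} s \<partial>lborel)"
    proof (rule nn_integral_mono)
      fix s :: real
      show "ennreal (\<phi> c) * indicator {b<..c} s \<le> f s * indicator {b<..c} s"
        using abc a by (cases "s \<in> {b<..c}") (auto simp: f_def intro!: ennreal_leI anti)
    qed
    finally have 1: "ennreal (d * \<phi> c) \<le> (\<integral>\<^sup>+s. f s * indicator {b<..c} s \<partial>lborel)" .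
    have S0: "0 \<le> d * (\<Sum>i<n. \<phi> (a + real (Suc i) * d))"
      using a d by (intro mult_nonneg_nonneg sum_nonneg nonneg) auto
    have "d * (\<Sum>i<Suc n. \<phi> (a + real (Suc i) * d)) = d * (\<Sum>i<n. \<phi> (a + real (Suc i) * d)) + d * \<phi> c"
      by (simp add: c_def distrib_left)
    then have "ennreal (d * (\<Sum>i<Suc n. \<phi> (a + real (Suc i) * d)))
        = ennreal (d * (\<Sum>i<n. \<phi> (a + real (Suc i) * d))) + ennreal (d * \<phi> c)"
      using S0 d nonneg[OF c0] by (simp add: ennreal_plus)
    also have "\<dots> \<le> (\<integral>\<^sup>+s. f s * indicator {a<..b} s \<partial>lborel) + (\<integral>\<^sup>+s. f s * indicator {b<..c} s \<partial>lborel)"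
      using Suc 1 unfolding b_def by (intro add_mono)
    also have "\<dots> = (\<integral>\<^sup>+s. f s * indicator {a<..b} s + f s * indicator {b<..c} s \<partial>lborel)"
      by (rule nn_integral_add[symmetric]) measurable
    also have "\<dots> = (\<integral>\<^sup>+s. f s * indicator {a<..c} s \<partial>lborel)"
      using abc by (intro nn_integral_cong) (auto simp: indicator_def)
    finally show ?case by (simp only: c_def)
  qed simp
  also have "\<dots> \<le> (\<integral>\<^sup>+s. L s * indicator {a<..} s \<partial>lborel)"
    using L a by (intro nn_integral_mono) (auto simp: indicator_def f_def max_def)
  finally show ?thesis .
qed

text \<open>Duality of L1 and L-infinity. If |w| exceeded some c > C on a set S of positive measure,
  the phase of w on S, divided by the measure of S, would be an admissible g that pairs with w to at
  least c.\<close>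

lemma AE_cmod_le_of_weak_bound:
  assumes w: "w \<in> L2 M" and C: "0 \<le> C"
    and weak: "\<And>g. g \<in> L2 M \<Longrightarrow> integrable M g \<Longrightarrow> (LINT x|M. cmod (g x)) \<le> 1 \<Longrightarrow> (LINT x|M. w x \<bullet> g x) \<le> C"
  shows "AE x in M. cmod (w x) \<le> C"
proof -
  have [measurable]: "w \<in> borel_measurable M" using w by (simp add: L2_def)
  have step: "AE x in M. cmod (w x) \<le> c" if c: "C < c" for c
  proof -
    define S where "S = {x \<in> space M. c < cmod (w x)}"
    have [measurable]: "S \<in> sets M" unfolding S_def by measurable
    have c0: "0 < c" using C c by simp
    \<comment> \<open>Chebyshev's inequality: w is square-integrable and c > 0.\<close>
    have "emeasure M S < \<infinity>"
    proof -
      have "(\<integral>\<^sup>+x. ennreal ((cmod (w x))\<^sup>2) \<partial>M) < \<infinity>"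
        using w by (simp add: L2_def integrable_iff_bounded)
      moreover have "ennreal (c\<^sup>2) * emeasure M S \<le> (\<integral>\<^sup>+x. ennreal ((cmod (w x))\<^sup>2) \<partial>M)"
      proof -
        have "ennreal (c\<^sup>2) * emeasure M S = (\<integral>\<^sup>+x. ennreal (c\<^sup>2) * indicator S x \<partial>M)"
          by (simp add: nn_integral_cmult_indicator)
        also have "\<dots> \<le> (\<integral>\<^sup>+x. ennreal ((cmod (w x))\<^sup>2) \<partial>M)"
          using c0 by (intro nn_integral_mono) (auto simp: S_def indicator_def intro!: ennreal_leI power_mono)
        finally show ?thesis .
      qed
      ultimately have "ennreal (c\<^sup>2) * emeasure M S < \<infinity>" by (rule le_less_trans[rotated])
      then show ?thesis using c0 by (auto simp: ennreal_mult_less_top)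
    qed
    then have fin: "emeasure M S \<noteq> \<infinity>" by simp
    have "measure M S = 0"
    proof (rule ccontr)
      assume "measure M S \<noteq> 0"
      then have m: "0 < measure M S" by (simp add: zero_less_measure_iff)
      define g where "g x = complex_of_real (indicator S x / (measure M S * cmod (w x))) * w x" for x
      have [measurable]: "g \<in> borel_measurable M" unfolding g_def by measurable
      have norm_g: "cmod (g x) = indicator S x / measure M S" for x
        using c0 m by (auto simp: g_def S_def norm_mult norm_divide indicator_def)
      have int_ind: "integrable M (indicator S :: _ \<Rightarrow> real)"
        using fin by (simp add: integrable_indicator_iff less_top)
      then have "integrable M (\<lambda>x. cmod (g x))" unfolding norm_g by simp
      then have gi: "integrable M g" by (simp add: integrable_norm_iff)
      have "(\<lambda>x. (cmod (g x))\<^sup>2) = (\<lambda>x. (1 / (measure M S)\<^sup>2) * indicator S x)"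
        unfolding norm_g by (auto simp: fun_eq_iff indicator_def power_divide)
      then have gL: "g \<in> L2 M" using int_ind by (simp add: L2_def)
      have "(LINT x|M. cmod (g x)) = 1" unfolding norm_g using m fin by simp
      then have "(LINT x|M. w x \<bullet> g x) \<le> C" by (intro weak gL gi) simp
      moreover have "c \<le> (LINT x|M. w x \<bullet> g x)"
      proof -
        have "c = (LINT x|M. (c / measure M S) * indicator S x)" using m by simp
        also have "\<dots> \<le> (LINT x|M. w x \<bullet> g x)"
        proof (rule integral_mono)
          show "integrable M (\<lambda>x. c / measure M S * indicator S x)" using int_ind by simp
          show "integrable M (\<lambda>x. w x \<bullet> g x)" by (rule L2_integrable_inner[OF w gL])
          fix x assume "x \<in> space M"
          have "w x \<bullet> g x = indicator S x / (measure M S * cmod (w x)) * (w x \<bullet> w x)"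
            unfolding g_def by (simp only: scaleR_conv_of_real[symmetric] inner_scaleR_right)
          also have "w x \<bullet> w x = cmod (w x) * cmod (w x)" by (simp add: dot_square_norm power2_eq_square)
          finally have "w x \<bullet> g x = indicator S x * cmod (w x) / measure M S" by simp
          then show "c / measure M S * indicator S x \<le> w x \<bullet> g x"
            using m by (auto simp: S_def indicator_def divide_right_mono)
        qed
        finally show ?thesis .
      qed
      ultimately show False using c by simp
    qed
    then have "emeasure M S = 0" using fin by (simp add: emeasure_eq_ennreal_measure)
    then have "S \<in> null_sets M" by (simp add: null_sets_def)
    then show ?thesis by (rule AE_I') (auto simp: S_def)
  qed
  have "AE x in M. \<forall>n. cmod (w x) \<le> C + 1 / real (Suc n)"
    unfolding AE_all_countable by (intro allI step) simp
  then show ?thesis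
  proof eventually_elim
    fix x assume *: "\<forall>n. cmod (w x) \<le> C + 1 / real (Suc n)"
    have "(\<lambda>n. C + 1 / real (Suc n)) \<longlonglongrightarrow> C" by real_asymp
    then show "cmod (w x) \<le> C" using * by (intro LIMSEQ_le_const) auto
  qed
qed

text \<open>The form at x + s y is a quadratic polynomial in s without negative values. X may have a
  kernel, so the leading coefficient c can vanish; the polynomial is then affine, and b = 0.\<close>

lemma positive_form_Cauchy_Schwarz:
  fixes X :: "'h::real_inner \<Rightarrow>\<^sub>L 'h"
  assumes sym: "\<And>x y. X x \<bullet> y = x \<bullet> X y" and nonneg: "\<And>x. 0 \<le> X x \<bullet> x"
  shows "(X x \<bullet> y)\<^sup>2 \<le> (X x \<bullet> x) * (X y \<bullet> y)"
proof -
  define a b c where "a = X x \<bullet> x" and "b = X x \<bullet> y" and "c = X y \<bullet> y"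
  have q: "0 \<le> a + 2 * s * b + s\<^sup>2 * c" for s
  proof -
    have "X (x + s *\<^sub>R y) \<bullet> (x + s *\<^sub>R y) = a + s * b + (s * (X y \<bullet> x) + s\<^sup>2 * c)"
      by (simp add: blinfun.add_right blinfun.scaleR_right inner_add_left inner_add_right
          a_def b_def c_def power2_eq_square algebra_simps)
    moreover have "X y \<bullet> x = b" using sym[of y x] by (simp add: b_def inner_commute)
    ultimately have "X (x + s *\<^sub>R y) \<bullet> (x + s *\<^sub>R y) = a + 2 * s * b + s\<^sup>2 * c" by simp
    with nonneg[of "x + s *\<^sub>R y"] show ?thesis by simp
  qed
  have "b\<^sup>2 \<le> a * c"
  proof (cases "c = 0")
    case True
    have "b = 0"
    proof (rule ccontr)
      assume b: "b \<noteq> 0"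
      \<comment> \<open>At this s the affine polynomial a + 2 s b takes the value -1.\<close>
      have "0 \<le> a + 2 * (- (a + 1) / (2 * b)) * b" using q[of "- (a + 1) / (2 * b)"] True by simp
      also have "\<dots> = -1" using b by (simp add: field_simps)
      finally show False by simp
    qed
    then show ?thesis using True by simp
  next
    case False
    have c: "0 < c" using nonneg[of y] False by (simp add: c_def)
    have "0 \<le> a + 2 * (- b / c) * b + (- b / c)\<^sup>2 * c" by (rule q)
    also have "\<dots> = a - b\<^sup>2 / c" using False by (simp add: power2_eq_square field_simps)
    finally have "b\<^sup>2 / c \<le> a" by simp
    then show ?thesis using c by (simp add: divide_le_eq)
  qed
  then show ?thesis by (simp add: a_def b_def c_def)
qed

section \<open>Heat kernel bounds\<close>

lemma imul_inner_left: "imul u \<bullet> v = - (u \<bullet> imul v)"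
  using imul_inner[of u "imul v"] by (simp add: imul_imul inner_minus_right)

lemma AE_cmod_of_esssup:
  assumes "esssup M (\<lambda>x. ennreal (cmod (w x))) \<le> ennreal l" "0 \<le> l"
  shows "AE x in M. cmod (w x) \<le> l"
  using esssup_AE[of "\<lambda>x. ennreal (cmod (w x))" M]
proof eventually_elim
  fix x assume "ennreal (cmod (w x)) \<le> esssup M (\<lambda>x. ennreal (cmod (w x)))"
  then have "ennreal (cmod (w x)) \<le> ennreal l" using assms(1) by (rule order_trans)
  then show "cmod (w x) \<le> l" using assms(2) by simp
qed

section \<open>The heat flow on the complement of the kernel\<close>

context psa_operator
begin

definition ker_lift :: "'a hil set" where
  "ker_lift = {k. (k, 0) \<in> lift_op M A}"

text \<open>The lifted kernel contains the complement of the copy of L2 over M, so this space lies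
  inside the copy (\<open>V_lift_fproj\<close>).\<close>

definition V_lift :: "'a hil set" where
  "V_lift = {u. \<forall>k\<in>ker_lift. u \<bullet> k = 0}"

lemma ker_lift_imul: "k \<in> ker_lift \<Longrightarrow> imul k \<in> ker_lift"
proof -
  assume "k \<in> ker_lift"
  then have "(imul k, imul 0) \<in> lift_op M A" unfolding ker_lift_def by (auto intro: lift_op_imul[OF lin])
  moreover have "imul (0 :: 'a hil) = 0" using bounded_linear_imul by (rule linear_simps(3))
  ultimately show ?thesis by (simp add: ker_lift_def)
qed

lemma V_lift_fproj: "u \<in> V_lift \<Longrightarrow> fproj M u = u"
proof -
  assume u: "u \<in> V_lift"
  have "u - fproj M u \<in> ker_lift" by (simp add: ker_lift_def lift_op_compl[OF lin])
  then have 1: "u \<bullet> (u - fproj M u) = 0" using u by (simp add: V_lift_def)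
  have "fproj M u \<bullet> (u - fproj M u) = 0"
    by (simp add: fproj_sym blinfun.diff_right)
  with 1 have "(u - fproj M u) \<bullet> (u - fproj M u) = 0" by (simp only: inner_diff_left)
  then show ?thesis by simp
qed

text \<open>The kernel is stable under i, so real orthogonality to it is already complex
  orthogonality.\<close>

lemma emb_V_lift_iff:
  assumes f: "f \<in> L2 M"
  shows "emb M f \<in> V_lift \<longleftrightarrow> f \<in> V_space M A"
proof
  assume fV: "f \<in> V_space M A"
  have "emb M f \<bullet> k = 0" if "k \<in> ker_lift" for k
  proof -
    obtain h g where *: "(h, g) \<in> A" "fproj M k = emb M h" "0 = emb M g"
      using \<open>k \<in> ker_lift\<close> by (auto simp: ker_lift_def lift_op_def)
    have L: "h \<in> L2 M" "g \<in> L2 M" using lin_operator_L2[OF lin *(1)] by auto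
    have "(h, \<lambda>_. 0) \<in> A" by (rule lin_operator_cong[OF lin *(1) L(1)]) (use *(3) in auto)
    then have "L2_inner M f h = 0" using fV by (simp add: V_space_def orth_compl_def ker_op_def)
    then have "emb M f \<bullet> emb M h = 0" using f L by (simp add: inner_emb_emb)
    then show ?thesis using f * fproj_sym[of M "emb M f" k] by simp
  qed
  then show "emb M f \<in> V_lift" by (simp add: V_lift_def)
next
  assume V: "emb M f \<in> V_lift"
  have "L2_inner M f h = 0" if "h \<in> ker_op A" for h
  proof -
    have hA: "(h, \<lambda>_. 0) \<in> A" using that by (simp add: ker_op_def)
    then have h: "h \<in> L2 M" using lin_operator_L2[OF lin] by blast
    have "(emb M h, 0) \<in> lift_op M A" using emb_mem_lift_op[OF lin h L2_zero] hA by simp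
    then have k: "emb M h \<in> ker_lift" by (simp add: ker_lift_def)
    have "Re (L2_inner M f h) = 0" using V k f h by (simp add: V_lift_def inner_emb_emb[symmetric])
    moreover have "Im (L2_inner M f h) = 0"
      using V ker_lift_imul[OF k] f h by (simp add: V_lift_def Im_L2_inner imul_inner_left)
    ultimately show ?thesis by (simp add: complex_eq_iff)
  qed
  then show "f \<in> V_space M A" using f by (simp add: V_space_def orth_compl_def)
qed

lemma sgr_diff_sgr_nonneg:
  assumes "0 \<le> t"
  shows "0 \<le> (u - sgr t u) \<bullet> u"
proof -
  have "sgr t u \<bullet> u \<le> norm (sgr t u) * norm u" by (rule norm_cauchy_schwarz)
  also have "\<dots> \<le> (1 * norm u) * norm u"
    by (intro mult_right_mono norm_blinfun_le norm_sgr_le assms) simp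
  finally show ?thesis by (simp add: inner_diff_left dot_square_norm power2_eq_square)
qed

lemma sgr_sgr: "0 \<le> s \<Longrightarrow> 0 \<le> t \<Longrightarrow> sgr s (sgr t u) = sgr (s + t) u"
  by (simp add: sgr_add)

lemma sgr_inner_split: "0 \<le> s \<Longrightarrow> 0 \<le> t \<Longrightarrow> sgr s u \<bullet> sgr t v = sgr (s + t) u \<bullet> v"
  by (simp add: sgr_sym[of t "sgr s u" v, symmetric] sgr_sgr add.commute)

lemma norm_sgr_diff:
  assumes "0 \<le> t"
  shows "(norm (u - sgr t u))\<^sup>2 = 2 * ((u - sgr t u) \<bullet> u) - (u - sgr (2 * t) u) \<bullet> u"
proof -
  have "sgr t u \<bullet> sgr t u = sgr (2 * t) u \<bullet> u" using sgr_inner_split[OF assms assms] by simp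
  then show ?thesis
    by (simp add: power2_norm_eq_inner inner_diff_left inner_diff_right inner_commute[of u "sgr t u"])
qed

text \<open>Splitting off T_(s/2) on either side leaves T_(t-s) in the middle, which is at most
  1.\<close>

lemma sgr_inner_antimono:
  assumes "0 \<le> s" "s \<le> t"
  shows "sgr t u \<bullet> u \<le> sgr s u \<bullet> u"
proof -
  have s2: "0 \<le> s / 2" and ts: "0 \<le> t - s" using assms by auto
  have "sgr (t - s) (sgr (s / 2) u) \<bullet> sgr (s / 2) u = sgr t u \<bullet> u"
    unfolding sgr_sgr[OF ts s2] using ts s2 by (subst sgr_inner_split) auto
  moreover have "sgr (s / 2) u \<bullet> sgr (s / 2) u = sgr s u \<bullet> u"
    by (subst sgr_inner_split[OF s2 s2]) simp
  ultimately show ?thesis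
    using sgr_diff_sgr_nonneg[OF ts, of "sgr (s / 2) u"] by (simp add: inner_diff_left)
qed

lemma ker_lift_sqrt_graph:
  assumes "k \<in> ker_lift"
  shows "(k, 0) \<in> sqrt_graph"
proof -
  have "(k, 0) \<in> sqrt_graph O sqrt_graph" using assms by (simp add: ker_lift_def sqrt_graph_comp Res(2))
  then obtain w where w: "(k, w) \<in> sqrt_graph" "(w, 0) \<in> sqrt_graph" by blast
  have "w \<bullet> w = 0" using psa_sym[OF psa_sqrt w(2,1)] by simp
  then show ?thesis using w(1) by simp
qed

text \<open>A kernel vector has energy 0, hence <k - T_t k, k> \<le> 0; the formula for the squared
  norm of k - T_t k then makes it 0.\<close>

lemma sgr_ker_lift:
  assumes k: "k \<in> ker_lift" and t: "0 \<le> t"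
  shows "sgr t k = k"
proof -
  have "(k - sgr t k) \<bullet> k \<le> 0"
    using sgr_sqrt_graph[OF ker_lift_sqrt_graph[OF k] t] by simp
  moreover have "0 \<le> (k - sgr (2 * t) k) \<bullet> k" using t by (intro sgr_diff_sgr_nonneg) simp
  ultimately have "(norm (k - sgr t k))\<^sup>2 \<le> 0" unfolding norm_sgr_diff[OF t] by linarith
  then show ?thesis by simp
qed

lemma sgr_V_lift: "u \<in> V_lift \<Longrightarrow> 0 \<le> t \<Longrightarrow> sgr t u \<in> V_lift"
  unfolding V_lift_def by (auto simp: sgr_sym sgr_ker_lift)

lemma V_lift_projection:
  obtains v where "v \<in> V_lift" "u - v \<in> ker_lift"
proof -
  have sub: "subspace (lift_op M A)" using psa_lift by (simp add: psa_def)
  have "subspace ker_lift"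
  proof (rule subspaceI)
    show "0 \<in> ker_lift" using subspace_0[OF sub] by (simp add: ker_lift_def zero_prod_def)
    show "x + y \<in> ker_lift" if "x \<in> ker_lift" "y \<in> ker_lift" for x y
      using subspace_add[OF sub, of "(x, 0)" "(y, 0)"] that by (simp add: ker_lift_def)
    show "c *\<^sub>R x \<in> ker_lift" if "x \<in> ker_lift" for c x
      using subspace_scale[OF sub, of "(x, 0)" c] that by (simp add: ker_lift_def)
  qed
  moreover have "closed ker_lift"
  proof -
    have "closed ((\<lambda>k. (k, 0)) -` lift_op M A)"
      by (intro closed_vimage psa_closed psa_lift continuous_intros)
    also have "(\<lambda>k. (k, 0)) -` lift_op M A = ker_lift" by (auto simp: ker_lift_def)
    finally show ?thesis .
  qed
  ultimately obtain k where k: "k \<in> ker_lift" "\<And>w. w \<in> ker_lift \<Longrightarrow> (u - k) \<bullet> w = 0"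
    using closed_subspace_projection[of ker_lift u] by blast
  show thesis by (rule that[of "u - k"]) (use k in \<open>auto simp: V_lift_def\<close>)
qed

text \<open>Here v is the projection of g to V. As T_s v stays in V, <T_s v, v> = <T_s v, g>, which
  is at most the essential supremum of |T_s v| times the L1 norm of g.\<close>

lemma heat_L_bound:
  assumes g: "g \<in> L2 M" "integrable M g" "(LINT x|M. cmod (g x)) \<le> 1"
    and v: "v \<in> V_lift" "emb M g - v \<in> ker_lift" and s: "0 \<le> s"
  shows "ennreal (sgr s v \<bullet> v) \<le> heat_L M A s"
proof (cases "heat_L M A s = \<infinity>")
  case False
  then obtain l where l: "heat_L M A s = ennreal l" "0 \<le> l" by (cases "heat_L M A s") auto
  define w where "w = sec M (sgr s v)"
  have wV: "sgr s v \<in> V_lift" by (rule sgr_V_lift[OF v(1) s])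
  have ew: "emb M w = sgr s v" using V_lift_fproj[OF wV] by (simp add: w_def fproj_apply)
  have ev: "emb M (sec M v) = v" using V_lift_fproj[OF v(1)] by (simp add: fproj_apply)
  have "sec M v \<in> V_space M A" using emb_V_lift_iff[OF sec_L2, of v] v(1) ev by simp
  moreover have "(\<lambda>x. g x - sec M v x) \<in> orth_compl M (V_space M A)"
    unfolding orth_compl_def
  proof (intro CollectI conjI ballI)
    show d: "(\<lambda>x. g x - sec M v x) \<in> L2 M" by (intro L2_diff g sec_L2)
    fix h assume hV: "h \<in> V_space M A"
    then have h: "h \<in> L2 M" by (simp add: V_space_def orth_compl_def)
    have hV': "emb M h \<in> V_lift" using emb_V_lift_iff[OF h] hV by simp
    have ed: "emb M (\<lambda>x. g x - sec M v x) = emb M g - v" using g by (simp add: emb_diff ev)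
    have orth: "k \<bullet> emb M h = 0" if "k \<in> ker_lift" for k
      using hV' that inner_commute[of k "emb M h"] by (simp add: V_lift_def)
    have "Re (L2_inner M (\<lambda>x. g x - sec M v x) h) = 0"
      using d h by (simp add: inner_emb_emb[symmetric] ed orth v(2))
    moreover have "Im (L2_inner M (\<lambda>x. g x - sec M v x) h) = 0"
      using d h by (simp add: Im_L2_inner ed orth ker_lift_imul[OF v(2)])
    ultimately show "L2_inner M (\<lambda>x. g x - sec M v x) h = 0" by (simp add: complex_eq_iff)
  qed
  ultimately have "(g, sec M v) \<in> orth_proj M (V_space M A)" using g(1) by (simp add: orth_proj_def)
  moreover have "(sec M v, w) \<in> exp_neg_op M s A"
    unfolding exp_neg_op_eq[OF s] heat_op_def using ev ew by (simp add: w_def)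
  ultimately have "(g, w) \<in> orth_proj M (V_space M A) O exp_neg_op M s A" by blast
  then have "esssup M (\<lambda>x. ennreal (cmod (w x))) \<le> heat_L M A s"
    unfolding heat_L_def norm_1_inf_def
    by (intro SUP_upper2[of "(g, w)"]) (use g in auto)
  then have AE: "AE x in M. cmod (w x) \<le> l" unfolding l(1) by (rule AE_cmod_of_esssup) (rule l(2))
  have wL: "w \<in> L2 M" by (simp add: w_def)
  have "sgr s v \<bullet> v = sgr s v \<bullet> emb M g"
    using wV v(2) by (auto simp: V_lift_def inner_diff_right)
  also have "\<dots> = (LINT x|M. w x \<bullet> g x)" unfolding w_def by (rule inner_emb[OF g(1)])
  also have "\<dots> \<le> (LINT x|M. l * cmod (g x))"
  proof (rule integral_mono_AE)
    show "integrable M (\<lambda>x. w x \<bullet> g x)" by (rule L2_integrable_inner[OF wL g(1)])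
    show "integrable M (\<lambda>x. l * cmod (g x))" using g(2) by simp
    show "AE x in M. w x \<bullet> g x \<le> l * cmod (g x)"
      using AE
    proof eventually_elim
      fix x assume "cmod (w x) \<le> l"
      then have "cmod (w x) * cmod (g x) \<le> l * cmod (g x)" by (rule mult_right_mono) simp
      then show "w x \<bullet> g x \<le> l * cmod (g x)" using norm_cauchy_schwarz[of "w x" "g x"] by linarith
    qed
  qed
  also have "\<dots> = l * (LINT x|M. cmod (g x))" by simp
  also have "\<dots> \<le> l * 1" using g(3) l(2) by (rule mult_left_mono)
  finally show ?thesis by (simp add: l ennreal_leI)
qed simp

text \<open>
  Discretisation of \<open>\<langle>f, h\<rangle> = \<integral> \<langle>A e\<^sup>-\<^sup>s\<^sup>A f, h\<rangle> ds\<close> and of the Cauchy--Schwarz inequality for the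
  energy form, which is replaced by the form of \<open>(1 - e\<^sup>-\<^sup>\<delta>\<^sup>A) / \<delta>\<close>.
\<close>

lemma telescoped_Cauchy_Schwarz:
  assumes u: "(u, b) \<in> sqrt_graph" and d: "0 \<le> d"
  shows "(u \<bullet> (h - sgr (real n * d) h))\<^sup>2 \<le> (b \<bullet> b) * (d * (\<Sum>i<n. sgr (real i * d) h \<bullet> h))"
proof -
  \<comment> \<open>d w is the Riemann sum for the integral of T_s h over [0, n d], and (1 - T_d) w
    telescopes.\<close>
  define w where "w = (\<Sum>i<n. sgr (real i * d) h)"
  define X where "X = id_blinfun - sgr d"
  have X: "X x = x - sgr d x" for x by (simp add: X_def blinfun.diff_left)
  have Xw: "X w = h - sgr (real n * d) h"
  proof -
    have "X w = (\<Sum>i<n. sgr (real i * d) h - sgr (real (Suc i) * d) h)"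
      unfolding w_def blinfun.sum_right X
      using d by (intro sum.cong refl) (simp add: sgr_sgr algebra_simps)
    also have "\<dots> = sgr (real 0 * d) h - sgr (real n * d) h"
      by (rule sum_lessThan_telescope')
    finally show ?thesis by simp
  qed
  have symX: "X x \<bullet> y = x \<bullet> X y" for x y
    by (simp add: X inner_diff_left inner_diff_right sgr_sym[OF d])
  have "X w \<bullet> w = (\<Sum>i<n. (h - sgr (real n * d) h) \<bullet> sgr (real i * d) h)"
    unfolding Xw by (simp add: w_def inner_sum_right)
  also have "\<dots> \<le> (\<Sum>i<n. sgr (real i * d) h \<bullet> h)"
  proof (rule sum_mono)
    fix i
    have "0 \<le> sgr (real n * d) h \<bullet> sgr (real i * d) h"
      using d by (subst sgr_inner_split) (auto intro!: sgr_nonneg)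
    then show "(h - sgr (real n * d) h) \<bullet> sgr (real i * d) h \<le> sgr (real i * d) h \<bullet> h"
      by (simp add: inner_diff_left inner_commute[of h "sgr (real i * d) h"])
  qed
  finally have 1: "X w \<bullet> w \<le> (\<Sum>i<n. sgr (real i * d) h \<bullet> h)" .
  have 2: "X u \<bullet> u \<le> d * (b \<bullet> b)" unfolding X by (rule sgr_sqrt_graph[OF u d])
  have nX: "0 \<le> X x \<bullet> x" for x unfolding X by (rule sgr_diff_sgr_nonneg[OF d])
  \<comment> \<open>Cauchy-Schwarz for the form of 1 - T_d. The energy bound for u contributes the
    factor d that completes the Riemann sum.\<close>
  have "(u \<bullet> (h - sgr (real n * d) h))\<^sup>2 = (X w \<bullet> u)\<^sup>2" by (simp only: Xw inner_commute)
  also have "\<dots> \<le> (X w \<bullet> w) * (X u \<bullet> u)" by (rule positive_form_Cauchy_Schwarz[OF symX nX])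
  also have "\<dots> \<le> (\<Sum>i<n. sgr (real i * d) h \<bullet> h) * (d * (b \<bullet> b))"
    using d by (intro mult_mono 1 2 nX sum_nonneg sgr_nonneg) auto
  finally show ?thesis by (simp add: mult_ac)
qed

text \<open>The telescoped inequality in the limit of vanishing mesh and infinite horizon. The
  Riemann sums stay below M(2 t) up to one vanishing term, and the boundary term T_(n d) h tends to
  0 because M(2 t) is finite.\<close>

lemma weak_heat_bound:
  assumes u: "(u, b) \<in> sqrt_graph" "u \<in> V_lift" and t: "0 < t"
    and m: "heat_M M A (2 * t) = ennreal m" "0 \<le> m"
    and g: "g \<in> L2 M" "integrable M g" "(LINT x|M. cmod (g x)) \<le> 1"
  shows "(sgr t u \<bullet> emb M g)\<^sup>2 \<le> (b \<bullet> b) * m"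
proof -
  obtain v where v: "v \<in> V_lift" "emb M g - v \<in> ker_lift" by (rule V_lift_projection)
  define \<phi> where "\<phi> s = sgr s v \<bullet> v" for s
  define h where "h = sgr t v"
  have t0: "0 \<le> t" using t by simp
  have h\<phi>: "sgr s h \<bullet> h = \<phi> (2 * t + s)" if s: "0 \<le> s" for s
  proof -
    have "sgr s h \<bullet> h = sgr (s + t) v \<bullet> sgr t v" using s t0 by (simp add: h_def sgr_sgr)
    also have "\<dots> = \<phi> (2 * t + s)" using s t0 by (subst sgr_inner_split) (auto simp: \<phi>_def algebra_simps)
    finally show ?thesis .
  qed
  have sum_le: "d * (\<Sum>i<n. \<phi> (2 * t + real (Suc i) * d)) \<le> m" if d: "0 \<le> d" for d n
  proof -
    have "ennreal (d * (\<Sum>i<n. \<phi> (2 * t + real (Suc i) * d)))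
        \<le> (\<integral>\<^sup>+s. heat_L M A s * indicator {2 * t<..} s \<partial>lborel)"
    proof (rule antimono_sum_le_nn_integral)
      show "\<phi> s' \<le> \<phi> s" if "0 \<le> s" "s \<le> s'" for s s'
        unfolding \<phi>_def by (rule sgr_inner_antimono[OF that])
      show "0 \<le> \<phi> s" if "0 \<le> s" for s unfolding \<phi>_def by (rule sgr_nonneg[OF that])
      show "ennreal (\<phi> s) \<le> heat_L M A s" if "2 * t < s" for s
        unfolding \<phi>_def using that t by (intro heat_L_bound[OF g v]) simp
    qed (use t d in auto)
    also have "\<dots> = ennreal m" using m(1) by (simp add: heat_M_def)
    finally show ?thesis using m(2) by simp
  qed
  have \<phi>0: "0 \<le> \<phi> s" if "0 \<le> s" for s unfolding \<phi>_def by (rule sgr_nonneg[OF that])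
  have main: "(u \<bullet> (h - sgr (real (Suc k)) h))\<^sup>2 \<le> (b \<bullet> b) * (\<phi> (2 * t) / real (Suc k) + m)" for k
  proof -
    \<comment> \<open>Mesh 1/(k + 1) and (k + 1)^2 nodes: the mesh shrinks while the horizon n d = k
      + 1 grows.\<close>
    define d n where "d = 1 / real (Suc k)" and "n = Suc k * Suc k"
    have d: "0 \<le> d" and nd: "real n * d = real (Suc k)"
      by (simp_all add: d_def n_def del: of_nat_Suc mult_Suc mult_Suc_right)
    obtain n' where n': "n = Suc n'" by (simp add: n_def)
    have "d * (\<Sum>i<n. sgr (real i * d) h \<bullet> h) = d * (\<Sum>i<n. \<phi> (2 * t + real i * d))"
      using d by (simp add: h\<phi>)
    \<comment> \<open>The node i = 0 is split off because \<open>sum_le\<close> uses right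
      endpoints; its weight d makes it vanish in the limit.\<close>
    also have "\<dots> = d * \<phi> (2 * t) + d * (\<Sum>i<n'. \<phi> (2 * t + real (Suc i) * d))"
      unfolding n' sum.lessThan_Suc_shift by (simp add: distrib_left)
    also have "\<dots> \<le> d * \<phi> (2 * t) + m" by (intro add_left_mono sum_le d)
    finally have "d * (\<Sum>i<n. sgr (real i * d) h \<bullet> h) \<le> \<phi> (2 * t) / real (Suc k) + m"
      by (simp add: d_def)
    then have "(b \<bullet> b) * (d * (\<Sum>i<n. sgr (real i * d) h \<bullet> h)) \<le> (b \<bullet> b) * (\<phi> (2 * t) / real (Suc k) + m)"
      by (rule mult_left_mono) simp
    with telescoped_Cauchy_Schwarz[OF u(1) d, of h n] show ?thesis unfolding nd by linarith
  qed
  have decay: "(norm (sgr (real (Suc k)) h))\<^sup>2 \<le> m / real (Suc k)" for k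
  proof -
    have "(norm (sgr (real (Suc k)) h))\<^sup>2 = sgr (real (Suc k) + real (Suc k)) h \<bullet> h"
      unfolding power2_norm_eq_inner by (rule sgr_inner_split) auto
    also have "\<dots> = \<phi> (2 * t + (real (Suc k) + real (Suc k)))" by (rule h\<phi>) simp
    finally have eq: "(norm (sgr (real (Suc k)) h))\<^sup>2 = \<phi> (2 * t + (real (Suc k) + real (Suc k)))" .
    \<comment> \<open>\<phi> decreases, so k + 1 copies of its value at 2 t + 2 (k + 1) lie below a
      Riemann sum of mesh 1.\<close>
    have "real (Suc k) * \<phi> (2 * t + (real (Suc k) + real (Suc k))) = (\<Sum>i<Suc k. \<phi> (2 * t + (real (Suc k) + real (Suc k))))"
      by simp
    also have "\<dots> \<le> (\<Sum>i<Suc k. \<phi> (2 * t + real (Suc i) * 1))"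
      unfolding \<phi>_def using t by (intro sum_mono sgr_inner_antimono) auto
    also have "\<dots> \<le> m" using sum_le[of 1 "Suc k"] by simp
    finally show ?thesis unfolding eq by (simp add: pos_le_divide_eq mult.commute)
  qed
  have "(\<lambda>k. sgr (real (Suc k)) h) \<longlonglongrightarrow> 0"
  proof -
    have "(\<lambda>k. (norm (sgr (real (Suc k)) h))\<^sup>2) \<longlonglongrightarrow> 0"
    proof (rule tendsto_sandwich[of "\<lambda>_. 0" _ _ "\<lambda>k. m / real (Suc k)"])
      show "(\<lambda>k. m / real (Suc k)) \<longlonglongrightarrow> 0" by real_asymp
      show "\<forall>\<^sub>F k in sequentially. (norm (sgr (real (Suc k)) h))\<^sup>2 \<le> m / real (Suc k)"
        by (intro always_eventually allI decay)
    qed (simp_all add: always_eventually)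
    from tendsto_real_sqrt[OF this] show ?thesis by (simp add: tendsto_norm_zero_iff)
  qed
  then have 1: "(\<lambda>k. (u \<bullet> (h - sgr (real (Suc k)) h))\<^sup>2) \<longlonglongrightarrow> (u \<bullet> (h - 0))\<^sup>2"
    by (intro tendsto_intros)
  have 2: "(\<lambda>k. (b \<bullet> b) * (\<phi> (2 * t) / real (Suc k) + m)) \<longlonglongrightarrow> (b \<bullet> b) * m"
    by real_asymp
  have "(u \<bullet> h)\<^sup>2 \<le> (b \<bullet> b) * m"
    using LIMSEQ_le[OF 1 2] main by simp
  moreover have "sgr t u \<bullet> emb M g = u \<bullet> h"
  proof -
    \<comment> \<open>T_t u stays in V, so g may be replaced by its projection v.\<close>
    have "sgr t u \<bullet> (emb M g - v) = 0" using sgr_V_lift[OF u(2) t0] v(2) by (simp add: V_lift_def)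
    then show ?thesis by (simp add: inner_diff_right h_def sgr_sym[OF t0])
  qed
  ultimately show ?thesis by simp
qed

lemma AE_heat_bound:
  assumes u: "(u, b) \<in> sqrt_graph" "u \<in> V_lift" and t: "0 < t"
    and m: "heat_M M A (2 * t) = ennreal m" "0 \<le> m"
  shows "AE x in M. (cmod (sec M (sgr t u) x))\<^sup>2 \<le> (b \<bullet> b) * m"
proof -
  have "AE x in M. cmod (sec M (sgr t u) x) \<le> sqrt ((b \<bullet> b) * m)"
  proof (rule AE_cmod_le_of_weak_bound[OF sec_L2])
    show "0 \<le> sqrt ((b \<bullet> b) * m)" using m by simp
    fix g assume g: "g \<in> L2 M" "integrable M g" "(LINT x|M. cmod (g x)) \<le> 1"
    have "(LINT x|M. sec M (sgr t u) x \<bullet> g x) = sgr t u \<bullet> emb M g"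
      by (rule inner_emb[OF g(1), symmetric])
    also have "\<dots> \<le> sqrt ((b \<bullet> b) * m)" by (rule real_le_rsqrt[OF weak_heat_bound[OF u t m g]])
    finally show "(LINT x|M. sec M (sgr t u) x \<bullet> g x) \<le> sqrt ((b \<bullet> b) * m)" .
  qed
  then show ?thesis
  proof eventually_elim
    fix x assume "cmod (sec M (sgr t u) x) \<le> sqrt ((b \<bullet> b) * m)"
    then have "(cmod (sec M (sgr t u) x))\<^sup>2 \<le> (sqrt ((b \<bullet> b) * m))\<^sup>2" by (rule power_mono) simp
    then show "(cmod (sec M (sgr t u) x))\<^sup>2 \<le> (b \<bullet> b) * m" using m by simp
  qed
qed

section \<open>The functional inequality\<close>

lemma heat_M_antimono: "s \<le> t \<Longrightarrow> heat_M M A t \<le> heat_M M A s"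
  unfolding heat_M_def by (intro nn_integral_mono) (auto simp: indicator_def)

text \<open>N(y) = y/a is the integral of y/s^2 over s > a. The infimum a need not be attained, so
  the bound is first shown with e > a in its place, for which some time t < e has M(t) \<le> y; then
  e decreases to a.\<close>

lemma heat_N_le:
  assumes y: "0 \<le> y"
  shows "heat_N M A (ennreal y) \<le>
    (\<integral>\<^sup>+s. (if 0 < s \<and> heat_M M A s \<le> ennreal y then ennreal (y / s\<^sup>2) else 0) \<partial>lborel)" (is "_ \<le> ?I")
proof (cases "y = 0 \<or> heat_M_inv M A (ennreal y) = \<infinity>")
  case False
  then have y0: "0 < y" using y by simp
  obtain a where a: "heat_M_inv M A (ennreal y) = ennreal a" "0 \<le> a"
    using False by (cases "heat_M_inv M A (ennreal y)") auto
  have lower: "ennreal (y / e) \<le> ?I" if e: "a < e" for e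
  proof -
    have "Inf {ennreal t | t. 0 < t \<and> heat_M M A t \<le> ennreal y} < ennreal e"
      using a e by (simp add: heat_M_inv_def ennreal_lessI)
    then obtain t where t: "0 < t" "heat_M M A t \<le> ennreal y" "ennreal t < ennreal e"
      by (auto simp: Inf_less_iff)
    then have te: "t < e" using e a by (simp add: ennreal_less_iff)
    have "ennreal (y / e) = (\<integral>\<^sup>+s. ennreal (y / s\<^sup>2) * indicator {e..} s \<partial>lborel)"
      using t te y by (intro nn_integral_inverse_square[symmetric]) auto
    also have "\<dots> \<le> ?I"
    proof (rule nn_integral_mono)
      fix s :: real
      show "ennreal (y / s\<^sup>2) * indicator {e..} s \<le> (if 0 < s \<and> heat_M M A s \<le> ennreal y then ennreal (y / s\<^sup>2) else 0)"
      proof (cases "e \<le> s")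
        case True
        then have "0 < s" "heat_M M A s \<le> ennreal y"
          using t te heat_M_antimono[of t s] by (auto intro: order_trans)
        then show ?thesis by (simp add: indicator_def)
      qed simp
    qed
    finally show ?thesis .
  qed
  have N: "heat_N M A (ennreal y) = ennreal y / ennreal a" using y0 a by (simp add: heat_N_def)
  show ?thesis
  proof (cases "?I = \<infinity>")
    case fin: False
    then obtain r where r: "?I = ennreal r" "0 \<le> r" by (cases ?I) auto
    have ye: "y \<le> r * e" if "a < e" for e
    proof -
      have "0 < e" using that a by simp
      moreover have "y / e \<le> r" using lower[OF that] r by simp
      ultimately show ?thesis by (simp add: pos_divide_le_eq)
    qed
    have "y \<le> r * a"
    proof (rule LIMSEQ_le_const)
      show "(\<lambda>n. r * (a + 1 / real (Suc n))) \<longlonglongrightarrow> r * a" by real_asymp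
      show "\<exists>N. \<forall>n\<ge>N. y \<le> r * (a + 1 / real (Suc n))" by (intro exI[of _ 0] allI impI ye) simp
    qed
    \<comment> \<open>For y > 0, a = 0 is compatible only with an infinite integral, where the claim
      is trivial.\<close>
    then have a0: "0 < a" using y0 a by (cases "a = 0") auto
    then have "ennreal y / ennreal a = ennreal (y / a)" using y by (simp add: divide_ennreal)
    also have "\<dots> \<le> ennreal r" using \<open>y \<le> r * a\<close> a0 by (intro ennreal_leI) (simp add: pos_divide_le_eq)
    finally show ?thesis by (simp add: N r)
  qed simp
qed (auto simp: heat_N_def)

lemma heat_sobolev:
  assumes sig: "sigma_finite_measure M"
    and fin: "\<And>t. 0 < t \<Longrightarrow> heat_M M A t < \<infinity>"
    and fV: "f \<in> V_space M A" and f0: "\<not> (AE x in M. f x = 0)" and en: "energy M A f < \<infinity>"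
  shows "(\<integral>\<^sup>+x. heat_N M A (ennreal ((cmod (f x))\<^sup>2) / (4 * energy M A f)) \<partial>M) \<le> ennreal (ln 2)"
proof -
  have f: "f \<in> L2 M" using fV by (simp add: V_space_def orth_compl_def)
  have [measurable]: "f \<in> borel_measurable M" using f by (rule L2_borel)
  define u where "u = emb M f"
  have uV: "u \<in> V_lift" unfolding u_def using emb_V_lift_iff[OF f] fV by simp
  obtain b where b: "(u, b) \<in> sqrt_graph" "energy M A f = ennreal (b \<bullet> b)"
    unfolding u_def by (rule energy_finite[OF f en])
  define E where "E = b \<bullet> b"
  \<comment> \<open>Zero energy puts u in the kernel, which meets V only in 0.\<close>
  have "E \<noteq> 0"
  proof
    assume "E = 0"
    then have "(u, 0) \<in> sqrt_graph" using b(1) by (simp add: E_def)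
    moreover have "(0, 0) \<in> sqrt_graph"
      using psa_sqrt subspace_0[of sqrt_graph] by (simp add: psa_def zero_prod_def)
    ultimately have "(u, 0) \<in> sqrt_graph O sqrt_graph" by blast
    then have "u \<in> ker_lift" by (simp add: ker_lift_def sqrt_graph_comp Res(2))
    then have "u \<bullet> u = 0" using uV by (simp add: V_lift_def)
    then have "emb M f = 0" by (simp add: u_def)
    then show False using f0 emb_eq_0_iff[OF f] by simp
  qed
  then have E: "0 < E" by (simp add: E_def)
  define y where "y x = (cmod (f x))\<^sup>2 / (4 * E)" for x
  have y0: "0 \<le> y x" for x using E by (simp add: y_def)
  have [measurable]: "y \<in> borel_measurable M" unfolding y_def by measurable
  have yeq: "ennreal ((cmod (f x))\<^sup>2) / (4 * energy M A f) = ennreal (y x)" for x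
  proof -
    have "4 * energy M A f = ennreal (4 * E)" using E by (simp add: b(2) E_def[symmetric] ennreal_mult)
    then show ?thesis using E by (simp add: y_def divide_ennreal)
  qed
  \<comment> \<open>Measurability of M, obtained from its monotonicity, gives the joint
    measurability of G that the exchange of integrals requires.\<close>
  have [measurable]: "heat_M M A \<in> borel_measurable borel"
    by (rule borel_measurable_antimono_ennreal) (rule heat_M_antimono)
  define G where "G x s = (if 0 < s \<and> heat_M M A s \<le> ennreal (y x) then ennreal (y x / s\<^sup>2) else 0)" for x s
  have Gm: "case_prod G \<in> borel_measurable (M \<Otimes>\<^sub>M lborel)"
    unfolding G_def case_prod_beta' by measurable
  interpret pair_sigma_finite M lborel
    using sig sigma_finite_lborel by (intro pair_sigma_finite.intro)
  \<comment> \<open>This is \<psi>/E, continued by 0 to the left so that it is monotone on the whole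
    line.\<close>
  define \<eta> where "\<eta> s = (if 0 < s then ((u - sgr s u) \<bullet> u) / E else 0)" for s
  have inner: "(\<integral>\<^sup>+x. G x s \<partial>M) \<le> ennreal ((2 * \<eta> (s / 2) - \<eta> s) / s\<^sup>2) * indicator {0<..} s" for s
  proof (cases "0 < s")
    case False
    then show ?thesis by (simp add: G_def)
  next
    case True
    \<comment> \<open>Half the time, because the pointwise bound for T_t f involves M(2 t) =
      M(s).\<close>
    define t where "t = s / 2"
    have t: "0 < t" "0 \<le> t" "2 * t = s" using True by (auto simp: t_def)
    define w where "w = sec M (sgr t u)"
    have w: "w \<in> L2 M" by (simp add: w_def)
    have ew: "emb M w = sgr t u"
      using V_lift_fproj[OF sgr_V_lift[OF uV t(2)]] by (simp add: w_def fproj_apply)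
    obtain m where m: "heat_M M A (2 * t) = ennreal m" "0 \<le> m"
      using fin[of "2 * t"] t by (cases "heat_M M A (2 * t)") auto
    have "AE x in M. (cmod (w x))\<^sup>2 \<le> E * m"
      unfolding w_def E_def by (rule AE_heat_bound[OF b(1) uV t(1) m])
    then have "AE x in M. G x s \<le> ennreal ((cmod (f x - w x))\<^sup>2 * (1 / (E * s\<^sup>2)))"
    proof eventually_elim
      fix x assume wx: "(cmod (w x))\<^sup>2 \<le> E * m"
      show "G x s \<le> ennreal ((cmod (f x - w x))\<^sup>2 * (1 / (E * s\<^sup>2)))"
      proof (cases "heat_M M A s \<le> ennreal (y x)")
        case le: True
        \<comment> \<open>Where G is nonzero, |T_t f|^2 \<le> E M(s) \<le> E y = |f|^2/4. The factor
          4 in y is chosen for this, and the triangle inequality then gives |f|/2 \<le> |f - T_t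
          f|.\<close>
        have "m \<le> y x" using le m y0[of x] by (simp add: t(3))
        then have "E * m \<le> (cmod (f x))\<^sup>2 / 4" using E by (simp add: y_def field_simps)
        with wx have "(cmod (w x))\<^sup>2 \<le> (cmod (f x) / 2)\<^sup>2" by (simp add: power_divide)
        then have "cmod (w x) \<le> cmod (f x) / 2" by (rule power2_le_imp_le) simp
        moreover have "cmod (f x) \<le> cmod (w x) + cmod (f x - w x)"
          using norm_triangle_ineq[of "w x" "f x - w x"] by simp
        ultimately have "cmod (f x) / 2 \<le> cmod (f x - w x)" by linarith
        then have "(cmod (f x) / 2)\<^sup>2 \<le> (cmod (f x - w x))\<^sup>2" by (rule power_mono) simp
        then have "(cmod (f x) / 2)\<^sup>2 * (1 / (E * s\<^sup>2)) \<le> (cmod (f x - w x))\<^sup>2 * (1 / (E * s\<^sup>2))"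
          using E by (intro mult_right_mono) auto
        moreover have "y x / s\<^sup>2 = (cmod (f x) / 2)\<^sup>2 * (1 / (E * s\<^sup>2))"
          by (simp add: y_def power_divide)
        ultimately show ?thesis using le True by (simp only: G_def if_True simp_thms) (rule ennreal_leI)
      qed (simp add: G_def)
    qed
    then have "(\<integral>\<^sup>+x. G x s \<partial>M) \<le> (\<integral>\<^sup>+x. ennreal ((cmod (f x - w x))\<^sup>2 * (1 / (E * s\<^sup>2))) \<partial>M)"
      by (rule nn_integral_mono_AE)
    also have "\<dots> = ennreal (LINT x|M. (cmod (f x - w x))\<^sup>2 * (1 / (E * s\<^sup>2)))"
      using L2_diff[OF f w] E by (intro nn_integral_eq_integral integrable_mult_left) (auto simp: L2_def)
    also have "(LINT x|M. (cmod (f x - w x))\<^sup>2 * (1 / (E * s\<^sup>2))) = (norm (u - sgr t u))\<^sup>2 * (1 / (E * s\<^sup>2))"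
    proof -
      have "norm (u - sgr t u) = L2_norm M (\<lambda>x. f x - w x)"
        using norm_emb[OF L2_diff[OF f w]] emb_diff[OF f w] by (simp add: u_def ew)
      then have "(norm (u - sgr t u))\<^sup>2 = (LINT x|M. (cmod (f x - w x))\<^sup>2)"
        by (simp add: L2_norm_def)
      then show ?thesis by simp
    qed
    also have "\<dots> = (2 * \<eta> (s / 2) - \<eta> s) / s\<^sup>2"
      unfolding norm_sgr_diff[OF t(2)] t(3) using True E
      by (simp add: \<eta>_def t_def[symmetric] t(1) diff_divide_distrib mult.commute)
    finally show ?thesis using True by simp
  qed
  have \<eta>0: "0 \<le> \<eta> s" for s
    using E sgr_diff_sgr_nonneg[of s u] by (simp add: \<eta>_def)
  have "(\<integral>\<^sup>+x. heat_N M A (ennreal ((cmod (f x))\<^sup>2) / (4 * energy M A f)) \<partial>M)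
      \<le> (\<integral>\<^sup>+x. (\<integral>\<^sup>+s. G x s \<partial>lborel) \<partial>M)"
    unfolding yeq G_def by (intro nn_integral_mono heat_N_le y0)
  also have "\<dots> = (\<integral>\<^sup>+s. (\<integral>\<^sup>+x. G x s \<partial>M) \<partial>lborel)"
    by (rule Fubini'[OF Gm, symmetric])
  also have "\<dots> \<le> (\<integral>\<^sup>+s. ennreal ((2 * \<eta> (s / 2) - \<eta> s) / s\<^sup>2) * indicator {0<..} s \<partial>lborel)"
    by (intro nn_integral_mono inner)
  also have "\<dots> \<le> ennreal (ln 2)"
  proof (rule nn_integral_dilation_difference)
    show "mono \<eta>"
    proof (rule monoI)
      fix s s' :: real assume "s \<le> s'"
      show "\<eta> s \<le> \<eta> s'"
      proof (cases "0 < s")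
        case True
        then have "sgr s' u \<bullet> u \<le> sgr s u \<bullet> u" using \<open>s \<le> s'\<close> by (intro sgr_inner_antimono) auto
        then show ?thesis using True \<open>s \<le> s'\<close> E by (simp add: \<eta>_def inner_diff_left divide_right_mono)
      next
        case False
        then show ?thesis using \<eta>0[of s'] by (simp add: \<eta>_def[of s])
      qed
    qed
    show "0 \<le> \<eta> s" for s by (rule \<eta>0)
    show "\<eta> s \<le> s" if "0 \<le> s" for s
      using sgr_sqrt_graph[OF b(1) that] E that by (simp add: \<eta>_def E_def[symmetric] pos_divide_le_eq)
    show "\<eta> s \<le> (u \<bullet> u) / E" for s
      using E sgr_nonneg[of s u] by (simp add: \<eta>_def inner_diff_left divide_right_mono)
    show "\<eta> s \<le> 2 * \<eta> (s / 2)" if "0 < s" for s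
    proof -
      have "0 \<le> 2 * ((u - sgr (s / 2) u) \<bullet> u) - (u - sgr s u) \<bullet> u"
        using norm_sgr_diff[of "s / 2" u] that zero_le_power2[of "norm (u - sgr (s / 2) u)"] by simp
      then have "(u - sgr s u) \<bullet> u / E \<le> 2 * ((u - sgr (s / 2) u) \<bullet> u) / E"
        using E by (intro divide_right_mono) auto
      then show ?thesis using that by (simp add: \<eta>_def)
    qed
  qed
  finally show ?thesis .
qed

end

theorem theorem1p2:
  fixes M :: "'a measure" and A :: "'a oper" and f :: "'a \<Rightarrow> complex"
  assumes "sigma_finite_measure M"
    and "positive_self_adjoint M A"
    and "\<And>t. 0 < t \<Longrightarrow> heat_L M A t < \<infinity>"
    and "\<And>t. 0 < t \<Longrightarrow> heat_M M A t < \<infinity>"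
    and "f \<in> V_space M A"
    and "\<not> (AE x in M. f x = 0)"
    and "energy M A f < \<infinity>"
  shows "(\<integral>\<^sup>+x. heat_N M A (ennreal ((cmod (f x))\<^sup>2) / (4 * energy M A f)) \<partial>M) \<le> ennreal (ln 2)"
proof -
  interpret psa_operator M A by standard (rule assms(2))
  show ?thesis by (rule heat_sobolev[OF assms(1,4-7)])
qed

end
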